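(* The strict 2-categories ${\tt 2Lei_\infty}\text{-}{\tt Alg}$ (of 2-term Leibniz infinity algebras, infinity morphisms and 2-term $\infty$-homotopies) and ${\tt Lei2Alg}$ (of Leibniz 2-algebras, Leibniz 2-algebra morphisms and Leibniz 2-algebra 2-morphisms) are 2-equivalent.
   Context: $\mathbb K$ is a field of characteristic $0$. **The 2-category ${\tt 2Lei_\infty}\text{-}{\tt Alg}$.** *Objects:* 2-term Leibniz infinity algebras, i.e. graded vector spaces $V=V_0\oplus V_1$ with linear, bilinear, trilinear maps $l_1,l_2,l_3$ on $V$ of degrees $-1,0,1$ such that, for $w,x,y,z\in V_0$, $h,k\in V_1$: (a) $l_1l_2(x,h)=l_2(x,l_1h)$, $l_1l_2(h,x)=l_2(l_1h,x)$; (b) $l_2(l_1h,k)=l_2(h,l_1k)$; (c) $l_1l_3(x,y,z)=l_2(x,l_2(y,z))-l_2(y,l_2(x,z))-l_2(l_2(x,y),z)$; (d) $l_3(x,y,l_1h)=l_2(x,l_2(y,h))-l_2(y,l_2(x,h))-l_2(l_2(x,y),h)$, $l_3(x,l_1h,y)=l_2(x,l_2(h,y))-l_2(h,l_2(x,y))-l_2(l_2(x,h),y)$, $l_3(l_1h,x,y)=l_2(h,l_2(x,y))-l_2(x,l_2(h,y))-l_2(l_2(h,x),y)$; (e) $l_2(l_3(w,x,y),z)+l_2(w,l_3(x,y,z))-l_2(x,l_3(w,y,z))+l_2(y,l_3(w,x,z))-l_3(l_2(w,x),y,z)+l_3(w,l_2(x,y),z)-l_3(x,l_2(w,y),z)-l_3(w,x,l_2(y,z))+l_3(w,y,l_2(x,z))-l_3(x,y,l_2(w,z))=0$.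 *1-morphisms:* infinity morphisms $f=(f_1,f_2):(V,l_i)\to(W,m_i)$: a linear map $f_1:V\to W$ of degree $0$ and a bilinear map $f_2:V\times V\to W$ of degree $1$ such that, for $x,y,z\in V_0$, $h\in V_1$: (a) $m_1f_1h=f_1l_1h$; (b) $m_2(f_1x,f_1y)+m_1f_2(x,y)=f_1l_2(x,y)$; (c) $m_2(f_1x,f_1h)=f_1l_2(x,h)-f_2(x,l_1h)$, $m_2(f_1h,f_1x)=f_1l_2(h,x)-f_2(l_1h,x)$; (d) $m_3(f_1x,f_1y,f_1z)-m_2(f_2(x,y),f_1z)+m_2(f_1x,f_2(y,z))-m_2(f_1y,f_2(x,z))=f_1l_3(x,y,z)+f_2(l_2(x,y),z)-f_2(x,l_2(y,z))+f_2(y,l_2(x,z))$. Composition: $(g\circ f)_1=g_1f_1$, $(g\circ f)_2(x,y)=g_2(f_1x,f_1y)+g_1f_2(x,y)$; identity $(\mathrm{id},0)$. *2-morphisms:* 2-term $\infty$-homotopies $\theta_1:f\Rightarrow g$, i.e. linear maps $\theta_1:V\to W$ of degree $1$ such that, for $x,y\in V_0$, $h\in V_1$: (a) $g_1x-f_1x=m_1\theta_1x$; (b) $g_1h-f_1h=\theta_1l_1h$; (c) $g_2(x,y)-f_2(x,y)=\theta_1l_2(x,y)-m_2(f_1x,\theta_1y)-m_2(\theta_1x,g_1y)$. Vertical composition $\tau_1\circ_1\theta_1=\tau_1+\theta_1$; horizontal composition of $\theta_1:f\Rightarrow g$ ($f,g:V\to W$) and $\tau_1:f'\Rightarrow g'$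 ($f',g':W\to X$): $\tau_1\circ_0\theta_1=g_1'\theta_1+\tau_1f_1=f'_1\theta_1+\tau_1g_1$; identities are zero maps. **The 2-category ${\tt Lei2Alg}$.** A linear category is a category internal to $\mathbb K$-vector spaces (vector space $L_0$ of objects, vector space of morphisms, all structure maps linear); linear functors and (bi-, tri-)linear functors and natural transformations are the corresponding linear ones. *Objects:* Leibniz 2-algebras $(L,[-,-],\mathbf J)$: a linear category $L$ with a bilinear functor $[-,-]:L\times L\to L$ and a trilinear natural transformation (Jacobiator) $\mathbf J_{x,y,z}:[x,[y,z]]\to[[x,y],z]+[y,[x,z]]$, such that for all $w,x,y,z\in L_0$ the following two composites from $[w,[x,[y,z]]]$ to $[[[w,x],y],z]+[[x,[w,y]],z]+[[x,y],[w,z]]+[[w,y],[x,z]]+[y,[[w,x],z]]+[y,[x,[w,z]]]$ coincide (arrows applied in the order listed, identities on the remaining summands understood): (i) $[\mathbf 1_w,\mathbf J_{x,y,z}]$, then $\mathbf J_{w,[x,y],z}+\mathbf J_{w,y,[x,z]}$, then $\mathbf 1+[\mathbf 1_y,\mathbf J_{w,x,z}]$, then $[\mathbf J_{w,x,y},\mathbf 1_z]+\mathbf 1$; (ii) $\mathbf J_{w,x,[y,z]}$, then $\mathbf 1+[\mathbf 1_x,\mathbf J_{w,y,z}]$, then $\mathbf J_{[w,x],y,z}+\mathbf J_{x,[w,y],z}+\mathbf J_{x,y,[w,z]}$. *1-morphisms* $(F,\mathbf F):L\to L'$: a linear functor $F:L\to L'$ with a bilinear natural transformation $\mathbf F_{x,y}:[Fx,Fy]\to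 F[x,y]$ such that for all $x,y,z\in L_0$ the following composites $[Fx,[Fy,Fz]]\to F[[x,y],z]+F[y,[x,z]]$ coincide: (i) $\mathbf J_{Fx,Fy,Fz}$, then $[\mathbf F_{x,y},\mathbf 1_{Fz}]+[\mathbf 1_{Fy},\mathbf F_{x,z}]$, then $\mathbf F_{[x,y],z}+\mathbf F_{y,[x,z]}$; (ii) $[\mathbf 1_{Fx},\mathbf F_{y,z}]$, then $\mathbf F_{x,[y,z]}$, then $F\mathbf J_{x,y,z}$. Composition: composition of functors, with structure transformation $[GFx,GFy]\xrightarrow{\mathbf G_{Fx,Fy}}G[Fx,Fy]\xrightarrow{G\mathbf F_{x,y}}GF[x,y]$. *2-morphisms* $\boldsymbol\theta:(F,\mathbf F)\Rightarrow(G,\mathbf G)$: linear natural transformations $\boldsymbol\theta:F\Rightarrow G$ such that $\boldsymbol\theta_{[x,y]}\circ\mathbf F_{x,y}=\mathbf G_{x,y}\circ[\boldsymbol\theta_x,\boldsymbol\theta_y]$ for all $x,y\in L_0$. Horizontal and vertical compositions are those of natural transformations. *)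

theory Defs
  imports "HOL-Algebra.Module"
begin

section \<open>Strict 2-categories\<close>

text \<open>Composites are written in the usual order: \<open>comp1 C g f\<close> is ``g after f'', and likewise for the
  vertical composite \<open>vcomp\<close> and the horizontal composite \<open>hcomp\<close> of 2-cells.\<close>

record ('o, 'm, 'c) two_cat =
  obj :: "'o set"
  arr :: "'m set"
  cell :: "'c set"
  dom1 :: "'m \<Rightarrow> 'o"
  cod1 :: "'m \<Rightarrow> 'o"
  id1 :: "'o \<Rightarrow> 'm"
  comp1 :: "'m \<Rightarrow> 'm \<Rightarrow> 'm"
  src2 :: "'c \<Rightarrow> 'm"
  tgt2 :: "'c \<Rightarrow> 'm"
  id2 :: "'m \<Rightarrow> 'c"
  vcomp :: "'c \<Rightarrow> 'c \<Rightarrow> 'c"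
  hcomp :: "'c \<Rightarrow> 'c \<Rightarrow> 'c"

locale strict_2_category =
  fixes C :: "('o, 'm, 'c) two_cat"
  assumes dom1_closed: "f \<in> arr C \<Longrightarrow> dom1 C f \<in> obj C"
    and cod1_closed: "f \<in> arr C \<Longrightarrow> cod1 C f \<in> obj C"
    and id1_closed: "a \<in> obj C \<Longrightarrow> id1 C a \<in> arr C"
    and dom1_id1: "a \<in> obj C \<Longrightarrow> dom1 C (id1 C a) = a"
    and cod1_id1: "a \<in> obj C \<Longrightarrow> cod1 C (id1 C a) = a"
    and comp1_closed: "\<lbrakk>f \<in> arr C; g \<in> arr C; cod1 C f = dom1 C g\<rbrakk> \<Longrightarrow> comp1 C g f \<in> arr C"
    and dom1_comp1: "\<lbrakk>f \<in> arr C; g \<in> arr C; cod1 C f = dom1 C g\<rbrakk> \<Longrightarrow> dom1 C (comp1 C g f) = dom1 C f"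
    and cod1_comp1: "\<lbrakk>f \<in> arr C; g \<in> arr C; cod1 C f = dom1 C g\<rbrakk> \<Longrightarrow> cod1 C (comp1 C g f) = cod1 C g"
    and comp1_id1_right: "f \<in> arr C \<Longrightarrow> comp1 C f (id1 C (dom1 C f)) = f"
    and comp1_id1_left: "f \<in> arr C \<Longrightarrow> comp1 C (id1 C (cod1 C f)) f = f"
    and comp1_assoc:
      "\<lbrakk>f \<in> arr C; g \<in> arr C; h \<in> arr C; cod1 C f = dom1 C g; cod1 C g = dom1 C h\<rbrakk>
        \<Longrightarrow> comp1 C h (comp1 C g f) = comp1 C (comp1 C h g) f"
    and src2_closed: "\<alpha> \<in> cell C \<Longrightarrow> src2 C \<alpha> \<in> arr C"
    and tgt2_closed: "\<alpha> \<in> cell C \<Longrightarrow> tgt2 C \<alpha> \<in> arr C"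
    and cell_dom1: "\<alpha> \<in> cell C \<Longrightarrow> dom1 C (tgt2 C \<alpha>) = dom1 C (src2 C \<alpha>)"
    and cell_cod1: "\<alpha> \<in> cell C \<Longrightarrow> cod1 C (tgt2 C \<alpha>) = cod1 C (src2 C \<alpha>)"
    and id2_closed: "f \<in> arr C \<Longrightarrow> id2 C f \<in> cell C"
    and src2_id2: "f \<in> arr C \<Longrightarrow> src2 C (id2 C f) = f"
    and tgt2_id2: "f \<in> arr C \<Longrightarrow> tgt2 C (id2 C f) = f"
    and vcomp_closed: "\<lbrakk>\<alpha> \<in> cell C; \<beta> \<in> cell C; tgt2 C \<alpha> = src2 C \<beta>\<rbrakk> \<Longrightarrow> vcomp C \<beta> \<alpha> \<in> cell C"
    and src2_vcomp:
      "\<lbrakk>\<alpha> \<in> cell C; \<beta> \<in> cell C; tgt2 C \<alpha> = src2 C \<beta>\<rbrakk> \<Longrightarrow> src2 C (vcomp C \<beta> \<alpha>) = src2 C \<alpha>"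
    and tgt2_vcomp:
      "\<lbrakk>\<alpha> \<in> cell C; \<beta> \<in> cell C; tgt2 C \<alpha> = src2 C \<beta>\<rbrakk> \<Longrightarrow> tgt2 C (vcomp C \<beta> \<alpha>) = tgt2 C \<beta>"
    and vcomp_id2_right: "\<alpha> \<in> cell C \<Longrightarrow> vcomp C \<alpha> (id2 C (src2 C \<alpha>)) = \<alpha>"
    and vcomp_id2_left: "\<alpha> \<in> cell C \<Longrightarrow> vcomp C (id2 C (tgt2 C \<alpha>)) \<alpha> = \<alpha>"
    and vcomp_assoc:
      "\<lbrakk>\<alpha> \<in> cell C; \<beta> \<in> cell C; \<gamma> \<in> cell C; tgt2 C \<alpha> = src2 C \<beta>; tgt2 C \<beta> = src2 C \<gamma>\<rbrakk>
        \<Longrightarrow> vcomp C \<gamma> (vcomp C \<beta> \<alpha>) = vcomp C (vcomp C \<gamma> \<beta>) \<alpha>"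
    and hcomp_closed:
      "\<lbrakk>\<alpha> \<in> cell C; \<beta> \<in> cell C; cod1 C (src2 C \<alpha>) = dom1 C (src2 C \<beta>)\<rbrakk> \<Longrightarrow> hcomp C \<beta> \<alpha> \<in> cell C"
    and src2_hcomp:
      "\<lbrakk>\<alpha> \<in> cell C; \<beta> \<in> cell C; cod1 C (src2 C \<alpha>) = dom1 C (src2 C \<beta>)\<rbrakk>
        \<Longrightarrow> src2 C (hcomp C \<beta> \<alpha>) = comp1 C (src2 C \<beta>) (src2 C \<alpha>)"
    and tgt2_hcomp:
      "\<lbrakk>\<alpha> \<in> cell C; \<beta> \<in> cell C; cod1 C (src2 C \<alpha>) = dom1 C (src2 C \<beta>)\<rbrakk>
        \<Longrightarrow> tgt2 C (hcomp C \<beta> \<alpha>) = comp1 C (tgt2 C \<beta>) (tgt2 C \<alpha>)"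
    and hcomp_id_right: "\<alpha> \<in> cell C \<Longrightarrow> hcomp C \<alpha> (id2 C (id1 C (dom1 C (src2 C \<alpha>)))) = \<alpha>"
    and hcomp_id_left: "\<alpha> \<in> cell C \<Longrightarrow> hcomp C (id2 C (id1 C (cod1 C (src2 C \<alpha>)))) \<alpha> = \<alpha>"
    and hcomp_assoc:
      "\<lbrakk>\<alpha> \<in> cell C; \<beta> \<in> cell C; \<gamma> \<in> cell C;
        cod1 C (src2 C \<alpha>) = dom1 C (src2 C \<beta>); cod1 C (src2 C \<beta>) = dom1 C (src2 C \<gamma>)\<rbrakk>
        \<Longrightarrow> hcomp C \<gamma> (hcomp C \<beta> \<alpha>) = hcomp C (hcomp C \<gamma> \<beta>) \<alpha>"
    and hcomp_id2:
      "\<lbrakk>f \<in> arr C; g \<in> arr C; cod1 C f = dom1 C g\<rbrakk>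
        \<Longrightarrow> hcomp C (id2 C g) (id2 C f) = id2 C (comp1 C g f)"
    and interchange:
      "\<lbrakk>\<alpha> \<in> cell C; \<alpha>' \<in> cell C; \<beta> \<in> cell C; \<beta>' \<in> cell C;
        tgt2 C \<alpha> = src2 C \<alpha>'; tgt2 C \<beta> = src2 C \<beta>'; cod1 C (src2 C \<alpha>) = dom1 C (src2 C \<beta>)\<rbrakk>
        \<Longrightarrow> hcomp C (vcomp C \<beta>' \<beta>) (vcomp C \<alpha>' \<alpha>) = vcomp C (hcomp C \<beta>' \<alpha>') (hcomp C \<beta> \<alpha>)"

locale strict_2_functor = C: strict_2_category C + D: strict_2_category D
  for C :: "('o, 'm, 'c) two_cat" and D :: "('p, 'n, 'd) two_cat" +
  fixes F0 :: "'o \<Rightarrow> 'p" and F1 :: "'m \<Rightarrow> 'n" and F2 :: "'c \<Rightarrow> 'd"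
  assumes map_obj: "a \<in> obj C \<Longrightarrow> F0 a \<in> obj D"
    and map_arr: "f \<in> arr C \<Longrightarrow> F1 f \<in> arr D"
    and map_cell: "\<alpha> \<in> cell C \<Longrightarrow> F2 \<alpha> \<in> cell D"
    and map_dom1: "f \<in> arr C \<Longrightarrow> dom1 D (F1 f) = F0 (dom1 C f)"
    and map_cod1: "f \<in> arr C \<Longrightarrow> cod1 D (F1 f) = F0 (cod1 C f)"
    and map_src2: "\<alpha> \<in> cell C \<Longrightarrow> src2 D (F2 \<alpha>) = F1 (src2 C \<alpha>)"
    and map_tgt2: "\<alpha> \<in> cell C \<Longrightarrow> tgt2 D (F2 \<alpha>) = F1 (tgt2 C \<alpha>)"
    and map_id1: "a \<in> obj C \<Longrightarrow> F1 (id1 C a) = id1 D (F0 a)"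
    and map_comp1:
      "\<lbrakk>f \<in> arr C; g \<in> arr C; cod1 C f = dom1 C g\<rbrakk> \<Longrightarrow> F1 (comp1 C g f) = comp1 D (F1 g) (F1 f)"
    and map_id2: "f \<in> arr C \<Longrightarrow> F2 (id2 C f) = id2 D (F1 f)"
    and map_vcomp:
      "\<lbrakk>\<alpha> \<in> cell C; \<beta> \<in> cell C; tgt2 C \<alpha> = src2 C \<beta>\<rbrakk> \<Longrightarrow> F2 (vcomp C \<beta> \<alpha>) = vcomp D (F2 \<beta>) (F2 \<alpha>)"
    and map_hcomp:
      "\<lbrakk>\<alpha> \<in> cell C; \<beta> \<in> cell C; cod1 C (src2 C \<alpha>) = dom1 C (src2 C \<beta>)\<rbrakk>
        \<Longrightarrow> F2 (hcomp C \<beta> \<alpha>) = hcomp D (F2 \<beta>) (F2 \<alpha>)"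

locale two_natural_isomorphism =
  F: strict_2_functor C D F0 F1 F2 + G: strict_2_functor C D G0 G1 G2
  for C :: "('o, 'm, 'c) two_cat" and D :: "('p, 'n, 'd) two_cat"
    and F0 F1 F2 G0 G1 G2 +
  fixes \<eta> :: "'o \<Rightarrow> 'n"
  assumes component: "a \<in> obj C \<Longrightarrow> \<eta> a \<in> arr D"
    and component_dom1: "a \<in> obj C \<Longrightarrow> dom1 D (\<eta> a) = F0 a"
    and component_cod1: "a \<in> obj C \<Longrightarrow> cod1 D (\<eta> a) = G0 a"
    and component_iso:
      "a \<in> obj C \<Longrightarrow> \<exists>h\<in>arr D. dom1 D h = G0 a \<and> cod1 D h = F0 a \<and>
        comp1 D h (\<eta> a) = id1 D (F0 a) \<and> comp1 D (\<eta> a) h = id1 D (G0 a)"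
    and natural_arr:
      "f \<in> arr C \<Longrightarrow> comp1 D (G1 f) (\<eta> (dom1 C f)) = comp1 D (\<eta> (cod1 C f)) (F1 f)"
    and natural_cell:
      "\<alpha> \<in> cell C \<Longrightarrow>
        hcomp D (G2 \<alpha>) (id2 D (\<eta> (dom1 C (src2 C \<alpha>)))) =
        hcomp D (id2 D (\<eta> (cod1 C (src2 C \<alpha>)))) (F2 \<alpha>)"

text \<open>2-equivalence in the strict sense: 2-functors in both directions whose two composites are
  2-naturally isomorphic to the identity 2-functors.\<close>

definition two_equivalent :: "('o, 'm, 'c) two_cat \<Rightarrow> ('p, 'n, 'd) two_cat \<Rightarrow> bool" where
  "two_equivalent C D \<longleftrightarrow> strict_2_category C \<and> strict_2_category D \<and>
    (\<exists>F0 F1 F2 G0 G1 G2 \<eta> \<epsilon>.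
      strict_2_functor C D F0 F1 F2 \<and> strict_2_functor D C G0 G1 G2 \<and>
      two_natural_isomorphism C C (G0 \<circ> F0) (G1 \<circ> F1) (G2 \<circ> F2) id id id \<eta> \<and>
      two_natural_isomorphism D D (F0 \<circ> G0) (F1 \<circ> G1) (F2 \<circ> G2) id id id \<epsilon>)"


section \<open>Multilinear maps\<close>

text \<open>Vector spaces are modules over a field, with carrier a subset of an arbitrary type \<open>'a\<close> that
  plays the role of the universe of small sets. The ring multiplication and unit contained in
  the record type \<open>module\<close> are irrelevant.\<close>

definition linear_map ::
  "('k, 'r) ring_scheme \<Rightarrow> ('k, 'a) module \<Rightarrow> ('k, 'a) module \<Rightarrow> ('a \<Rightarrow> 'a) \<Rightarrow> bool" where
  "linear_map K V W f \<longleftrightarrow> f \<in> carrier V \<rightarrow> carrier W \<and>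
    (\<forall>x\<in>carrier V. \<forall>y\<in>carrier V. f (x \<oplus>\<^bsub>V\<^esub> y) = f x \<oplus>\<^bsub>W\<^esub> f y) \<and>
    (\<forall>c\<in>carrier K. \<forall>x\<in>carrier V. f (c \<odot>\<^bsub>V\<^esub> x) = c \<odot>\<^bsub>W\<^esub> f x)"

definition bilinear_map ::
  "('k, 'r) ring_scheme \<Rightarrow> ('k, 'a) module \<Rightarrow> ('k, 'a) module \<Rightarrow> ('k, 'a) module \<Rightarrow>
    ('a \<Rightarrow> 'a \<Rightarrow> 'a) \<Rightarrow> bool" where
  "bilinear_map K U V W f \<longleftrightarrow>
    (\<forall>x\<in>carrier U. linear_map K V W (\<lambda>y. f x y)) \<and>
    (\<forall>y\<in>carrier V. linear_map K U W (\<lambda>x. f x y))"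

definition trilinear_map ::
  "('k, 'r) ring_scheme \<Rightarrow> ('k, 'a) module \<Rightarrow> ('k, 'a) module \<Rightarrow> ('k, 'a) module \<Rightarrow>
    ('k, 'a) module \<Rightarrow> ('a \<Rightarrow> 'a \<Rightarrow> 'a \<Rightarrow> 'a) \<Rightarrow> bool" where
  "trilinear_map K T U V W f \<longleftrightarrow>
    (\<forall>x\<in>carrier T. \<forall>y\<in>carrier U. linear_map K V W (\<lambda>z. f x y z)) \<and>
    (\<forall>x\<in>carrier T. \<forall>z\<in>carrier V. linear_map K U W (\<lambda>y. f x y z)) \<and>
    (\<forall>y\<in>carrier U. \<forall>z\<in>carrier V. linear_map K T W (\<lambda>x. f x y z))"


section \<open>2-term Leibniz infinity algebras\<close>

text \<open>For degree reasons the structure maps have only the following components: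
  \<open>l1 : V1 \<rightarrow> V0\<close>, \<open>l2_00 : V0 \<times> V0 \<rightarrow> V0\<close>, \<open>l2_01 : V0 \<times> V1 \<rightarrow> V1\<close>,
  \<open>l2_10 : V1 \<times> V0 \<rightarrow> V1\<close> and \<open>l3 : V0 \<times> V0 \<times> V0 \<rightarrow> V1\<close>.\<close>

record ('k, 'a) lei_inf =
  deg0 :: "('k, 'a) module"
  deg1 :: "('k, 'a) module"
  l1 :: "'a \<Rightarrow> 'a"
  l2_00 :: "'a \<Rightarrow> 'a \<Rightarrow> 'a"
  l2_01 :: "'a \<Rightarrow> 'a \<Rightarrow> 'a"
  l2_10 :: "'a \<Rightarrow> 'a \<Rightarrow> 'a"
  l3 :: "'a \<Rightarrow> 'a \<Rightarrow> 'a \<Rightarrow> 'a"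

locale leibniz_infinity_algebra =
  V0: module K "deg0 V" + V1: module K "deg1 V"
  for K :: "('k, 'r) ring_scheme" and V :: "('k, 'a) lei_inf" +
  assumes l1_linear: "linear_map K (deg1 V) (deg0 V) (l1 V)"
    and l2_00_bilinear: "bilinear_map K (deg0 V) (deg0 V) (deg0 V) (l2_00 V)"
    and l2_01_bilinear: "bilinear_map K (deg0 V) (deg1 V) (deg1 V) (l2_01 V)"
    and l2_10_bilinear: "bilinear_map K (deg1 V) (deg0 V) (deg1 V) (l2_10 V)"
    and l3_trilinear: "trilinear_map K (deg0 V) (deg0 V) (deg0 V) (deg1 V) (l3 V)"
    and l1_l2_01:
      "\<lbrakk>x \<in> carrier (deg0 V); h \<in> carrier (deg1 V)\<rbrakk> \<Longrightarrow> l1 V (l2_01 V x h) = l2_00 V x (l1 V h)"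
    and l1_l2_10:
      "\<lbrakk>x \<in> carrier (deg0 V); h \<in> carrier (deg1 V)\<rbrakk> \<Longrightarrow> l1 V (l2_10 V h x) = l2_00 V (l1 V h) x"
    and l2_l1:
      "\<lbrakk>h \<in> carrier (deg1 V); k \<in> carrier (deg1 V)\<rbrakk> \<Longrightarrow> l2_01 V (l1 V h) k = l2_10 V h (l1 V k)"
    and l1_l3:
      "\<lbrakk>x \<in> carrier (deg0 V); y \<in> carrier (deg0 V); z \<in> carrier (deg0 V)\<rbrakk> \<Longrightarrow>
        l1 V (l3 V x y z) =
          l2_00 V x (l2_00 V y z) \<ominus>\<^bsub>deg0 V\<^esub> l2_00 V y (l2_00 V x z) \<ominus>\<^bsub>deg0 V\<^esub> l2_00 V (l2_00 V x y) z"
    and l3_l1_third: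
      "\<lbrakk>x \<in> carrier (deg0 V); y \<in> carrier (deg0 V); h \<in> carrier (deg1 V)\<rbrakk> \<Longrightarrow>
        l3 V x y (l1 V h) =
          l2_01 V x (l2_01 V y h) \<ominus>\<^bsub>deg1 V\<^esub> l2_01 V y (l2_01 V x h) \<ominus>\<^bsub>deg1 V\<^esub> l2_01 V (l2_00 V x y) h"
    and l3_l1_second:
      "\<lbrakk>x \<in> carrier (deg0 V); y \<in> carrier (deg0 V); h \<in> carrier (deg1 V)\<rbrakk> \<Longrightarrow>
        l3 V x (l1 V h) y =
          l2_01 V x (l2_10 V h y) \<ominus>\<^bsub>deg1 V\<^esub> l2_10 V h (l2_00 V x y) \<ominus>\<^bsub>deg1 V\<^esub> l2_10 V (l2_01 V x h) y"
    and l3_l1_first: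
      "\<lbrakk>x \<in> carrier (deg0 V); y \<in> carrier (deg0 V); h \<in> carrier (deg1 V)\<rbrakk> \<Longrightarrow>
        l3 V (l1 V h) x y =
          l2_10 V h (l2_00 V x y) \<ominus>\<^bsub>deg1 V\<^esub> l2_01 V x (l2_10 V h y) \<ominus>\<^bsub>deg1 V\<^esub> l2_10 V (l2_10 V h x) y"
    and l3_coherence:
      "\<lbrakk>w \<in> carrier (deg0 V); x \<in> carrier (deg0 V); y \<in> carrier (deg0 V); z \<in> carrier (deg0 V)\<rbrakk> \<Longrightarrow>
        l2_10 V (l3 V w x y) z
          \<oplus>\<^bsub>deg1 V\<^esub> l2_01 V w (l3 V x y z)
          \<ominus>\<^bsub>deg1 V\<^esub> l2_01 V x (l3 V w y z)
          \<oplus>\<^bsub>deg1 V\<^esub> l2_01 V y (l3 V w x z)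
          \<ominus>\<^bsub>deg1 V\<^esub> l3 V (l2_00 V w x) y z
          \<oplus>\<^bsub>deg1 V\<^esub> l3 V w (l2_00 V x y) z
          \<ominus>\<^bsub>deg1 V\<^esub> l3 V x (l2_00 V w y) z
          \<ominus>\<^bsub>deg1 V\<^esub> l3 V w x (l2_00 V y z)
          \<oplus>\<^bsub>deg1 V\<^esub> l3 V w y (l2_00 V x z)
          \<ominus>\<^bsub>deg1 V\<^esub> l3 V x y (l2_00 V w z) = \<zero>\<^bsub>deg1 V\<^esub>"

text \<open>Maps that are components of 1- and 2-morphisms are extensional, so that equality of
  morphisms is equality of their values on the carriers. The linear map \<open>f\<^sub>1\<close> of degree 0
  has the components \<open>f1_0\<close> and \<open>f1_1\<close>.\<close>

record ('k, 'a) lei_inf_mor =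
  inf_dom :: "('k, 'a) lei_inf"
  inf_cod :: "('k, 'a) lei_inf"
  f1_0 :: "'a \<Rightarrow> 'a"
  f1_1 :: "'a \<Rightarrow> 'a"
  f2 :: "'a \<Rightarrow> 'a \<Rightarrow> 'a"

locale leibniz_infinity_morphism =
  V: leibniz_infinity_algebra K V + W: leibniz_infinity_algebra K W
  for K :: "('k, 'r) ring_scheme" and V W :: "('k, 'a) lei_inf" +
  fixes f :: "('k, 'a) lei_inf_mor"
  assumes f1_0_linear: "linear_map K (deg0 V) (deg0 W) (f1_0 f)"
    and f1_1_linear: "linear_map K (deg1 V) (deg1 W) (f1_1 f)"
    and f2_bilinear: "bilinear_map K (deg0 V) (deg0 V) (deg1 W) (f2 f)"
    and f1_0_ext: "f1_0 f \<in> carrier (deg0 V) \<rightarrow>\<^sub>E carrier (deg0 W)"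
    and f1_1_ext: "f1_1 f \<in> carrier (deg1 V) \<rightarrow>\<^sub>E carrier (deg1 W)"
    and f2_ext: "f2 f \<in> carrier (deg0 V) \<rightarrow>\<^sub>E (carrier (deg0 V) \<rightarrow>\<^sub>E carrier (deg1 W))"
    and f1_chain: "h \<in> carrier (deg1 V) \<Longrightarrow> l1 W (f1_1 f h) = f1_0 f (l1 V h)"
    and f1_l2_00:
      "\<lbrakk>x \<in> carrier (deg0 V); y \<in> carrier (deg0 V)\<rbrakk> \<Longrightarrow>
        l2_00 W (f1_0 f x) (f1_0 f y) \<oplus>\<^bsub>deg0 W\<^esub> l1 W (f2 f x y) = f1_0 f (l2_00 V x y)"
    and f1_l2_01:
      "\<lbrakk>x \<in> carrier (deg0 V); h \<in> carrier (deg1 V)\<rbrakk> \<Longrightarrow>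
        l2_01 W (f1_0 f x) (f1_1 f h) = f1_1 f (l2_01 V x h) \<ominus>\<^bsub>deg1 W\<^esub> f2 f x (l1 V h)"
    and f1_l2_10:
      "\<lbrakk>x \<in> carrier (deg0 V); h \<in> carrier (deg1 V)\<rbrakk> \<Longrightarrow>
        l2_10 W (f1_1 f h) (f1_0 f x) = f1_1 f (l2_10 V h x) \<ominus>\<^bsub>deg1 W\<^esub> f2 f (l1 V h) x"
    and f2_coherence:
      "\<lbrakk>x \<in> carrier (deg0 V); y \<in> carrier (deg0 V); z \<in> carrier (deg0 V)\<rbrakk> \<Longrightarrow>
        l3 W (f1_0 f x) (f1_0 f y) (f1_0 f z)
          \<ominus>\<^bsub>deg1 W\<^esub> l2_10 W (f2 f x y) (f1_0 f z)
          \<oplus>\<^bsub>deg1 W\<^esub> l2_01 W (f1_0 f x) (f2 f y z)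
          \<ominus>\<^bsub>deg1 W\<^esub> l2_01 W (f1_0 f y) (f2 f x z) =
        f1_1 f (l3 V x y z)
          \<oplus>\<^bsub>deg1 W\<^esub> f2 f (l2_00 V x y) z
          \<ominus>\<^bsub>deg1 W\<^esub> f2 f x (l2_00 V y z)
          \<oplus>\<^bsub>deg1 W\<^esub> f2 f y (l2_00 V x z)"

record ('k, 'a) lei_inf_homotopy =
  htp_src :: "('k, 'a) lei_inf_mor"
  htp_tgt :: "('k, 'a) lei_inf_mor"
  htp :: "'a \<Rightarrow> 'a"

locale leibniz_infinity_homotopy =
  f: leibniz_infinity_morphism K V W f + g: leibniz_infinity_morphism K V W g
  for K :: "('k, 'r) ring_scheme" and V W :: "('k, 'a) lei_inf" and f g :: "('k, 'a) lei_inf_mor" +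
  fixes \<theta> :: "'a \<Rightarrow> 'a"
  assumes htp_linear: "linear_map K (deg0 V) (deg1 W) \<theta>"
    and htp_ext: "\<theta> \<in> carrier (deg0 V) \<rightarrow>\<^sub>E carrier (deg1 W)"
    and htp_deg0:
      "x \<in> carrier (deg0 V) \<Longrightarrow> f1_0 g x \<ominus>\<^bsub>deg0 W\<^esub> f1_0 f x = l1 W (\<theta> x)"
    and htp_deg1:
      "h \<in> carrier (deg1 V) \<Longrightarrow> f1_1 g h \<ominus>\<^bsub>deg1 W\<^esub> f1_1 f h = \<theta> (l1 V h)"
    and htp_f2:
      "\<lbrakk>x \<in> carrier (deg0 V); y \<in> carrier (deg0 V)\<rbrakk> \<Longrightarrow>
        f2 g x y \<ominus>\<^bsub>deg1 W\<^esub> f2 f x y =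
          \<theta> (l2_00 V x y) \<ominus>\<^bsub>deg1 W\<^esub> l2_01 W (f1_0 f x) (\<theta> y) \<ominus>\<^bsub>deg1 W\<^esub> l2_10 W (\<theta> x) (f1_0 g y)"

definition lei_inf_id :: "('k, 'a) lei_inf \<Rightarrow> ('k, 'a) lei_inf_mor" where
  "lei_inf_id V = \<lparr>inf_dom = V, inf_cod = V,
    f1_0 = (\<lambda>x\<in>carrier (deg0 V). x),
    f1_1 = (\<lambda>h\<in>carrier (deg1 V). h),
    f2 = (\<lambda>x\<in>carrier (deg0 V). \<lambda>y\<in>carrier (deg0 V). \<zero>\<^bsub>deg1 V\<^esub>)\<rparr>"

definition lei_inf_comp ::
  "('k, 'a) lei_inf_mor \<Rightarrow> ('k, 'a) lei_inf_mor \<Rightarrow> ('k, 'a) lei_inf_mor" where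
  "lei_inf_comp g f = \<lparr>inf_dom = inf_dom f, inf_cod = inf_cod g,
    f1_0 = (\<lambda>x\<in>carrier (deg0 (inf_dom f)). f1_0 g (f1_0 f x)),
    f1_1 = (\<lambda>h\<in>carrier (deg1 (inf_dom f)). f1_1 g (f1_1 f h)),
    f2 = (\<lambda>x\<in>carrier (deg0 (inf_dom f)). \<lambda>y\<in>carrier (deg0 (inf_dom f)).
      f2 g (f1_0 f x) (f1_0 f y) \<oplus>\<^bsub>deg1 (inf_cod g)\<^esub> f1_1 g (f2 f x y))\<rparr>"

definition htp_id :: "('k, 'a) lei_inf_mor \<Rightarrow> ('k, 'a) lei_inf_homotopy" where
  "htp_id f = \<lparr>htp_src = f, htp_tgt = f,
    htp = (\<lambda>x\<in>carrier (deg0 (inf_dom f)). \<zero>\<^bsub>deg1 (inf_cod f)\<^esub>)\<rparr>"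

definition htp_vcomp ::
  "('k, 'a) lei_inf_homotopy \<Rightarrow> ('k, 'a) lei_inf_homotopy \<Rightarrow> ('k, 'a) lei_inf_homotopy" where
  "htp_vcomp \<tau> \<theta> = \<lparr>htp_src = htp_src \<theta>, htp_tgt = htp_tgt \<tau>,
    htp = (\<lambda>x\<in>carrier (deg0 (inf_dom (htp_src \<theta>))).
      htp \<tau> x \<oplus>\<^bsub>deg1 (inf_cod (htp_src \<theta>))\<^esub> htp \<theta> x)\<rparr>"

text \<open>For \<open>\<theta> : f \<Rightarrow> g\<close> and \<open>\<tau> : f' \<Rightarrow> g'\<close> the horizontal composite is \<open>g'\<^sub>1 \<theta> + \<tau> f\<^sub>1\<close>,
  which agrees with \<open>f'\<^sub>1 \<theta> + \<tau> g\<^sub>1\<close>.\<close>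

definition htp_hcomp ::
  "('k, 'a) lei_inf_homotopy \<Rightarrow> ('k, 'a) lei_inf_homotopy \<Rightarrow> ('k, 'a) lei_inf_homotopy" where
  "htp_hcomp \<tau> \<theta> = \<lparr>
    htp_src = lei_inf_comp (htp_src \<tau>) (htp_src \<theta>),
    htp_tgt = lei_inf_comp (htp_tgt \<tau>) (htp_tgt \<theta>),
    htp = (\<lambda>x\<in>carrier (deg0 (inf_dom (htp_src \<theta>))).
      f1_1 (htp_tgt \<tau>) (htp \<theta> x) \<oplus>\<^bsub>deg1 (inf_cod (htp_src \<tau>))\<^esub> htp \<tau> (f1_0 (htp_src \<theta>) x))\<rparr>"

definition two_Lei_inf_Alg ::
  "('k, 'r) ring_scheme \<Rightarrow>
    (('k, 'a) lei_inf, ('k, 'a) lei_inf_mor, ('k, 'a) lei_inf_homotopy) two_cat" where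
  "two_Lei_inf_Alg K = \<lparr>
    obj = {V. leibniz_infinity_algebra K V},
    arr = {f. leibniz_infinity_morphism K (inf_dom f) (inf_cod f) f},
    cell = {\<theta>.
      inf_dom (htp_tgt \<theta>) = inf_dom (htp_src \<theta>) \<and> inf_cod (htp_tgt \<theta>) = inf_cod (htp_src \<theta>) \<and>
      leibniz_infinity_homotopy K (inf_dom (htp_src \<theta>)) (inf_cod (htp_src \<theta>))
        (htp_src \<theta>) (htp_tgt \<theta>) (htp \<theta>)},
    dom1 = inf_dom, cod1 = inf_cod, id1 = lei_inf_id, comp1 = lei_inf_comp,
    src2 = htp_src, tgt2 = htp_tgt, id2 = htp_id, vcomp = htp_vcomp, hcomp = htp_hcomp\<rparr>"


section \<open>Leibniz 2-algebras\<close>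

record ('k, 'a) linear_cat =
  ob :: "('k, 'a) module"
  mo :: "('k, 'a) module"
  src :: "'a \<Rightarrow> 'a"
  tgt :: "'a \<Rightarrow> 'a"
  idm :: "'a \<Rightarrow> 'a"
  cmp :: "'a \<Rightarrow> 'a \<Rightarrow> 'a"  (infixr \<open>\<bullet>\<index>\<close> 70)

text \<open>\<open>g \<bullet> f\<close> is ``g after f''; \<open>cmp_add\<close> and \<open>cmp_smult\<close> express linearity of composition on the
  subspace of composable pairs.\<close>

locale linear_category =
  Ob: module K "ob L" + Mo: module K "mo L"
  for K :: "('k, 'r) ring_scheme" and L :: "('k, 'a, 'z) linear_cat_scheme" (structure) +
  assumes src_linear: "linear_map K (mo L) (ob L) (src L)"
    and tgt_linear: "linear_map K (mo L) (ob L) (tgt L)"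
    and idm_linear: "linear_map K (ob L) (mo L) (idm L)"
    and cmp_closed:
      "\<lbrakk>f \<in> carrier (mo L); g \<in> carrier (mo L); tgt L f = src L g\<rbrakk> \<Longrightarrow> g \<bullet> f \<in> carrier (mo L)"
    and cmp_add:
      "\<lbrakk>f \<in> carrier (mo L); g \<in> carrier (mo L); tgt L f = src L g;
        f' \<in> carrier (mo L); g' \<in> carrier (mo L); tgt L f' = src L g'\<rbrakk> \<Longrightarrow>
        (g \<oplus>\<^bsub>mo L\<^esub> g') \<bullet> (f \<oplus>\<^bsub>mo L\<^esub> f') = (g \<bullet> f) \<oplus>\<^bsub>mo L\<^esub> (g' \<bullet> f')"
    and cmp_smult:
      "\<lbrakk>c \<in> carrier K; f \<in> carrier (mo L); g \<in> carrier (mo L); tgt L f = src L g\<rbrakk> \<Longrightarrow>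
        (c \<odot>\<^bsub>mo L\<^esub> g) \<bullet> (c \<odot>\<^bsub>mo L\<^esub> f) = c \<odot>\<^bsub>mo L\<^esub> (g \<bullet> f)"
    and src_idm: "x \<in> carrier (ob L) \<Longrightarrow> src L (idm L x) = x"
    and tgt_idm: "x \<in> carrier (ob L) \<Longrightarrow> tgt L (idm L x) = x"
    and src_cmp:
      "\<lbrakk>f \<in> carrier (mo L); g \<in> carrier (mo L); tgt L f = src L g\<rbrakk> \<Longrightarrow> src L (g \<bullet> f) = src L f"
    and tgt_cmp:
      "\<lbrakk>f \<in> carrier (mo L); g \<in> carrier (mo L); tgt L f = src L g\<rbrakk> \<Longrightarrow> tgt L (g \<bullet> f) = tgt L g"
    and cmp_idm_right: "f \<in> carrier (mo L) \<Longrightarrow> f \<bullet> idm L (src L f) = f"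
    and cmp_idm_left: "f \<in> carrier (mo L) \<Longrightarrow> idm L (tgt L f) \<bullet> f = f"
    and cmp_assoc:
      "\<lbrakk>f \<in> carrier (mo L); g \<in> carrier (mo L); h \<in> carrier (mo L);
        tgt L f = src L g; tgt L g = src L h\<rbrakk> \<Longrightarrow> h \<bullet> (g \<bullet> f) = (h \<bullet> g) \<bullet> f"

definition linear_functor ::
  "('k, 'r) ring_scheme \<Rightarrow> ('k, 'a, 'y) linear_cat_scheme \<Rightarrow> ('k, 'a, 'z) linear_cat_scheme \<Rightarrow>
    ('a \<Rightarrow> 'a) \<Rightarrow> ('a \<Rightarrow> 'a) \<Rightarrow> bool" where
  "linear_functor K L M F0 F1 \<longleftrightarrow>
    linear_map K (ob L) (ob M) F0 \<and> linear_map K (mo L) (mo M) F1 \<and>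
    (\<forall>f\<in>carrier (mo L). src M (F1 f) = F0 (src L f) \<and> tgt M (F1 f) = F0 (tgt L f)) \<and>
    (\<forall>x\<in>carrier (ob L). F1 (idm L x) = idm M (F0 x)) \<and>
    (\<forall>f\<in>carrier (mo L). \<forall>g\<in>carrier (mo L). tgt L f = src L g \<longrightarrow>
      F1 (g \<bullet>\<^bsub>L\<^esub> f) = F1 g \<bullet>\<^bsub>M\<^esub> F1 f)"

definition bilinear_functor ::
  "('k, 'r) ring_scheme \<Rightarrow> ('k, 'a, 'y) linear_cat_scheme \<Rightarrow> ('k, 'a, 'z) linear_cat_scheme \<Rightarrow>
    ('a \<Rightarrow> 'a \<Rightarrow> 'a) \<Rightarrow> ('a \<Rightarrow> 'a \<Rightarrow> 'a) \<Rightarrow> bool" where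
  "bilinear_functor K L M B0 B1 \<longleftrightarrow>
    bilinear_map K (ob L) (ob L) (ob M) B0 \<and> bilinear_map K (mo L) (mo L) (mo M) B1 \<and>
    (\<forall>f\<in>carrier (mo L). \<forall>g\<in>carrier (mo L).
      src M (B1 f g) = B0 (src L f) (src L g) \<and> tgt M (B1 f g) = B0 (tgt L f) (tgt L g)) \<and>
    (\<forall>x\<in>carrier (ob L). \<forall>y\<in>carrier (ob L). B1 (idm L x) (idm L y) = idm M (B0 x y)) \<and>
    (\<forall>f\<in>carrier (mo L). \<forall>f'\<in>carrier (mo L). \<forall>g\<in>carrier (mo L). \<forall>g'\<in>carrier (mo L).
      tgt L f = src L f' \<and> tgt L g = src L g' \<longrightarrow>
      B1 (f' \<bullet>\<^bsub>L\<^esub> f) (g' \<bullet>\<^bsub>L\<^esub> g) = B1 f' g' \<bullet>\<^bsub>M\<^esub> B1 f g)"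

text \<open>In the following three definitions \<open>S0, S1\<close> and \<open>T0, T1\<close> are the object and morphism parts
  of the source and target functors of the transformation \<open>\<alpha>\<close>.\<close>

definition linear_transformation ::
  "('k, 'r) ring_scheme \<Rightarrow> ('k, 'a, 'y) linear_cat_scheme \<Rightarrow> ('k, 'a, 'z) linear_cat_scheme \<Rightarrow>
    ('a \<Rightarrow> 'a) \<Rightarrow> ('a \<Rightarrow> 'a) \<Rightarrow> ('a \<Rightarrow> 'a) \<Rightarrow> ('a \<Rightarrow> 'a) \<Rightarrow> ('a \<Rightarrow> 'a) \<Rightarrow> bool" where
  "linear_transformation K L M S0 S1 T0 T1 \<alpha> \<longleftrightarrow>
    linear_map K (ob L) (mo M) \<alpha> \<and>
    (\<forall>x\<in>carrier (ob L). src M (\<alpha> x) = S0 x \<and> tgt M (\<alpha> x) = T0 x) \<and>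
    (\<forall>f\<in>carrier (mo L). \<alpha> (tgt L f) \<bullet>\<^bsub>M\<^esub> S1 f = T1 f \<bullet>\<^bsub>M\<^esub> \<alpha> (src L f))"

definition bilinear_transformation ::
  "('k, 'r) ring_scheme \<Rightarrow> ('k, 'a, 'y) linear_cat_scheme \<Rightarrow> ('k, 'a, 'z) linear_cat_scheme \<Rightarrow>
    ('a \<Rightarrow> 'a \<Rightarrow> 'a) \<Rightarrow> ('a \<Rightarrow> 'a \<Rightarrow> 'a) \<Rightarrow> ('a \<Rightarrow> 'a \<Rightarrow> 'a) \<Rightarrow> ('a \<Rightarrow> 'a \<Rightarrow> 'a) \<Rightarrow>
    ('a \<Rightarrow> 'a \<Rightarrow> 'a) \<Rightarrow> bool" where
  "bilinear_transformation K L M S0 S1 T0 T1 \<alpha> \<longleftrightarrow>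
    bilinear_map K (ob L) (ob L) (mo M) \<alpha> \<and>
    (\<forall>x\<in>carrier (ob L). \<forall>y\<in>carrier (ob L).
      src M (\<alpha> x y) = S0 x y \<and> tgt M (\<alpha> x y) = T0 x y) \<and>
    (\<forall>f\<in>carrier (mo L). \<forall>g\<in>carrier (mo L).
      \<alpha> (tgt L f) (tgt L g) \<bullet>\<^bsub>M\<^esub> S1 f g = T1 f g \<bullet>\<^bsub>M\<^esub> \<alpha> (src L f) (src L g))"

definition trilinear_transformation ::
  "('k, 'r) ring_scheme \<Rightarrow> ('k, 'a, 'y) linear_cat_scheme \<Rightarrow> ('k, 'a, 'z) linear_cat_scheme \<Rightarrow>
    ('a \<Rightarrow> 'a \<Rightarrow> 'a \<Rightarrow> 'a) \<Rightarrow> ('a \<Rightarrow> 'a \<Rightarrow> 'a \<Rightarrow> 'a) \<Rightarrow>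
    ('a \<Rightarrow> 'a \<Rightarrow> 'a \<Rightarrow> 'a) \<Rightarrow> ('a \<Rightarrow> 'a \<Rightarrow> 'a \<Rightarrow> 'a) \<Rightarrow> ('a \<Rightarrow> 'a \<Rightarrow> 'a \<Rightarrow> 'a) \<Rightarrow> bool" where
  "trilinear_transformation K L M S0 S1 T0 T1 \<alpha> \<longleftrightarrow>
    trilinear_map K (ob L) (ob L) (ob L) (mo M) \<alpha> \<and>
    (\<forall>x\<in>carrier (ob L). \<forall>y\<in>carrier (ob L). \<forall>z\<in>carrier (ob L).
      src M (\<alpha> x y z) = S0 x y z \<and> tgt M (\<alpha> x y z) = T0 x y z) \<and>
    (\<forall>f\<in>carrier (mo L). \<forall>g\<in>carrier (mo L). \<forall>h\<in>carrier (mo L).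
      \<alpha> (tgt L f) (tgt L g) (tgt L h) \<bullet>\<^bsub>M\<^esub> S1 f g h =
      T1 f g h \<bullet>\<^bsub>M\<^esub> \<alpha> (src L f) (src L g) (src L h))"

text \<open>The bracket is written \<open>\<lbrace>x, y\<rbrace>\<close> on objects and \<open>\<lblot>f, g\<rblot>\<close> on morphisms.\<close>

record ('k, 'a) lei2 = "('k, 'a) linear_cat" +
  br0 :: "'a \<Rightarrow> 'a \<Rightarrow> 'a"  (\<open>\<lbrace>_,/ _\<rbrace>\<index>\<close>)
  br1 :: "'a \<Rightarrow> 'a \<Rightarrow> 'a"  (\<open>\<lblot>_,/ _\<rblot>\<index>\<close>)
  jac :: "'a \<Rightarrow> 'a \<Rightarrow> 'a \<Rightarrow> 'a"

locale leibniz_2_algebra = linear_category K L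
  for K :: "('k, 'r) ring_scheme" and L :: "('k, 'a) lei2" (structure) +
  assumes bracket_functor: "bilinear_functor K L L (br0 L) (br1 L)"
    and jacobiator_transformation:
      "trilinear_transformation K L L
        (\<lambda>x y z. \<lbrace>x, \<lbrace>y, z\<rbrace>\<rbrace>)
        (\<lambda>f g h. \<lblot>f, \<lblot>g, h\<rblot>\<rblot>)
        (\<lambda>x y z. \<lbrace>\<lbrace>x, y\<rbrace>, z\<rbrace> \<oplus>\<^bsub>ob L\<^esub> \<lbrace>y, \<lbrace>x, z\<rbrace>\<rbrace>)
        (\<lambda>f g h. \<lblot>\<lblot>f, g\<rblot>, h\<rblot> \<oplus>\<^bsub>mo L\<^esub> \<lblot>g, \<lblot>f, h\<rblot>\<rblot>)
        (jac L)"
    and jacobiator_coherence: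
      "\<lbrakk>w \<in> carrier (ob L); x \<in> carrier (ob L); y \<in> carrier (ob L); z \<in> carrier (ob L)\<rbrakk> \<Longrightarrow>
        (\<lblot>jac L w x y, idm L z\<rblot> \<oplus>\<^bsub>mo L\<^esub>
            idm L (\<lbrace>\<lbrace>x, y\<rbrace>, \<lbrace>w, z\<rbrace>\<rbrace> \<oplus>\<^bsub>ob L\<^esub> \<lbrace>\<lbrace>w, y\<rbrace>, \<lbrace>x, z\<rbrace>\<rbrace> \<oplus>\<^bsub>ob L\<^esub>
              \<lbrace>y, \<lbrace>\<lbrace>w, x\<rbrace>, z\<rbrace>\<rbrace> \<oplus>\<^bsub>ob L\<^esub> \<lbrace>y, \<lbrace>x, \<lbrace>w, z\<rbrace>\<rbrace>\<rbrace>))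
        \<bullet> (idm L (\<lbrace>\<lbrace>w, \<lbrace>x, y\<rbrace>\<rbrace>, z\<rbrace> \<oplus>\<^bsub>ob L\<^esub> \<lbrace>\<lbrace>x, y\<rbrace>, \<lbrace>w, z\<rbrace>\<rbrace> \<oplus>\<^bsub>ob L\<^esub> \<lbrace>\<lbrace>w, y\<rbrace>, \<lbrace>x, z\<rbrace>\<rbrace>)
            \<oplus>\<^bsub>mo L\<^esub> \<lblot>idm L y, jac L w x z\<rblot>)
        \<bullet> (jac L w \<lbrace>x, y\<rbrace> z \<oplus>\<^bsub>mo L\<^esub> jac L w y \<lbrace>x, z\<rbrace>)
        \<bullet> \<lblot>idm L w, jac L x y z\<rblot>
        =
        (jac L \<lbrace>w, x\<rbrace> y z \<oplus>\<^bsub>mo L\<^esub> jac L x \<lbrace>w, y\<rbrace> z \<oplus>\<^bsub>mo L\<^esub> jac L x y \<lbrace>w, z\<rbrace>)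
        \<bullet> (idm L \<lbrace>\<lbrace>w, x\<rbrace>, \<lbrace>y, z\<rbrace>\<rbrace> \<oplus>\<^bsub>mo L\<^esub> \<lblot>idm L x, jac L w y z\<rblot>)
        \<bullet> jac L w x \<lbrace>y, z\<rbrace>"

record ('k, 'a) lei2_mor =
  mor_dom :: "('k, 'a) lei2"
  mor_cod :: "('k, 'a) lei2"
  fun0 :: "'a \<Rightarrow> 'a"
  fun1 :: "'a \<Rightarrow> 'a"
  str :: "'a \<Rightarrow> 'a \<Rightarrow> 'a"

locale leibniz_2_morphism =
  L: leibniz_2_algebra K L + M: leibniz_2_algebra K M
  for K :: "('k, 'r) ring_scheme" and L M :: "('k, 'a) lei2" +
  fixes F :: "('k, 'a) lei2_mor"
  assumes mor_functor: "linear_functor K L M (fun0 F) (fun1 F)"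
    and fun0_ext: "fun0 F \<in> carrier (ob L) \<rightarrow>\<^sub>E carrier (ob M)"
    and fun1_ext: "fun1 F \<in> carrier (mo L) \<rightarrow>\<^sub>E carrier (mo M)"
    and str_transformation:
      "bilinear_transformation K L M
        (\<lambda>x y. \<lbrace>fun0 F x, fun0 F y\<rbrace>\<^bsub>M\<^esub>) (\<lambda>f g. \<lblot>fun1 F f, fun1 F g\<rblot>\<^bsub>M\<^esub>)
        (\<lambda>x y. fun0 F \<lbrace>x, y\<rbrace>\<^bsub>L\<^esub>) (\<lambda>f g. fun1 F \<lblot>f, g\<rblot>\<^bsub>L\<^esub>)
        (str F)"
    and str_ext: "str F \<in> carrier (ob L) \<rightarrow>\<^sub>E (carrier (ob L) \<rightarrow>\<^sub>E carrier (mo M))"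
    and str_coherence:
      "\<lbrakk>x \<in> carrier (ob L); y \<in> carrier (ob L); z \<in> carrier (ob L)\<rbrakk> \<Longrightarrow>
        (str F \<lbrace>x, y\<rbrace>\<^bsub>L\<^esub> z \<oplus>\<^bsub>mo M\<^esub> str F y \<lbrace>x, z\<rbrace>\<^bsub>L\<^esub>)
        \<bullet>\<^bsub>M\<^esub> (\<lblot>str F x y, idm M (fun0 F z)\<rblot>\<^bsub>M\<^esub> \<oplus>\<^bsub>mo M\<^esub> \<lblot>idm M (fun0 F y), str F x z\<rblot>\<^bsub>M\<^esub>)
        \<bullet>\<^bsub>M\<^esub> jac M (fun0 F x) (fun0 F y) (fun0 F z)
        =
        fun1 F (jac L x y z)
        \<bullet>\<^bsub>M\<^esub> str F x \<lbrace>y, z\<rbrace>\<^bsub>L\<^esub>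
        \<bullet>\<^bsub>M\<^esub> \<lblot>idm M (fun0 F x), str F y z\<rblot>\<^bsub>M\<^esub>"

record ('k, 'a) lei2_cell =
  cell_src :: "('k, 'a) lei2_mor"
  cell_tgt :: "('k, 'a) lei2_mor"
  trf :: "'a \<Rightarrow> 'a"

locale leibniz_2_transformation =
  F: leibniz_2_morphism K L M F + G: leibniz_2_morphism K L M G
  for K :: "('k, 'r) ring_scheme" and L M :: "('k, 'a) lei2" and F G :: "('k, 'a) lei2_mor" +
  fixes \<theta> :: "'a \<Rightarrow> 'a"
  assumes transformation:
      "linear_transformation K L M (fun0 F) (fun1 F) (fun0 G) (fun1 G) \<theta>"
    and trf_ext: "\<theta> \<in> carrier (ob L) \<rightarrow>\<^sub>E carrier (mo M)"
    and trf_coherence: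
      "\<lbrakk>x \<in> carrier (ob L); y \<in> carrier (ob L)\<rbrakk> \<Longrightarrow>
        \<theta> \<lbrace>x, y\<rbrace>\<^bsub>L\<^esub> \<bullet>\<^bsub>M\<^esub> str F x y = str G x y \<bullet>\<^bsub>M\<^esub> \<lblot>\<theta> x, \<theta> y\<rblot>\<^bsub>M\<^esub>"

definition lei2_id :: "('k, 'a) lei2 \<Rightarrow> ('k, 'a) lei2_mor" where
  "lei2_id L = \<lparr>mor_dom = L, mor_cod = L,
    fun0 = (\<lambda>x\<in>carrier (ob L). x),
    fun1 = (\<lambda>f\<in>carrier (mo L). f),
    str = (\<lambda>x\<in>carrier (ob L). \<lambda>y\<in>carrier (ob L). idm L \<lbrace>x, y\<rbrace>\<^bsub>L\<^esub>)\<rparr>"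

definition lei2_comp :: "('k, 'a) lei2_mor \<Rightarrow> ('k, 'a) lei2_mor \<Rightarrow> ('k, 'a) lei2_mor" where
  "lei2_comp G F = \<lparr>mor_dom = mor_dom F, mor_cod = mor_cod G,
    fun0 = (\<lambda>x\<in>carrier (ob (mor_dom F)). fun0 G (fun0 F x)),
    fun1 = (\<lambda>f\<in>carrier (mo (mor_dom F)). fun1 G (fun1 F f)),
    str = (\<lambda>x\<in>carrier (ob (mor_dom F)). \<lambda>y\<in>carrier (ob (mor_dom F)).
      fun1 G (str F x y) \<bullet>\<^bsub>mor_cod G\<^esub> str G (fun0 F x) (fun0 F y))\<rparr>"

definition trf_id :: "('k, 'a) lei2_mor \<Rightarrow> ('k, 'a) lei2_cell" where
  "trf_id F = \<lparr>cell_src = F, cell_tgt = F,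
    trf = (\<lambda>x\<in>carrier (ob (mor_dom F)). idm (mor_cod F) (fun0 F x))\<rparr>"

definition trf_vcomp :: "('k, 'a) lei2_cell \<Rightarrow> ('k, 'a) lei2_cell \<Rightarrow> ('k, 'a) lei2_cell" where
  "trf_vcomp \<tau> \<theta> = \<lparr>cell_src = cell_src \<theta>, cell_tgt = cell_tgt \<tau>,
    trf = (\<lambda>x\<in>carrier (ob (mor_dom (cell_src \<theta>))).
      trf \<tau> x \<bullet>\<^bsub>mor_cod (cell_src \<theta>)\<^esub> trf \<theta> x)\<rparr>"

text \<open>For \<open>\<theta> : F \<Rightarrow> G\<close> and \<open>\<tau> : F' \<Rightarrow> G'\<close> the horizontal composite at \<open>x\<close> is
  \<open>F' F x \<rightarrow> F' G x \<rightarrow> G' G x\<close>.\<close>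

definition trf_hcomp :: "('k, 'a) lei2_cell \<Rightarrow> ('k, 'a) lei2_cell \<Rightarrow> ('k, 'a) lei2_cell" where
  "trf_hcomp \<tau> \<theta> = \<lparr>
    cell_src = lei2_comp (cell_src \<tau>) (cell_src \<theta>),
    cell_tgt = lei2_comp (cell_tgt \<tau>) (cell_tgt \<theta>),
    trf = (\<lambda>x\<in>carrier (ob (mor_dom (cell_src \<theta>))).
      trf \<tau> (fun0 (cell_tgt \<theta>) x) \<bullet>\<^bsub>mor_cod (cell_src \<tau>)\<^esub> fun1 (cell_src \<tau>) (trf \<theta> x))\<rparr>"

definition Lei2Alg ::
  "('k, 'r) ring_scheme \<Rightarrow> (('k, 'a) lei2, ('k, 'a) lei2_mor, ('k, 'a) lei2_cell) two_cat" where
  "Lei2Alg K = \<lparr>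
    obj = {L. leibniz_2_algebra K L},
    arr = {F. leibniz_2_morphism K (mor_dom F) (mor_cod F) F},
    cell = {\<theta>.
      mor_dom (cell_tgt \<theta>) = mor_dom (cell_src \<theta>) \<and> mor_cod (cell_tgt \<theta>) = mor_cod (cell_src \<theta>) \<and>
      leibniz_2_transformation K (mor_dom (cell_src \<theta>)) (mor_cod (cell_src \<theta>))
        (cell_src \<theta>) (cell_tgt \<theta>) (trf \<theta>)},
    dom1 = mor_dom, cod1 = mor_cod, id1 = lei2_id, comp1 = lei2_comp,
    src2 = cell_src, tgt2 = cell_tgt, id2 = trf_id, vcomp = trf_vcomp, hcomp = trf_hcomp\<rparr>"

end

theory Submission
  imports Defs "HOL-Algebra.Free_Abelian_Groups"
begin

text \<open>
A linear category is determined by the 2-term chain complex that consists of its space of objects and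
of the kernel of its source map. A morphism \<open>f\<close> is the pair of its source and its
\<^emph>\<open>arrow part\<close> \<open>f - 1\<^bsub>src f\<^esub>\<close>, which lies in that kernel, and linearity of composition forces
the arrow part of a composite to be the sum of the arrow parts. Every equation between
composites of morphisms with equal sources is therefore an additive equation between arrow parts. Read
in this way, the axioms of a Leibniz 2-algebra become those of a 2-term Leibniz infinity algebra, with
\<open>l\<^sub>1\<close> the target map, \<open>l\<^sub>2\<close> the bracket with identities, and \<open>l\<^sub>3\<close> minus the arrow part of the Jacobiator.
In the same way \<open>f\<^sub>2\<close> is the arrow part of the structure transformation of a morphism, and a homotopy
is the arrow part of a 2-cell.

The 2-functor that is built explicitly is this kernel functor, from Leibniz 2-algebras to Leibniz
infinity algebras (\<open>kernel_algebra\<close>, \<open>kernel_mor\<close>, \<open>kernel_cell\<close>). It is bijective on 1-cells between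
two given algebras and on 2-cells between two given 1-cells, because adding back the identity of the source
recovers a morphism from its arrow part (\<open>extend_mor\<close>, \<open>extend_cell\<close>; the result is
\<open>kernel_hom_transport\<close>). Such bijections have three consequences, all contained in
the locale \<open>hom_transport\<close>: the laws of a strict 2-category hold for Leibniz 2-algebras because they hold for Leibniz
infinity algebras, where 2-cells compose by addition; the kernel functor is a strict 2-functor; and
it is a 2-equivalence as soon as every Leibniz infinity algebra is isomorphic to a kernel
(\<open>two_equivalent_if_dense\<close>).

For the last point, a Leibniz infinity algebra \<open>V\<close> gives a Leibniz 2-algebra with \<open>V\<^sub>0\<close> as objects and
\<open>V\<^sub>0 \<oplus> V\<^sub>1\<close> as morphisms. All carriers are subsets of one type \<open>'a\<close>, so the pairs have to be encoded in \<open>'a\<close>.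
This is where characteristic 0 enters. If \<open>'a\<close> is infinite, it has as many elements as
\<open>'a \<times> 'a\<close>; if it is finite, every vector space in \<open>'a\<close> is zero, since a nonzero vector has infinitely many
multiples (\<open>exists_pair_encoding\<close>).

Beyond this, what has to be proved are identities between sums of many terms in abelian groups that are
given by a carrier set. They are reduced to identities in a free abelian group, where the simplifier
decides them (\<open>formal_eqI\<close>, \<open>formal_eqI_from\<close>).
\<close>

section \<open>Transport of a 2-category structure along bijections of hom-categories\<close>

text \<open>The maps \<open>lift1\<close> and \<open>lift2\<close> are inverse to \<open>G1\<close> and \<open>G2\<close> on 1-cells with given end points and on
  2-cells with given boundary. The structure \<open>D\<close> is a bare record; its identities and
  composites are the lifts of those of \<open>C\<close>, which is all that is needed to turn it into a 2-category.\<close>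

locale hom_transport = C: strict_2_category C
  for C :: "('o, 'm, 'c) two_cat" +
  fixes D :: "('p, 'n, 'd) two_cat"
    and G0 :: "'p \<Rightarrow> 'o" and G1 :: "'n \<Rightarrow> 'm" and G2 :: "'d \<Rightarrow> 'c"
    and lift1 :: "'p \<Rightarrow> 'p \<Rightarrow> 'm \<Rightarrow> 'n" and lift2 :: "'n \<Rightarrow> 'n \<Rightarrow> 'c \<Rightarrow> 'd"
  assumes G0_obj: "a \<in> obj D \<Longrightarrow> G0 a \<in> obj C"
    and arr_dom1: "f \<in> arr D \<Longrightarrow> dom1 D f \<in> obj D"
    and arr_cod1: "f \<in> arr D \<Longrightarrow> cod1 D f \<in> obj D"
    and G1_arr: "f \<in> arr D \<Longrightarrow> G1 f \<in> arr C"
    and dom1_G1: "f \<in> arr D \<Longrightarrow> dom1 C (G1 f) = G0 (dom1 D f)"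
    and cod1_G1: "f \<in> arr D \<Longrightarrow> cod1 C (G1 f) = G0 (cod1 D f)"
    and lift1_G1: "f \<in> arr D \<Longrightarrow> lift1 (dom1 D f) (cod1 D f) (G1 f) = f"
    and lift1:
      "\<lbrakk>a \<in> obj D; b \<in> obj D; m \<in> arr C; dom1 C m = G0 a; cod1 C m = G0 b\<rbrakk> \<Longrightarrow>
        lift1 a b m \<in> arr D \<and> dom1 D (lift1 a b m) = a \<and> cod1 D (lift1 a b m) = b \<and>
        G1 (lift1 a b m) = m"
    and id1_lift: "a \<in> obj D \<Longrightarrow> id1 D a = lift1 a a (id1 C (G0 a))"
    and comp1_lift:
      "\<lbrakk>f \<in> arr D; g \<in> arr D; cod1 D f = dom1 D g\<rbrakk> \<Longrightarrow>
        comp1 D g f = lift1 (dom1 D f) (cod1 D g) (comp1 C (G1 g) (G1 f))"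
    and cell_src2: "\<alpha> \<in> cell D \<Longrightarrow> src2 D \<alpha> \<in> arr D"
    and cell_tgt2: "\<alpha> \<in> cell D \<Longrightarrow> tgt2 D \<alpha> \<in> arr D"
    and cell_parallel: "\<alpha> \<in> cell D \<Longrightarrow> dom1 D (tgt2 D \<alpha>) = dom1 D (src2 D \<alpha>) \<and>
      cod1 D (tgt2 D \<alpha>) = cod1 D (src2 D \<alpha>)"
    and G2_cell: "\<alpha> \<in> cell D \<Longrightarrow> G2 \<alpha> \<in> cell C"
    and src2_G2: "\<alpha> \<in> cell D \<Longrightarrow> src2 C (G2 \<alpha>) = G1 (src2 D \<alpha>)"
    and tgt2_G2: "\<alpha> \<in> cell D \<Longrightarrow> tgt2 C (G2 \<alpha>) = G1 (tgt2 D \<alpha>)"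
    and lift2_G2: "\<alpha> \<in> cell D \<Longrightarrow> lift2 (src2 D \<alpha>) (tgt2 D \<alpha>) (G2 \<alpha>) = \<alpha>"
    and lift2:
      "\<lbrakk>f \<in> arr D; g \<in> arr D; dom1 D g = dom1 D f; cod1 D g = cod1 D f;
        \<gamma> \<in> cell C; src2 C \<gamma> = G1 f; tgt2 C \<gamma> = G1 g\<rbrakk> \<Longrightarrow>
        lift2 f g \<gamma> \<in> cell D \<and> src2 D (lift2 f g \<gamma>) = f \<and> tgt2 D (lift2 f g \<gamma>) = g \<and>
        G2 (lift2 f g \<gamma>) = \<gamma>"
    and id2_lift: "f \<in> arr D \<Longrightarrow> id2 D f = lift2 f f (id2 C (G1 f))"
    and vcomp_lift:
      "\<lbrakk>\<alpha> \<in> cell D; \<beta> \<in> cell D; tgt2 D \<alpha> = src2 D \<beta>\<rbrakk> \<Longrightarrow>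
        vcomp D \<beta> \<alpha> = lift2 (src2 D \<alpha>) (tgt2 D \<beta>) (vcomp C (G2 \<beta>) (G2 \<alpha>))"
    and hcomp_lift:
      "\<lbrakk>\<alpha> \<in> cell D; \<beta> \<in> cell D; cod1 D (src2 D \<alpha>) = dom1 D (src2 D \<beta>)\<rbrakk> \<Longrightarrow>
        hcomp D \<beta> \<alpha> = lift2 (comp1 D (src2 D \<beta>) (src2 D \<alpha>)) (comp1 D (tgt2 D \<beta>) (tgt2 D \<alpha>))
          (hcomp C (G2 \<beta>) (G2 \<alpha>))"
begin

lemmas C_closed = C.dom1_closed C.cod1_closed C.id1_closed C.dom1_id1 C.cod1_id1
  C.comp1_closed C.dom1_comp1 C.cod1_comp1 C.src2_closed C.tgt2_closed C.cell_dom1 C.cell_cod1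
  C.id2_closed C.src2_id2 C.tgt2_id2 C.vcomp_closed C.src2_vcomp C.tgt2_vcomp
  C.hcomp_closed C.src2_hcomp C.tgt2_hcomp

lemmas D_closed = arr_dom1 arr_cod1 cell_src2 cell_tgt2
  cell_parallel[THEN conjunct1] cell_parallel[THEN conjunct2]

lemmas G_closed = G0_obj G1_arr dom1_G1 cod1_G1 G2_cell src2_G2 tgt2_G2

lemma id1_D:
  assumes "a \<in> obj D"
  shows "id1 D a \<in> arr D" "dom1 D (id1 D a) = a" "cod1 D (id1 D a) = a"
    "G1 (id1 D a) = id1 C (G0 a)"
  using lift1[of a a "id1 C (G0 a)"] assms by (simp_all add: id1_lift C_closed G_closed)

lemma comp1_D:
  assumes "f \<in> arr D" "g \<in> arr D" "cod1 D f = dom1 D g"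
  shows "comp1 D g f \<in> arr D" "dom1 D (comp1 D g f) = dom1 D f" "cod1 D (comp1 D g f) = cod1 D g"
    "G1 (comp1 D g f) = comp1 C (G1 g) (G1 f)"
  using lift1[of "dom1 D f" "cod1 D g" "comp1 C (G1 g) (G1 f)"] assms
  by (simp_all add: comp1_lift C_closed G_closed D_closed)

lemma id2_D:
  assumes "f \<in> arr D"
  shows "id2 D f \<in> cell D" "src2 D (id2 D f) = f" "tgt2 D (id2 D f) = f"
    "G2 (id2 D f) = id2 C (G1 f)"
  using lift2[of f f "id2 C (G1 f)"] assms by (simp_all add: id2_lift C_closed G_closed)

lemma vcomp_D:
  assumes "\<alpha> \<in> cell D" "\<beta> \<in> cell D" "tgt2 D \<alpha> = src2 D \<beta>"
  shows "vcomp D \<beta> \<alpha> \<in> cell D" "src2 D (vcomp D \<beta> \<alpha>) = src2 D \<alpha>"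
    "tgt2 D (vcomp D \<beta> \<alpha>) = tgt2 D \<beta>" "G2 (vcomp D \<beta> \<alpha>) = vcomp C (G2 \<beta>) (G2 \<alpha>)"
proof -
  have "dom1 D (tgt2 D \<beta>) = dom1 D (src2 D \<alpha>)" "cod1 D (tgt2 D \<beta>) = cod1 D (src2 D \<alpha>)"
    using cell_parallel[OF assms(1)] cell_parallel[OF assms(2)] assms(3) by simp_all
  then show "vcomp D \<beta> \<alpha> \<in> cell D" "src2 D (vcomp D \<beta> \<alpha>) = src2 D \<alpha>"
    "tgt2 D (vcomp D \<beta> \<alpha>) = tgt2 D \<beta>" "G2 (vcomp D \<beta> \<alpha>) = vcomp C (G2 \<beta>) (G2 \<alpha>)"
    using lift2[of "src2 D \<alpha>" "tgt2 D \<beta>" "vcomp C (G2 \<beta>) (G2 \<alpha>)"] assms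
    by (simp_all add: vcomp_lift C_closed G_closed D_closed)
qed

lemma hcomp_D:
  assumes "\<alpha> \<in> cell D" "\<beta> \<in> cell D" "cod1 D (src2 D \<alpha>) = dom1 D (src2 D \<beta>)"
  shows "hcomp D \<beta> \<alpha> \<in> cell D"
    "src2 D (hcomp D \<beta> \<alpha>) = comp1 D (src2 D \<beta>) (src2 D \<alpha>)"
    "tgt2 D (hcomp D \<beta> \<alpha>) = comp1 D (tgt2 D \<beta>) (tgt2 D \<alpha>)"
    "G2 (hcomp D \<beta> \<alpha>) = hcomp C (G2 \<beta>) (G2 \<alpha>)"
  using lift2[of "comp1 D (src2 D \<beta>) (src2 D \<alpha>)" "comp1 D (tgt2 D \<beta>) (tgt2 D \<alpha>)"
      "hcomp C (G2 \<beta>) (G2 \<alpha>)"] assms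
  by (simp_all add: hcomp_lift C_closed G_closed D_closed comp1_D)

text \<open>Every law of \<open>D\<close> is an equation between cells with the same boundary, so these two lemmas reduce
  it to the corresponding law of \<open>C\<close>.\<close>

lemma G1_faithful:
  assumes "f \<in> arr D" "g \<in> arr D" "dom1 D f = dom1 D g" "cod1 D f = cod1 D g" "G1 f = G1 g"
  shows "f = g"
  using lift1_G1[OF assms(1)] lift1_G1[OF assms(2)] assms(3-5) by metis

lemma G2_faithful:
  assumes "\<alpha> \<in> cell D" "\<beta> \<in> cell D" "src2 D \<alpha> = src2 D \<beta>" "tgt2 D \<alpha> = tgt2 D \<beta>" "G2 \<alpha> = G2 \<beta>"
  shows "\<alpha> = \<beta>"
  using lift2_G2[OF assms(1)] lift2_G2[OF assms(2)] assms(3-5) by metis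

lemmas D_ops = D_closed id1_D(1-3) comp1_D(1-3) id2_D(1-3) vcomp_D(1-3) hcomp_D(1-3)
lemmas G_ops = G_closed id1_D(4) comp1_D(4) id2_D(4) vcomp_D(4) hcomp_D(4)

lemma D_comp1_assoc:
  "\<lbrakk>f \<in> arr D; g \<in> arr D; h \<in> arr D; cod1 D f = dom1 D g; cod1 D g = dom1 D h\<rbrakk>
    \<Longrightarrow> comp1 D h (comp1 D g f) = comp1 D (comp1 D h g) f"
  by (rule G1_faithful) (simp_all add: D_ops G_ops C.comp1_assoc)

lemma D_comp1_id:
  "f \<in> arr D \<Longrightarrow> comp1 D f (id1 D (dom1 D f)) = f"
  "f \<in> arr D \<Longrightarrow> comp1 D (id1 D (cod1 D f)) f = f"
  using C.comp1_id1_right[of "G1 f"] C.comp1_id1_left[of "G1 f"]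
  by (intro G1_faithful; simp add: D_ops G_ops)+

sublocale D: strict_2_category D
proof unfold_locales
  fix \<alpha> assume a: "\<alpha> \<in> cell D"
  show "vcomp D \<alpha> (id2 D (src2 D \<alpha>)) = \<alpha>"
    using a C.vcomp_id2_right[of "G2 \<alpha>"] by (intro G2_faithful) (simp_all add: D_ops G_ops)
  show "vcomp D (id2 D (tgt2 D \<alpha>)) \<alpha> = \<alpha>"
    using a C.vcomp_id2_left[of "G2 \<alpha>"] by (intro G2_faithful) (simp_all add: D_ops G_ops)
  have "comp1 D (tgt2 D \<alpha>) (id1 D (dom1 D (src2 D \<alpha>))) = tgt2 D \<alpha>"
    "comp1 D (id1 D (cod1 D (src2 D \<alpha>))) (tgt2 D \<alpha>) = tgt2 D \<alpha>"
    using D_comp1_id[of "tgt2 D \<alpha>"] a by (simp_all add: D_ops)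
  then show "hcomp D \<alpha> (id2 D (id1 D (dom1 D (src2 D \<alpha>)))) = \<alpha>"
    and "hcomp D (id2 D (id1 D (cod1 D (src2 D \<alpha>)))) \<alpha> = \<alpha>"
    using a C.hcomp_id_right[of "G2 \<alpha>"] C.hcomp_id_left[of "G2 \<alpha>"]
    by (intro G2_faithful; simp add: D_ops G_ops D_comp1_id)+
next
  fix \<alpha> \<beta> \<gamma>
  assume "\<alpha> \<in> cell D" "\<beta> \<in> cell D" "\<gamma> \<in> cell D" "tgt2 D \<alpha> = src2 D \<beta>" "tgt2 D \<beta> = src2 D \<gamma>"
  then show "vcomp D \<gamma> (vcomp D \<beta> \<alpha>) = vcomp D (vcomp D \<gamma> \<beta>) \<alpha>"
    by (intro G2_faithful) (simp_all add: D_ops G_ops C.vcomp_assoc)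
next
  fix \<alpha> \<beta> \<gamma>
  assume "\<alpha> \<in> cell D" "\<beta> \<in> cell D" "\<gamma> \<in> cell D"
    "cod1 D (src2 D \<alpha>) = dom1 D (src2 D \<beta>)" "cod1 D (src2 D \<beta>) = dom1 D (src2 D \<gamma>)"
  then show "hcomp D \<gamma> (hcomp D \<beta> \<alpha>) = hcomp D (hcomp D \<gamma> \<beta>) \<alpha>"
    by (intro G2_faithful) (simp_all add: D_ops G_ops C.hcomp_assoc D_comp1_assoc)
next
  fix f g
  assume "f \<in> arr D" "g \<in> arr D" "cod1 D f = dom1 D g"
  then show "hcomp D (id2 D g) (id2 D f) = id2 D (comp1 D g f)"
    by (intro G2_faithful) (simp_all add: D_ops G_ops C.hcomp_id2)
next
  fix \<alpha> \<alpha>' \<beta> \<beta>'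
  assume "\<alpha> \<in> cell D" "\<alpha>' \<in> cell D" "\<beta> \<in> cell D" "\<beta>' \<in> cell D"
    "tgt2 D \<alpha> = src2 D \<alpha>'" "tgt2 D \<beta> = src2 D \<beta>'" "cod1 D (src2 D \<alpha>) = dom1 D (src2 D \<beta>)"
  moreover from this have "cod1 D (src2 D \<alpha>') = dom1 D (src2 D \<beta>')"
    using cell_parallel by metis
  ultimately show
    "hcomp D (vcomp D \<beta>' \<beta>) (vcomp D \<alpha>' \<alpha>) = vcomp D (hcomp D \<beta>' \<alpha>') (hcomp D \<beta> \<alpha>)"
    by (intro G2_faithful) (simp_all add: D_ops G_ops C.interchange)
qed (simp_all add: D_ops D_comp1_assoc D_comp1_id)

sublocale G: strict_2_functor D C G0 G1 G2
  by unfold_locales (simp_all add: G_ops)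

text \<open>A strict 2-functor that is bijective on hom-categories and reaches every object up to isomorphism
  has a strict quasi-inverse: choose for every \<open>c\<close> an isomorphism \<open>u c : G0 (F0 c) \<rightarrow> c\<close>, conjugate 1- and 2-cells of \<open>C\<close>
  with these, and lift the result to \<open>D\<close>. Conjugation makes \<open>u\<close> natural on the nose, and the
  lifts of the \<open>u (G0 a)\<close> give the other natural isomorphism.\<close>

theorem two_equivalent_if_dense:
  assumes dense: "\<And>c. c \<in> obj C \<Longrightarrow> \<exists>a\<in>obj D. \<exists>u\<in>arr C. \<exists>v\<in>arr C.
    dom1 C u = G0 a \<and> cod1 C u = c \<and> dom1 C v = c \<and> cod1 C v = G0 a \<and>
    comp1 C v u = id1 C (G0 a) \<and> comp1 C u v = id1 C c"
  shows "two_equivalent C D"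
proof -
  define P where "P c a u v \<longleftrightarrow> a \<in> obj D \<and> u \<in> arr C \<and> v \<in> arr C \<and>
    dom1 C u = G0 a \<and> cod1 C u = c \<and> dom1 C v = c \<and> cod1 C v = G0 a \<and>
    comp1 C v u = id1 C (G0 a) \<and> comp1 C u v = id1 C c" for c a u v
  have "\<forall>c\<in>obj C. \<exists>t. P c (fst t) (fst (snd t)) (snd (snd t))"
    using dense by (simp add: P_def) blast
  from bchoice[OF this] obtain t where
    t: "\<And>c. c \<in> obj C \<Longrightarrow> P c (fst (t c)) (fst (snd (t c))) (snd (snd (t c)))" by blast
  define F0 where "F0 c = fst (t c)" for c
  define u where "u c = fst (snd (t c))" for c
  define v where "v c = snd (snd (t c))" for c
  have F0: "F0 c \<in> obj D"
    and u: "u c \<in> arr C" "dom1 C (u c) = G0 (F0 c)" "cod1 C (u c) = c"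
    and v: "v c \<in> arr C" "dom1 C (v c) = c" "cod1 C (v c) = G0 (F0 c)"
    and vu: "comp1 C (v c) (u c) = id1 C (G0 (F0 c))"
    and uv: "comp1 C (u c) (v c) = id1 C c" if "c \<in> obj C" for c
    using t[OF that] by (simp_all add: P_def F0_def u_def v_def)
  note uv_closed = F0 u v

  \<comment> \<open>conjugation with the isomorphisms \<open>u\<close>\<close>
  define conj1 where "conj1 m = comp1 C (v (cod1 C m)) (comp1 C m (u (dom1 C m)))" for m
  define conj2 where "conj2 \<gamma> = hcomp C (id2 C (v (cod1 C (src2 C \<gamma>))))
    (hcomp C \<gamma> (id2 C (u (dom1 C (src2 C \<gamma>)))))" for \<gamma>
  define F1 where "F1 m = lift1 (F0 (dom1 C m)) (F0 (cod1 C m)) (conj1 m)" for m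
  define F2 where "F2 \<gamma> = lift2 (F1 (src2 C \<gamma>)) (F1 (tgt2 C \<gamma>)) (conj2 \<gamma>)" for \<gamma>

  have F1: "F1 m \<in> arr D" "dom1 D (F1 m) = F0 (dom1 C m)" "cod1 D (F1 m) = F0 (cod1 C m)"
    "G1 (F1 m) = conj1 m" if "m \<in> arr C" for m
    using lift1[of "F0 (dom1 C m)" "F0 (cod1 C m)" "conj1 m"] that
    by (simp_all add: F1_def conj1_def C_closed uv_closed)
  have F2: "F2 \<gamma> \<in> cell D" "src2 D (F2 \<gamma>) = F1 (src2 C \<gamma>)" "tgt2 D (F2 \<gamma>) = F1 (tgt2 C \<gamma>)"
    "G2 (F2 \<gamma>) = conj2 \<gamma>" if "\<gamma> \<in> cell C" for \<gamma>
    using lift2[of "F1 (src2 C \<gamma>)" "F1 (tgt2 C \<gamma>)" "conj2 \<gamma>"] that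
    by (simp_all add: F2_def F1 conj2_def conj1_def C_closed uv_closed)

  have u_conj1: "comp1 C (u (cod1 C m)) (conj1 m) = comp1 C m (u (dom1 C m))" if "m \<in> arr C" for m
    using that C.comp1_id1_left[of "comp1 C m (u (dom1 C m))"]
    by (simp add: conj1_def C_closed uv_closed C.comp1_assoc uv)
  have u_conj2: "hcomp C (id2 C (u (cod1 C (src2 C \<gamma>)))) (conj2 \<gamma>) =
      hcomp C \<gamma> (id2 C (u (dom1 C (src2 C \<gamma>))))" if "\<gamma> \<in> cell C" for \<gamma>
    using that C.hcomp_id_left[of "hcomp C \<gamma> (id2 C (u (dom1 C (src2 C \<gamma>))))"]
    by (simp add: conj2_def C_closed uv_closed C.hcomp_assoc C.hcomp_id2 uv)
  \<comment> \<open>\<open>u c\<close> is invertible, so it suffices to compare cells after composition with it\<close>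
  have cancel1: "m = m'"
    if "comp1 C (u c) m = comp1 C (u c) m'" "c \<in> obj C" "m \<in> arr C" "m' \<in> arr C"
      "cod1 C m = G0 (F0 c)" "cod1 C m' = G0 (F0 c)" for c m m'
  proof -
    have *: "comp1 C (v c) (comp1 C (u c) n) = n" if "n \<in> arr C" "cod1 C n = G0 (F0 c)" for n
      using that \<open>c \<in> obj C\<close> C.comp1_id1_left[of n] by (simp add: C.comp1_assoc uv_closed vu)
    show ?thesis using *[of m] *[of m'] that by metis
  qed
  have cancel2: "\<gamma> = \<gamma>'"
    if "hcomp C (id2 C (u c)) \<gamma> = hcomp C (id2 C (u c)) \<gamma>'" "c \<in> obj C" "\<gamma> \<in> cell C" "\<gamma>' \<in> cell C"
      "cod1 C (src2 C \<gamma>) = G0 (F0 c)" "cod1 C (src2 C \<gamma>') = G0 (F0 c)" for c \<gamma> \<gamma>'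
  proof -
    have *: "hcomp C (id2 C (v c)) (hcomp C (id2 C (u c)) \<delta>) = \<delta>"
      if "\<delta> \<in> cell C" "cod1 C (src2 C \<delta>) = G0 (F0 c)" for \<delta>
      using that \<open>c \<in> obj C\<close> C.hcomp_id_left[of \<delta>]
      by (simp add: C.hcomp_assoc C.hcomp_id2 C_closed uv_closed vu)
    show ?thesis using *[of \<gamma>] *[of \<gamma>'] that by metis
  qed
  have conj_closed: "conj1 m \<in> arr C" "dom1 C (conj1 m) = G0 (F0 (dom1 C m))"
    "cod1 C (conj1 m) = G0 (F0 (cod1 C m))" if "m \<in> arr C" for m
    using that by (simp_all add: conj1_def C_closed uv_closed)
  have conj2_closed: "conj2 \<gamma> \<in> cell C" "src2 C (conj2 \<gamma>) = conj1 (src2 C \<gamma>)"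
    "tgt2 C (conj2 \<gamma>) = conj1 (tgt2 C \<gamma>)" if "\<gamma> \<in> cell C" for \<gamma>
    using that by (simp_all add: conj2_def conj1_def C_closed uv_closed)
  note conj_closed = conj_closed conj2_closed

  have conj1_id: "conj1 (id1 C c) = id1 C (G0 (F0 c))" if "c \<in> obj C" for c
    using that C.comp1_id1_left[of "u c"] by (simp add: conj1_def C_closed uv_closed vu)
  have conj1_comp: "conj1 (comp1 C n m) = comp1 C (conj1 n) (conj1 m)"
    if "m \<in> arr C" "n \<in> arr C" "cod1 C m = dom1 C n" for m n
  proof (rule cancel1)
    show "comp1 C (u (cod1 C n)) (conj1 (comp1 C n m)) =
        comp1 C (u (cod1 C n)) (comp1 C (conj1 n) (conj1 m))"
      using that u_conj1[of "comp1 C n m"] u_conj1[of n] u_conj1[of m]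
      by (simp add: C.comp1_assoc C_closed conj_closed uv_closed)
        (simp add: C.comp1_assoc[symmetric] C_closed conj_closed uv_closed)
  qed (use that in \<open>simp_all add: C_closed conj_closed\<close>)
  have conj2_id: "conj2 (id2 C m) = id2 C (conj1 m)" if "m \<in> arr C" for m
    using that by (simp add: conj2_def conj1_def C_closed uv_closed C.hcomp_id2)
  have conj2_vcomp: "conj2 (vcomp C \<delta> \<gamma>) = vcomp C (conj2 \<delta>) (conj2 \<gamma>)"
    if "\<gamma> \<in> cell C" "\<delta> \<in> cell C" "tgt2 C \<gamma> = src2 C \<delta>" for \<gamma> \<delta>
  proof -
    have [simp]: "dom1 C (src2 C \<delta>) = dom1 C (src2 C \<gamma>)" "cod1 C (src2 C \<delta>) = cod1 C (src2 C \<gamma>)"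
      using that C.cell_dom1[of \<gamma>] C.cell_cod1[of \<gamma>] by simp_all
    \<comment> \<open>split the identities on \<open>u\<close> and \<open>v\<close> so that the interchange law applies\<close>
    have idv: "id2 C w = vcomp C (id2 C w) (id2 C w)" if "w \<in> arr C" for w
      using that C.vcomp_id2_right[of "id2 C w"] by (simp add: C_closed)
    have "hcomp C (vcomp C \<delta> \<gamma>) (id2 C (u (dom1 C (src2 C \<gamma>)))) =
        vcomp C (hcomp C \<delta> (id2 C (u (dom1 C (src2 C \<gamma>)))))
          (hcomp C \<gamma> (id2 C (u (dom1 C (src2 C \<gamma>)))))"
      using that by (subst idv) (simp_all add: C.interchange C_closed uv_closed)
    then show ?thesis
      using that unfolding conj2_def
      by (subst idv) (simp_all add: C.interchange C_closed uv_closed)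
  qed
  have conj2_hcomp: "conj2 (hcomp C \<delta> \<gamma>) = hcomp C (conj2 \<delta>) (conj2 \<gamma>)"
    if "\<gamma> \<in> cell C" "\<delta> \<in> cell C" "cod1 C (src2 C \<gamma>) = dom1 C (src2 C \<delta>)" for \<gamma> \<delta>
  proof (rule cancel2)
    show "hcomp C (id2 C (u (cod1 C (src2 C \<delta>)))) (conj2 (hcomp C \<delta> \<gamma>)) =
        hcomp C (id2 C (u (cod1 C (src2 C \<delta>)))) (hcomp C (conj2 \<delta>) (conj2 \<gamma>))"
      using that u_conj2[of "hcomp C \<delta> \<gamma>"] u_conj2[of \<delta>] u_conj2[of \<gamma>]
      by (simp add: C.hcomp_assoc C_closed conj_closed uv_closed)
        (simp add: C.hcomp_assoc[symmetric] C_closed conj_closed uv_closed)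
  qed (use that in \<open>simp_all add: C_closed conj_closed\<close>)
  note conj_ops = conj1_id conj1_comp conj2_id conj2_vcomp conj2_hcomp

  interpret F: strict_2_functor C D F0 F1 F2
  proof unfold_locales
    show "F1 (id1 C a) = id1 D (F0 a)" if "a \<in> obj C" for a
      using that by (intro G1_faithful) (simp_all add: F0 F1 D_ops G_ops C_closed conj_ops)
    show F1_comp: "F1 (comp1 C g f) = comp1 D (F1 g) (F1 f)"
      if "f \<in> arr C" "g \<in> arr C" "cod1 C f = dom1 C g" for f g
      using that by (intro G1_faithful) (simp_all add: F0 F1 D_ops G_ops C_closed conj_ops)
    show "F2 (id2 C f) = id2 D (F1 f)" if "f \<in> arr C" for f
      using that by (intro G2_faithful) (simp_all add: F0 F1 F2 D_ops G_ops C_closed conj_ops)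
    show "F2 (vcomp C \<beta> \<alpha>) = vcomp D (F2 \<beta>) (F2 \<alpha>)"
      if "\<alpha> \<in> cell C" "\<beta> \<in> cell C" "tgt2 C \<alpha> = src2 C \<beta>" for \<alpha> \<beta>
      using that by (intro G2_faithful) (simp_all add: F0 F1 F2 D_ops G_ops C_closed conj_ops)
    show "F2 (hcomp C \<beta> \<alpha>) = hcomp D (F2 \<beta>) (F2 \<alpha>)"
      if "\<alpha> \<in> cell C" "\<beta> \<in> cell C" "cod1 C (src2 C \<alpha>) = dom1 C (src2 C \<beta>)" for \<alpha> \<beta>
      using that
      by (intro G2_faithful) (simp_all add: F0 F1 F2 D_ops G_ops C_closed conj_ops F1_comp)
  qed (simp_all add: F0 F1 F2)

  have \<eta>: "two_natural_isomorphism C C (G0 \<circ> F0) (G1 \<circ> F1) (G2 \<circ> F2) id id id u"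
  proof unfold_locales
    fix c assume "c \<in> obj C"
    then show "\<exists>h\<in>arr C. dom1 C h = id c \<and> cod1 C h = (G0 \<circ> F0) c \<and>
        comp1 C h (u c) = id1 C ((G0 \<circ> F0) c) \<and> comp1 C (u c) h = id1 C (id c)"
      using uv vu v by (intro bexI[of _ "v c"]) simp_all
  qed (simp_all add: F0 F1 F2 D_ops G_ops C_closed conj_ops uv_closed F.map_id1 F.map_comp1
      F.map_id2 F.map_vcomp F.map_hcomp u_conj1 u_conj2 conj_closed)

  define \<epsilon> where "\<epsilon> a = lift1 (F0 (G0 a)) a (u (G0 a))" for a
  have \<epsilon>: "\<epsilon> a \<in> arr D" "dom1 D (\<epsilon> a) = F0 (G0 a)" "cod1 D (\<epsilon> a) = a" "G1 (\<epsilon> a) = u (G0 a)"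
    if "a \<in> obj D" for a
    using lift1[of "F0 (G0 a)" a "u (G0 a)"] that by (simp_all add: \<epsilon>_def G_closed uv_closed)
  have \<epsilon>: "two_natural_isomorphism D D (F0 \<circ> G0) (F1 \<circ> G1) (F2 \<circ> G2) id id id \<epsilon>"
  proof unfold_locales
    fix a assume a: "a \<in> obj D"
    let ?h = "lift1 a (F0 (G0 a)) (v (G0 a))"
    have h: "?h \<in> arr D" "dom1 D ?h = a" "cod1 D ?h = F0 (G0 a)" "G1 ?h = v (G0 a)"
      using lift1[of a "F0 (G0 a)" "v (G0 a)"] a by (simp_all add: G_closed uv_closed)
    have "comp1 D ?h (\<epsilon> a) = id1 D (F0 (G0 a))" "comp1 D (\<epsilon> a) ?h = id1 D a"
      using a h by (intro G1_faithful; simp add: \<epsilon> D_ops G_ops F0 uv vu)+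
    then show "\<exists>h\<in>arr D. dom1 D h = id a \<and> cod1 D h = (F0 \<circ> G0) a \<and>
        comp1 D h (\<epsilon> a) = id1 D ((F0 \<circ> G0) a) \<and> comp1 D (\<epsilon> a) h = id1 D (id a)"
      using h by auto
  next
    fix f assume f: "f \<in> arr D"
    then show "comp1 D (id f) (\<epsilon> (dom1 D f)) = comp1 D (\<epsilon> (cod1 D f)) ((F1 \<circ> G1) f)"
      using u_conj1[of "G1 f"]
      by (intro G1_faithful) (simp_all add: \<epsilon> F1 D_ops G_ops)
  next
    fix \<alpha> assume a: "\<alpha> \<in> cell D"
    have nat: "comp1 D f (\<epsilon> (dom1 D f)) = comp1 D (\<epsilon> (cod1 D f)) (F1 (G1 f))" if "f \<in> arr D" for f
      using u_conj1[of "G1 f"] that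
      by (intro G1_faithful) (simp_all add: \<epsilon> F1 D_ops G_ops)
    show "hcomp D (id \<alpha>) (id2 D (\<epsilon> (dom1 D (src2 D \<alpha>)))) =
         hcomp D (id2 D (\<epsilon> (cod1 D (src2 D \<alpha>)))) ((F2 \<circ> G2) \<alpha>)"
      using a u_conj2[of "G2 \<alpha>"] nat[of "src2 D \<alpha>"] nat[of "tgt2 D \<alpha>"]
      by (intro G2_faithful) (simp_all add: \<epsilon> F1 F2 D_ops G_ops)
  qed (simp_all add: F0 F1 F2 D_ops G_ops C_closed uv_closed \<epsilon> F.map_id1 F.map_comp1
      F.map_id2 F.map_vcomp F.map_hcomp)

  show ?thesis
    unfolding two_equivalent_def
    using F.strict_2_functor_axioms G.strict_2_functor_axioms \<eta> \<epsilon>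
      C.strict_2_category_axioms D.strict_2_category_axioms by blast
qed

end

section \<open>Identities in abelian groups\<close>

text \<open>An element \<open>x\<close> of \<open>G\<close> is represented by a formal sum \<open>p\<close> if it is the value of \<open>p\<close> under evaluation
  of formal sums of elements of \<open>G\<close>. Evaluation is the homomorphism given by the universal property, which
  the definition characterises instead of constructing it.\<close>

definition formal :: "('a, 'm) ring_scheme \<Rightarrow> ('a \<Rightarrow>\<^sub>0 int) \<Rightarrow> 'a \<Rightarrow> bool" where
  "formal G p x \<longleftrightarrow> abelian_group G \<and> x \<in> carrier G \<and> Poly_Mapping.keys p \<subseteq> carrier G \<and>
    (\<forall>h\<in>hom (free_Abelian_group (carrier G)) (add_monoid G).
      (\<forall>a\<in>carrier G. h (frag_of a) = a) \<longrightarrow> h p = x)"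

lemma formal_add:
  assumes "formal G p x" "formal G q y"
  shows "formal G (p + q) (x \<oplus>\<^bsub>G\<^esub> y)"
proof -
  interpret abelian_group G using assms by (simp add: formal_def)
  have "h (p + q) = h p \<oplus>\<^bsub>G\<^esub> h q"
    if "h \<in> hom (free_Abelian_group (carrier G)) (add_monoid G)" for h
    using hom_mult[OF that, of p q] assms by (simp add: formal_def)
  moreover have "Poly_Mapping.keys (p + q) \<subseteq> carrier G"
    using assms keys_add[of p q] unfolding formal_def by blast
  ultimately show ?thesis
    using assms by (simp add: formal_def)
qed

lemma formal_neg:
  assumes "formal G p x"
  shows "formal G (- p) (\<ominus>\<^bsub>G\<^esub> x)"
proof -
  interpret abelian_group G using assms by (simp add: formal_def)
  have "h (- p) = \<ominus>\<^bsub>G\<^esub> h p"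
    if h: "h \<in> hom (free_Abelian_group (carrier G)) (add_monoid G)" for h
  proof -
    interpret h: group_hom "free_Abelian_group (carrier G)" "add_monoid G" h
      using h a_group by (simp add: group_hom_def group_hom_axioms_def)
    show ?thesis
      using h.hom_inv[of p] assms by (simp add: formal_def a_inv_def)
  qed
  then show ?thesis
    using assms by (simp add: formal_def)
qed

lemma formal_minus: "formal G p x \<Longrightarrow> formal G q y \<Longrightarrow> formal G (p - q) (x \<ominus>\<^bsub>G\<^esub> y)"
  using formal_add[OF _ formal_neg, of G p x q y] by (simp add: a_minus_def)

lemma formal_zero: "abelian_group G \<Longrightarrow> formal G 0 \<zero>\<^bsub>G\<^esub>"
proof -
  assume "abelian_group G"
  then interpret abelian_group G .
  have "h 0 = \<zero>\<^bsub>G\<^esub>"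
    if h: "h \<in> hom (free_Abelian_group (carrier G)) (add_monoid G)" for h
    using hom_one[OF h] a_group by simp
  then show ?thesis by (simp add: formal_def abelian_group_axioms)
qed

lemma formal_atom: "abelian_group G \<Longrightarrow> x \<in> carrier G \<Longrightarrow> formal G (frag_of x) x"
  by (simp add: formal_def)

text \<open>Tried in this order, these rules compute a representation from the shape of an expression, and treat
  as an atom whatever is not a sum, a difference, a negative or zero.\<close>

lemmas formal_intros = formal_add formal_minus formal_neg formal_zero formal_atom

lemma formal_unique:
  assumes "formal G p x" "formal G p y"
  shows "x = y"
proof -
  interpret abelian_group G using assms by (simp add: formal_def)
  obtain h where "h \<in> hom (free_Abelian_group (carrier G)) (add_monoid G)"
    and "\<And>a. a \<in> carrier G \<Longrightarrow> h (frag_of a) = a"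
    using comm_group.free_Abelian_group_universal[OF a_comm_group, of "\<lambda>a. a" "carrier G"] by auto
  with assms show ?thesis by (auto simp: formal_def)
qed

lemma formal_eqI: "formal G p x \<Longrightarrow> formal G q y \<Longrightarrow> p = q \<Longrightarrow> x = y"
  by (simp add: formal_unique)

lemma neg_zero [simp]: "abelian_group G \<Longrightarrow> \<ominus>\<^bsub>G\<^esub> \<zero>\<^bsub>G\<^esub> = \<zero>\<^bsub>G\<^esub>"
  by (rule formal_eqI[OF formal_neg[OF formal_zero] formal_zero]) simp_all

text \<open>An equation follows from another one if both have the same formal difference of their sides.\<close>

lemma formal_eqI_from:
  assumes "u = v" "formal G r u" "formal G s v" "formal G p x" "formal G q y" "p - q = r - s"
  shows "x = y"
proof -
  interpret abelian_group G using assms by (simp add: formal_def)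
  have cl: "x \<in> carrier G" "y \<in> carrier G" "u \<in> carrier G" "v \<in> carrier G"
    using assms by (auto simp: formal_def)
  have "x \<ominus>\<^bsub>G\<^esub> y = u \<ominus>\<^bsub>G\<^esub> v"
    using assms by (intro formal_eqI[OF formal_minus formal_minus])
  also have "\<dots> = \<zero>\<^bsub>G\<^esub>" using cl assms(1) minus_eq r_neg by simp
  finally have "\<ominus>\<^bsub>G\<^esub> (\<ominus>\<^bsub>G\<^esub> y) = x"
    using cl by (intro minus_equality) (simp_all add: minus_eq)
  then show ?thesis using cl by simp
qed

section \<open>Linear and multilinear maps\<close>

text \<open>Rewriting with these rules, and their multilinear analogues below, expands an expression
  into a sum of terms without sums inside, which is the form that the comparison of formal sums needs.\<close>

lemma linear_map_simps:
  assumes "module K V" "module K W" and f: "linear_map K V W f"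
  shows "x \<in> carrier V \<Longrightarrow> f x \<in> carrier W"
    and "\<lbrakk>x \<in> carrier V; y \<in> carrier V\<rbrakk> \<Longrightarrow> f (x \<oplus>\<^bsub>V\<^esub> y) = f x \<oplus>\<^bsub>W\<^esub> f y"
    and "x \<in> carrier V \<Longrightarrow> f (\<ominus>\<^bsub>V\<^esub> x) = \<ominus>\<^bsub>W\<^esub> f x"
    and "\<lbrakk>x \<in> carrier V; y \<in> carrier V\<rbrakk> \<Longrightarrow> f (x \<ominus>\<^bsub>V\<^esub> y) = f x \<ominus>\<^bsub>W\<^esub> f y"
    and "f \<zero>\<^bsub>V\<^esub> = \<zero>\<^bsub>W\<^esub>"
    and "\<lbrakk>c \<in> carrier K; x \<in> carrier V\<rbrakk> \<Longrightarrow> f (c \<odot>\<^bsub>V\<^esub> x) = c \<odot>\<^bsub>W\<^esub> f x"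
proof -
  interpret V: module K V by fact
  interpret W: module K W by fact
  have h: "group_hom (add_monoid V) (add_monoid W) f"
    using f V.M.a_group W.M.a_group
    by (auto simp: linear_map_def group_hom_def group_hom_axioms_def hom_def)
  show neg: "f (\<ominus>\<^bsub>V\<^esub> x) = \<ominus>\<^bsub>W\<^esub> f x" if "x \<in> carrier V" for x
    using group_hom.hom_inv[OF h] that by (simp add: a_inv_def)
  show "f \<zero>\<^bsub>V\<^esub> = \<zero>\<^bsub>W\<^esub>"
    using group_hom.hom_one[OF h] by simp
  show "\<lbrakk>x \<in> carrier V; y \<in> carrier V\<rbrakk> \<Longrightarrow> f (x \<ominus>\<^bsub>V\<^esub> y) = f x \<ominus>\<^bsub>W\<^esub> f y"
    using f neg by (simp add: linear_map_def a_minus_def)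
qed (use f in \<open>auto simp: linear_map_def\<close>)

lemma bilinear_map_simps:
  assumes "module K U" "module K V" "module K W" and f: "bilinear_map K U V W f"
  shows "\<lbrakk>x \<in> carrier U; y \<in> carrier V\<rbrakk> \<Longrightarrow> f x y \<in> carrier W"
    and "\<lbrakk>x \<in> carrier U; y \<in> carrier V; y' \<in> carrier V\<rbrakk> \<Longrightarrow> f x (y \<oplus>\<^bsub>V\<^esub> y') = f x y \<oplus>\<^bsub>W\<^esub> f x y'"
    and "\<lbrakk>x \<in> carrier U; x' \<in> carrier U; y \<in> carrier V\<rbrakk> \<Longrightarrow> f (x \<oplus>\<^bsub>U\<^esub> x') y = f x y \<oplus>\<^bsub>W\<^esub> f x' y"
    and "\<lbrakk>x \<in> carrier U; y \<in> carrier V\<rbrakk> \<Longrightarrow> f x (\<ominus>\<^bsub>V\<^esub> y) = \<ominus>\<^bsub>W\<^esub> f x y"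
    and "\<lbrakk>x \<in> carrier U; y \<in> carrier V\<rbrakk> \<Longrightarrow> f (\<ominus>\<^bsub>U\<^esub> x) y = \<ominus>\<^bsub>W\<^esub> f x y"
    and "\<lbrakk>x \<in> carrier U; y \<in> carrier V; y' \<in> carrier V\<rbrakk> \<Longrightarrow> f x (y \<ominus>\<^bsub>V\<^esub> y') = f x y \<ominus>\<^bsub>W\<^esub> f x y'"
    and "\<lbrakk>x \<in> carrier U; x' \<in> carrier U; y \<in> carrier V\<rbrakk> \<Longrightarrow> f (x \<ominus>\<^bsub>U\<^esub> x') y = f x y \<ominus>\<^bsub>W\<^esub> f x' y"
    and "x \<in> carrier U \<Longrightarrow> f x \<zero>\<^bsub>V\<^esub> = \<zero>\<^bsub>W\<^esub>"
    and "y \<in> carrier V \<Longrightarrow> f \<zero>\<^bsub>U\<^esub> y = \<zero>\<^bsub>W\<^esub>"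
    and "\<lbrakk>c \<in> carrier K; x \<in> carrier U; y \<in> carrier V\<rbrakk> \<Longrightarrow> f x (c \<odot>\<^bsub>V\<^esub> y) = c \<odot>\<^bsub>W\<^esub> f x y"
    and "\<lbrakk>c \<in> carrier K; x \<in> carrier U; y \<in> carrier V\<rbrakk> \<Longrightarrow> f (c \<odot>\<^bsub>U\<^esub> x) y = c \<odot>\<^bsub>W\<^esub> f x y"
proof -
  have 1: "linear_map K V W (\<lambda>y. f x y)" if "x \<in> carrier U" for x
    using f that by (simp add: bilinear_map_def)
  have 2: "linear_map K U W (\<lambda>x. f x y)" if "y \<in> carrier V" for y
    using f that by (simp add: bilinear_map_def)
  note s1 = linear_map_simps[OF assms(2,3) 1] and s2 = linear_map_simps[OF assms(1,3) 2]
  show "\<lbrakk>x \<in> carrier U; y \<in> carrier V\<rbrakk> \<Longrightarrow> f x y \<in> carrier W"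
    and "\<lbrakk>x \<in> carrier U; y \<in> carrier V; y' \<in> carrier V\<rbrakk> \<Longrightarrow> f x (y \<oplus>\<^bsub>V\<^esub> y') = f x y \<oplus>\<^bsub>W\<^esub> f x y'"
    and "\<lbrakk>x \<in> carrier U; x' \<in> carrier U; y \<in> carrier V\<rbrakk> \<Longrightarrow> f (x \<oplus>\<^bsub>U\<^esub> x') y = f x y \<oplus>\<^bsub>W\<^esub> f x' y"
    and "\<lbrakk>x \<in> carrier U; y \<in> carrier V\<rbrakk> \<Longrightarrow> f x (\<ominus>\<^bsub>V\<^esub> y) = \<ominus>\<^bsub>W\<^esub> f x y"
    and "\<lbrakk>x \<in> carrier U; y \<in> carrier V\<rbrakk> \<Longrightarrow> f (\<ominus>\<^bsub>U\<^esub> x) y = \<ominus>\<^bsub>W\<^esub> f x y"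
    and "\<lbrakk>x \<in> carrier U; y \<in> carrier V; y' \<in> carrier V\<rbrakk> \<Longrightarrow> f x (y \<ominus>\<^bsub>V\<^esub> y') = f x y \<ominus>\<^bsub>W\<^esub> f x y'"
    and "\<lbrakk>x \<in> carrier U; x' \<in> carrier U; y \<in> carrier V\<rbrakk> \<Longrightarrow> f (x \<ominus>\<^bsub>U\<^esub> x') y = f x y \<ominus>\<^bsub>W\<^esub> f x' y"
    and "x \<in> carrier U \<Longrightarrow> f x \<zero>\<^bsub>V\<^esub> = \<zero>\<^bsub>W\<^esub>"
    and "y \<in> carrier V \<Longrightarrow> f \<zero>\<^bsub>U\<^esub> y = \<zero>\<^bsub>W\<^esub>"
    and "\<lbrakk>c \<in> carrier K; x \<in> carrier U; y \<in> carrier V\<rbrakk> \<Longrightarrow> f x (c \<odot>\<^bsub>V\<^esub> y) = c \<odot>\<^bsub>W\<^esub> f x y"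
    and "\<lbrakk>c \<in> carrier K; x \<in> carrier U; y \<in> carrier V\<rbrakk> \<Longrightarrow> f (c \<odot>\<^bsub>U\<^esub> x) y = c \<odot>\<^bsub>W\<^esub> f x y"
    by (simp_all add: s1 s2)
qed

lemma trilinear_map_simps:
  assumes "module K T" "module K U" "module K V" "module K W" and f: "trilinear_map K T U V W f"
  shows "\<lbrakk>x \<in> carrier T; y \<in> carrier U; z \<in> carrier V\<rbrakk> \<Longrightarrow> f x y z \<in> carrier W"
    and "\<lbrakk>x \<in> carrier T; x' \<in> carrier T; y \<in> carrier U; z \<in> carrier V\<rbrakk> \<Longrightarrow>
      f (x \<oplus>\<^bsub>T\<^esub> x') y z = f x y z \<oplus>\<^bsub>W\<^esub> f x' y z"
    and "\<lbrakk>x \<in> carrier T; y \<in> carrier U; y' \<in> carrier U; z \<in> carrier V\<rbrakk> \<Longrightarrow>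
      f x (y \<oplus>\<^bsub>U\<^esub> y') z = f x y z \<oplus>\<^bsub>W\<^esub> f x y' z"
    and "\<lbrakk>x \<in> carrier T; y \<in> carrier U; z \<in> carrier V; z' \<in> carrier V\<rbrakk> \<Longrightarrow>
      f x y (z \<oplus>\<^bsub>V\<^esub> z') = f x y z \<oplus>\<^bsub>W\<^esub> f x y z'"
    and "\<lbrakk>y \<in> carrier U; z \<in> carrier V\<rbrakk> \<Longrightarrow> f \<zero>\<^bsub>T\<^esub> y z = \<zero>\<^bsub>W\<^esub>"
    and "\<lbrakk>x \<in> carrier T; z \<in> carrier V\<rbrakk> \<Longrightarrow> f x \<zero>\<^bsub>U\<^esub> z = \<zero>\<^bsub>W\<^esub>"
    and "\<lbrakk>x \<in> carrier T; y \<in> carrier U\<rbrakk> \<Longrightarrow> f x y \<zero>\<^bsub>V\<^esub> = \<zero>\<^bsub>W\<^esub>"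
    and "\<lbrakk>c \<in> carrier K; x \<in> carrier T; y \<in> carrier U; z \<in> carrier V\<rbrakk> \<Longrightarrow>
      f (c \<odot>\<^bsub>T\<^esub> x) y z = c \<odot>\<^bsub>W\<^esub> f x y z"
    and "\<lbrakk>c \<in> carrier K; x \<in> carrier T; y \<in> carrier U; z \<in> carrier V\<rbrakk> \<Longrightarrow>
      f x (c \<odot>\<^bsub>U\<^esub> y) z = c \<odot>\<^bsub>W\<^esub> f x y z"
    and "\<lbrakk>c \<in> carrier K; x \<in> carrier T; y \<in> carrier U; z \<in> carrier V\<rbrakk> \<Longrightarrow>
      f x y (c \<odot>\<^bsub>V\<^esub> z) = c \<odot>\<^bsub>W\<^esub> f x y z"
proof -
  have 1: "linear_map K V W (\<lambda>z. f x y z)" if "x \<in> carrier T" "y \<in> carrier U" for x y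
    using f that by (simp add: trilinear_map_def)
  have 2: "linear_map K U W (\<lambda>y. f x y z)" if "x \<in> carrier T" "z \<in> carrier V" for x z
    using f that by (simp add: trilinear_map_def)
  have 3: "linear_map K T W (\<lambda>x. f x y z)" if "y \<in> carrier U" "z \<in> carrier V" for y z
    using f that by (simp add: trilinear_map_def)
  note s1 = linear_map_simps[OF assms(3,4) 1] and s2 = linear_map_simps[OF assms(2,4) 2]
    and s3 = linear_map_simps[OF assms(1,4) 3]
  show "\<lbrakk>x \<in> carrier T; y \<in> carrier U; z \<in> carrier V\<rbrakk> \<Longrightarrow> f x y z \<in> carrier W"
    and "\<lbrakk>x \<in> carrier T; x' \<in> carrier T; y \<in> carrier U; z \<in> carrier V\<rbrakk> \<Longrightarrow>
      f (x \<oplus>\<^bsub>T\<^esub> x') y z = f x y z \<oplus>\<^bsub>W\<^esub> f x' y z"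
    and "\<lbrakk>x \<in> carrier T; y \<in> carrier U; y' \<in> carrier U; z \<in> carrier V\<rbrakk> \<Longrightarrow>
      f x (y \<oplus>\<^bsub>U\<^esub> y') z = f x y z \<oplus>\<^bsub>W\<^esub> f x y' z"
    and "\<lbrakk>x \<in> carrier T; y \<in> carrier U; z \<in> carrier V; z' \<in> carrier V\<rbrakk> \<Longrightarrow>
      f x y (z \<oplus>\<^bsub>V\<^esub> z') = f x y z \<oplus>\<^bsub>W\<^esub> f x y z'"
    and "\<lbrakk>y \<in> carrier U; z \<in> carrier V\<rbrakk> \<Longrightarrow> f \<zero>\<^bsub>T\<^esub> y z = \<zero>\<^bsub>W\<^esub>"
    and "\<lbrakk>x \<in> carrier T; z \<in> carrier V\<rbrakk> \<Longrightarrow> f x \<zero>\<^bsub>U\<^esub> z = \<zero>\<^bsub>W\<^esub>"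
    and "\<lbrakk>x \<in> carrier T; y \<in> carrier U\<rbrakk> \<Longrightarrow> f x y \<zero>\<^bsub>V\<^esub> = \<zero>\<^bsub>W\<^esub>"
    and "\<lbrakk>c \<in> carrier K; x \<in> carrier T; y \<in> carrier U; z \<in> carrier V\<rbrakk> \<Longrightarrow>
      f (c \<odot>\<^bsub>T\<^esub> x) y z = c \<odot>\<^bsub>W\<^esub> f x y z"
    and "\<lbrakk>c \<in> carrier K; x \<in> carrier T; y \<in> carrier U; z \<in> carrier V\<rbrakk> \<Longrightarrow>
      f x (c \<odot>\<^bsub>U\<^esub> y) z = c \<odot>\<^bsub>W\<^esub> f x y z"
    and "\<lbrakk>c \<in> carrier K; x \<in> carrier T; y \<in> carrier U; z \<in> carrier V\<rbrakk> \<Longrightarrow>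
      f x y (c \<odot>\<^bsub>V\<^esub> z) = c \<odot>\<^bsub>W\<^esub> f x y z"
    by (simp_all add: s1 s2 s3)
qed

lemma linear_map_cong:
  assumes "module K V" and "\<And>x. x \<in> carrier V \<Longrightarrow> f x = g x"
  shows "linear_map K V W f \<longleftrightarrow> linear_map K V W g"
proof -
  interpret V: module K V by fact
  show ?thesis using assms(2) by (simp add: linear_map_def Pi_iff)
qed

lemma linear_map_restrict [simp]:
  "module K V \<Longrightarrow> linear_map K V W (restrict f (carrier V)) \<longleftrightarrow> linear_map K V W f"
  by (rule linear_map_cong) simp_all

lemma bilinear_map_cong:
  assumes "module K U" "module K V"
    and "\<And>x y. \<lbrakk>x \<in> carrier U; y \<in> carrier V\<rbrakk> \<Longrightarrow> f x y = g x y"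
  shows "bilinear_map K U V W f \<longleftrightarrow> bilinear_map K U V W g"
proof -
  have "linear_map K V W (\<lambda>y. f x y) \<longleftrightarrow> linear_map K V W (\<lambda>y. g x y)" if "x \<in> carrier U" for x
    using assms that by (intro linear_map_cong) auto
  moreover have "linear_map K U W (\<lambda>x. f x y) \<longleftrightarrow> linear_map K U W (\<lambda>x. g x y)"
    if "y \<in> carrier V" for y
    using assms that by (intro linear_map_cong) auto
  ultimately show ?thesis by (simp add: bilinear_map_def)
qed

lemma bilinear_map_restrict [simp]:
  "\<lbrakk>module K U; module K V\<rbrakk> \<Longrightarrow>
    bilinear_map K U V W (\<lambda>x\<in>carrier U. \<lambda>y\<in>carrier V. f x y) \<longleftrightarrow> bilinear_map K U V W f"
  by (rule bilinear_map_cong) simp_all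

lemma linear_map_add:
  assumes "module K V" "module K W" "linear_map K V W f" "linear_map K V W g"
  shows "linear_map K V W (\<lambda>x. f x \<oplus>\<^bsub>W\<^esub> g x)"
proof -
  interpret V: module K V by fact
  interpret W: module K W by fact
  note [simp] = linear_map_simps[OF assms(1,2,3)] linear_map_simps[OF assms(1,2,4)]
  show ?thesis by (simp add: linear_map_def W.M.a_ac W.smult_r_distr)
qed

lemma linear_map_neg:
  assumes "module K V" "module K W" "linear_map K V W f"
  shows "linear_map K V W (\<lambda>x. \<ominus>\<^bsub>W\<^esub> f x)"
proof -
  interpret V: module K V by fact
  interpret W: module K W by fact
  note [simp] = linear_map_simps[OF assms(1,2,3)]
  show ?thesis by (simp add: linear_map_def W.M.a_ac W.M.minus_add W.smult_r_minus)
qed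

lemma linear_map_diff:
  assumes "module K V" "module K W" "linear_map K V W f" "linear_map K V W g"
  shows "linear_map K V W (\<lambda>x. f x \<ominus>\<^bsub>W\<^esub> g x)"
  using linear_map_add[OF assms(1-3) linear_map_neg[OF assms(1,2,4)]] by (simp add: a_minus_def)

lemma linear_map_zero:
  assumes "module K V" "module K W"
  shows "linear_map K V W (\<lambda>x. \<zero>\<^bsub>W\<^esub>)"
proof -
  interpret V: module K V by fact
  interpret W: module K W by fact
  show ?thesis by (simp add: linear_map_def)
qed

lemma linear_map_ident: "linear_map K V V (\<lambda>x. x)"
  by (simp add: linear_map_def)

lemma linear_map_compose:
  "linear_map K U V f \<Longrightarrow> linear_map K V W g \<Longrightarrow> linear_map K U W (\<lambda>x. g (f x))"
  by (fastforce simp: linear_map_def Pi_iff)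

lemma bilinear_map_linear:
  assumes "bilinear_map K U V W f"
  shows "x \<in> carrier U \<Longrightarrow> linear_map K V W (\<lambda>y. f x y)"
    and "y \<in> carrier V \<Longrightarrow> linear_map K U W (\<lambda>x. f x y)"
  using assms by (simp_all add: bilinear_map_def)

lemma bilinear_map_add:
  assumes "module K U" "module K V" "module K W" "bilinear_map K U V W f" "bilinear_map K U V W g"
  shows "bilinear_map K U V W (\<lambda>x y. f x y \<oplus>\<^bsub>W\<^esub> g x y)"
  using assms by (simp add: bilinear_map_def linear_map_add)

lemma bilinear_map_postcompose:
  assumes "bilinear_map K U V W f" "linear_map K W X g"
  shows "bilinear_map K U V X (\<lambda>x y. g (f x y))"
  using assms(1) unfolding bilinear_map_def
  by (intro conjI ballI linear_map_compose[OF _ assms(2)]) simp_all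

lemma bilinear_map_precompose:
  assumes b: "bilinear_map K U' V' W b" and f: "linear_map K U U' f" and g: "linear_map K V V' g"
  shows "bilinear_map K U V W (\<lambda>x y. b (f x) (g y))"
proof -
  have "f x \<in> carrier U'" if "x \<in> carrier U" for x
    using f that by (auto simp: linear_map_def)
  moreover have "g y \<in> carrier V'" if "y \<in> carrier V" for y
    using g that by (auto simp: linear_map_def)
  ultimately show ?thesis
    using linear_map_compose[OF f bilinear_map_linear(2)[OF b]]
      linear_map_compose[OF g bilinear_map_linear(1)[OF b]]
    by (simp add: bilinear_map_def)
qed

section \<open>Leibniz infinity algebras, morphisms and homotopies\<close>

context leibniz_infinity_algebra
begin

lemmas abelian_groups [simp] = V0.M.abelian_group_axioms V1.M.abelian_group_axioms
lemmas modules [simp] = V0.module_axioms V1.module_axioms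

lemmas l1_simps [simp] = linear_map_simps[OF V1.module_axioms V0.module_axioms l1_linear]
lemmas l2_00_simps [simp] =
  bilinear_map_simps[OF V0.module_axioms V0.module_axioms V0.module_axioms l2_00_bilinear]
lemmas l2_01_simps [simp] =
  bilinear_map_simps[OF V0.module_axioms V1.module_axioms V1.module_axioms l2_01_bilinear]
lemmas l2_10_simps [simp] =
  bilinear_map_simps[OF V1.module_axioms V0.module_axioms V1.module_axioms l2_10_bilinear]
lemmas l3_simps [simp] =
  trilinear_map_simps[OF V0.module_axioms V0.module_axioms V0.module_axioms V1.module_axioms
    l3_trilinear]

declare l2_l1 [simp] l1_l2_01 [simp] l1_l2_10 [simp] l1_l3 [simp]
  l3_l1_third [simp] l3_l1_second [simp] l3_l1_first [simp]

end

context leibniz_infinity_morphism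
begin

lemmas f1_0_simps [simp] = linear_map_simps[OF V.V0.module_axioms W.V0.module_axioms f1_0_linear]
lemmas f1_1_simps [simp] = linear_map_simps[OF V.V1.module_axioms W.V1.module_axioms f1_1_linear]
lemmas f2_simps [simp] =
  bilinear_map_simps[OF V.V0.module_axioms V.V0.module_axioms W.V1.module_axioms f2_bilinear]

text \<open>The defining equations of a morphism are oriented so that \<open>f1_0\<close> and \<open>f1_1\<close> are pushed inside the
  brackets. Both sides of an identity about a composite then reach the same normal form.\<close>

lemma f1_0_l1 [simp]: "h \<in> carrier (deg1 V) \<Longrightarrow> f1_0 f (l1 V h) = l1 W (f1_1 f h)"
  by (simp add: f1_chain)

lemma f1_0_l2 [simp]:
  "\<lbrakk>x \<in> carrier (deg0 V); y \<in> carrier (deg0 V)\<rbrakk> \<Longrightarrow>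
    f1_0 f (l2_00 V x y) = l2_00 W (f1_0 f x) (f1_0 f y) \<oplus>\<^bsub>deg0 W\<^esub> l1 W (f2 f x y)"
  by (simp add: f1_l2_00)

lemma f1_1_l2_01 [simp]:
  assumes [simp]: "x \<in> carrier (deg0 V)" "h \<in> carrier (deg1 V)"
  shows "f1_1 f (l2_01 V x h) = l2_01 W (f1_0 f x) (f1_1 f h) \<oplus>\<^bsub>deg1 W\<^esub> f2 f x (l1 V h)"
  by (rule formal_eqI_from[where G="deg1 W", OF f1_l2_01[OF assms, symmetric]], (rule formal_intros | simp)+)

lemma f1_1_l2_10 [simp]:
  assumes [simp]: "x \<in> carrier (deg0 V)" "h \<in> carrier (deg1 V)"
  shows "f1_1 f (l2_10 V h x) = l2_10 W (f1_1 f h) (f1_0 f x) \<oplus>\<^bsub>deg1 W\<^esub> f2 f (l1 V h) x"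
  by (rule formal_eqI_from[where G="deg1 W", OF f1_l2_10[OF assms, symmetric]], (rule formal_intros | simp)+)

lemma f1_1_l3:
  assumes [simp]: "x \<in> carrier (deg0 V)" "y \<in> carrier (deg0 V)" "z \<in> carrier (deg0 V)"
  shows "f1_1 f (l3 V x y z) =
    l3 W (f1_0 f x) (f1_0 f y) (f1_0 f z)
      \<ominus>\<^bsub>deg1 W\<^esub> l2_10 W (f2 f x y) (f1_0 f z)
      \<oplus>\<^bsub>deg1 W\<^esub> l2_01 W (f1_0 f x) (f2 f y z)
      \<ominus>\<^bsub>deg1 W\<^esub> l2_01 W (f1_0 f y) (f2 f x z)
      \<ominus>\<^bsub>deg1 W\<^esub> f2 f (l2_00 V x y) z
      \<oplus>\<^bsub>deg1 W\<^esub> f2 f x (l2_00 V y z)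
      \<ominus>\<^bsub>deg1 W\<^esub> f2 f y (l2_00 V x z)"
  by (rule formal_eqI_from[where G="deg1 W", OF f2_coherence[OF assms, symmetric]], (rule formal_intros | simp)+)

end

lemma lei_inf_mor_eqI:
  assumes "leibniz_infinity_morphism K V W f" "leibniz_infinity_morphism K V W g"
    and "inf_dom f = inf_dom g" "inf_cod f = inf_cod g"
    and "\<And>x. x \<in> carrier (deg0 V) \<Longrightarrow> f1_0 f x = f1_0 g x"
    and "\<And>h. h \<in> carrier (deg1 V) \<Longrightarrow> f1_1 f h = f1_1 g h"
    and "\<And>x y. \<lbrakk>x \<in> carrier (deg0 V); y \<in> carrier (deg0 V)\<rbrakk> \<Longrightarrow> f2 f x y = f2 g x y"
  shows "f = g"
proof -
  interpret f: leibniz_infinity_morphism K V W f by fact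
  interpret g: leibniz_infinity_morphism K V W g by fact
  have "f1_0 f = f1_0 g" "f1_1 f = f1_1 g"
    using assms f.f1_0_ext g.f1_0_ext f.f1_1_ext g.f1_1_ext by (auto intro: PiE_ext)
  moreover have "f2 f = f2 g"
  proof (rule PiE_ext[OF f.f2_ext g.f2_ext])
    fix x assume x: "x \<in> carrier (deg0 V)"
    show "f2 f x = f2 g x"
      by (rule PiE_ext[OF PiE_mem[OF f.f2_ext x] PiE_mem[OF g.f2_ext x]]) (rule assms(7)[OF x])
  qed
  ultimately show ?thesis using assms(3,4) by simp
qed

lemma lei_inf_id_morphism:
  assumes "leibniz_infinity_algebra K V"
  shows "leibniz_infinity_morphism K V V (lei_inf_id V)"
proof -
  interpret V: leibniz_infinity_algebra K V by fact
  have comps: "f1_0 (lei_inf_id V) = (\<lambda>x\<in>carrier (deg0 V). x)"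
    "f1_1 (lei_inf_id V) = (\<lambda>h\<in>carrier (deg1 V). h)"
    "f2 (lei_inf_id V) = (\<lambda>x\<in>carrier (deg0 V). \<lambda>y\<in>carrier (deg0 V). \<zero>\<^bsub>deg1 V\<^esub>)"
    by (simp_all add: lei_inf_id_def)
  show ?thesis
  proof unfold_locales
    show "linear_map K (deg0 V) (deg0 V) (f1_0 (lei_inf_id V))"
      "linear_map K (deg1 V) (deg1 V) (f1_1 (lei_inf_id V))"
      unfolding comps by (simp_all add: linear_map_ident)
    show "bilinear_map K (deg0 V) (deg0 V) (deg1 V) (f2 (lei_inf_id V))"
      unfolding comps by (subst bilinear_map_restrict) (simp_all add: bilinear_map_def linear_map_zero)
  next
    fix x h assume [simp]: "x \<in> carrier (deg0 V)" "h \<in> carrier (deg1 V)"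
    show "l2_01 V (f1_0 (lei_inf_id V) x) (f1_1 (lei_inf_id V) h) =
      f1_1 (lei_inf_id V) (l2_01 V x h) \<ominus>\<^bsub>deg1 V\<^esub> f2 (lei_inf_id V) x (l1 V h)"
      "l2_10 V (f1_1 (lei_inf_id V) h) (f1_0 (lei_inf_id V) x) =
        f1_1 (lei_inf_id V) (l2_10 V h x) \<ominus>\<^bsub>deg1 V\<^esub> f2 (lei_inf_id V) (l1 V h) x"
      by (simp_all add: comps V.V1.M.minus_eq)
  next
    fix x y assume [simp]: "x \<in> carrier (deg0 V)" "y \<in> carrier (deg0 V)"
    show "l2_00 V (f1_0 (lei_inf_id V) x) (f1_0 (lei_inf_id V) y)
        \<oplus>\<^bsub>deg0 V\<^esub> l1 V (f2 (lei_inf_id V) x y) = f1_0 (lei_inf_id V) (l2_00 V x y)"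
      by (simp add: comps)
  next
    fix x y z assume [simp]: "x \<in> carrier (deg0 V)" "y \<in> carrier (deg0 V)" "z \<in> carrier (deg0 V)"
    show "l3 V (f1_0 (lei_inf_id V) x) (f1_0 (lei_inf_id V) y) (f1_0 (lei_inf_id V) z)
          \<ominus>\<^bsub>deg1 V\<^esub> l2_10 V (f2 (lei_inf_id V) x y) (f1_0 (lei_inf_id V) z)
          \<oplus>\<^bsub>deg1 V\<^esub> l2_01 V (f1_0 (lei_inf_id V) x) (f2 (lei_inf_id V) y z)
          \<ominus>\<^bsub>deg1 V\<^esub> l2_01 V (f1_0 (lei_inf_id V) y) (f2 (lei_inf_id V) x z) =
        f1_1 (lei_inf_id V) (l3 V x y z)
          \<oplus>\<^bsub>deg1 V\<^esub> f2 (lei_inf_id V) (l2_00 V x y) z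
          \<ominus>\<^bsub>deg1 V\<^esub> f2 (lei_inf_id V) x (l2_00 V y z)
          \<oplus>\<^bsub>deg1 V\<^esub> f2 (lei_inf_id V) y (l2_00 V x z)"
      by (simp add: comps V.V1.M.minus_eq)
  qed (simp_all add: comps)
qed

locale composable_infinity_morphisms =
  f: leibniz_infinity_morphism K U V f + g: leibniz_infinity_morphism K V W g
  for K :: "('k, 'r) ring_scheme" and U V W :: "('k, 'a) lei_inf" and f g :: "('k, 'a) lei_inf_mor" +
  assumes dom_f: "inf_dom f = U" and cod_f: "inf_cod f = V"
    and dom_g: "inf_dom g = V" and cod_g: "inf_cod g = W"
begin

lemma comp_components:
  "f1_0 (lei_inf_comp g f) = (\<lambda>x\<in>carrier (deg0 U). f1_0 g (f1_0 f x))"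
  "f1_1 (lei_inf_comp g f) = (\<lambda>h\<in>carrier (deg1 U). f1_1 g (f1_1 f h))"
  "f2 (lei_inf_comp g f) = (\<lambda>x\<in>carrier (deg0 U). \<lambda>y\<in>carrier (deg0 U).
    f2 g (f1_0 f x) (f1_0 f y) \<oplus>\<^bsub>deg1 W\<^esub> f1_1 g (f2 f x y))"
  by (simp_all add: lei_inf_comp_def dom_f cod_g)

text \<open>Applying the coherence law of \<open>g\<close> at \<open>f x, f y, f z\<close> and the image under \<open>g\<close> of that of \<open>f\<close>, all
  terms of the coherence law of the composite cancel.\<close>

lemma comp_morphism: "leibniz_infinity_morphism K U W (lei_inf_comp g f)"
proof unfold_locales
  show "linear_map K (deg0 U) (deg0 W) (f1_0 (lei_inf_comp g f))"
    using linear_map_compose[OF f.f1_0_linear g.f1_0_linear] by (simp add: comp_components)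
  show "linear_map K (deg1 U) (deg1 W) (f1_1 (lei_inf_comp g f))"
    using linear_map_compose[OF f.f1_1_linear g.f1_1_linear] by (simp add: comp_components)
  show "bilinear_map K (deg0 U) (deg0 U) (deg1 W) (f2 (lei_inf_comp g f))"
    unfolding comp_components
    by (subst bilinear_map_restrict)
      (simp_all add: bilinear_map_add bilinear_map_precompose[OF g.f2_bilinear]
        bilinear_map_postcompose[OF f.f2_bilinear] f.f1_0_linear g.f1_1_linear)
next
  fix x y z
  assume [simp]: "x \<in> carrier (deg0 U)" "y \<in> carrier (deg0 U)" "z \<in> carrier (deg0 U)"
  show "l3 W (f1_0 (lei_inf_comp g f) x) (f1_0 (lei_inf_comp g f) y) (f1_0 (lei_inf_comp g f) z)
      \<ominus>\<^bsub>deg1 W\<^esub> l2_10 W (f2 (lei_inf_comp g f) x y) (f1_0 (lei_inf_comp g f) z)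
      \<oplus>\<^bsub>deg1 W\<^esub> l2_01 W (f1_0 (lei_inf_comp g f) x) (f2 (lei_inf_comp g f) y z)
      \<ominus>\<^bsub>deg1 W\<^esub> l2_01 W (f1_0 (lei_inf_comp g f) y) (f2 (lei_inf_comp g f) x z) =
    f1_1 (lei_inf_comp g f) (l3 U x y z)
      \<oplus>\<^bsub>deg1 W\<^esub> f2 (lei_inf_comp g f) (l2_00 U x y) z
      \<ominus>\<^bsub>deg1 W\<^esub> f2 (lei_inf_comp g f) x (l2_00 U y z)
      \<oplus>\<^bsub>deg1 W\<^esub> f2 (lei_inf_comp g f) y (l2_00 U x z)"
    by (simp add: comp_components f.f1_1_l3 g.f1_1_l3)
      (rule formal_eqI[where G="deg1 W"], (rule formal_intros | simp)+)
next
  fix x h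
  assume [simp]: "x \<in> carrier (deg0 U)" "h \<in> carrier (deg1 U)"
  show "l2_01 W (f1_0 (lei_inf_comp g f) x) (f1_1 (lei_inf_comp g f) h) =
    f1_1 (lei_inf_comp g f) (l2_01 U x h) \<ominus>\<^bsub>deg1 W\<^esub> f2 (lei_inf_comp g f) x (l1 U h)"
    by (simp add: comp_components)
      (rule formal_eqI[where G="deg1 W"], (rule formal_intros | simp)+)
  show "l2_10 W (f1_1 (lei_inf_comp g f) h) (f1_0 (lei_inf_comp g f) x) =
    f1_1 (lei_inf_comp g f) (l2_10 U h x) \<ominus>\<^bsub>deg1 W\<^esub> f2 (lei_inf_comp g f) (l1 U h) x"
    by (simp add: comp_components)
      (rule formal_eqI[where G="deg1 W"], (rule formal_intros | simp)+)
next
  fix x y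
  assume [simp]: "x \<in> carrier (deg0 U)" "y \<in> carrier (deg0 U)"
  show "l2_00 W (f1_0 (lei_inf_comp g f) x) (f1_0 (lei_inf_comp g f) y)
      \<oplus>\<^bsub>deg0 W\<^esub> l1 W (f2 (lei_inf_comp g f) x y) = f1_0 (lei_inf_comp g f) (l2_00 U x y)"
    by (simp add: comp_components)
      (rule formal_eqI[where G="deg0 W"], (rule formal_intros | simp)+)
qed (auto simp: comp_components)

end

context leibniz_infinity_homotopy
begin

lemmas htp_simps [simp] = linear_map_simps[OF f.V.V0.module_axioms f.W.V1.module_axioms htp_linear]

text \<open>A homotopy determines its target from its source. Rewriting with these three lemmas eliminates the
  target morphism from an identity.\<close>

lemma target_f1_0:
  assumes [simp]: "x \<in> carrier (deg0 V)"
  shows "f1_0 g x = f1_0 f x \<oplus>\<^bsub>deg0 W\<^esub> l1 W (\<theta> x)"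
  by (rule formal_eqI_from[where G="deg0 W", OF htp_deg0[OF assms]], (rule formal_intros | simp)+)

lemma target_f1_1:
  assumes [simp]: "h \<in> carrier (deg1 V)"
  shows "f1_1 g h = f1_1 f h \<oplus>\<^bsub>deg1 W\<^esub> \<theta> (l1 V h)"
  by (rule formal_eqI_from[where G="deg1 W", OF htp_deg1[OF assms]], (rule formal_intros | simp)+)

lemma target_f2:
  assumes [simp]: "x \<in> carrier (deg0 V)" "y \<in> carrier (deg0 V)"
  shows "f2 g x y = f2 f x y \<oplus>\<^bsub>deg1 W\<^esub> (\<theta> (l2_00 V x y)
    \<ominus>\<^bsub>deg1 W\<^esub> l2_01 W (f1_0 f x) (\<theta> y) \<ominus>\<^bsub>deg1 W\<^esub> l2_10 W (\<theta> x) (f1_0 g y))"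
  by (rule formal_eqI_from[where G="deg1 W", OF htp_f2[OF assms]], (rule formal_intros | simp)+)

end


lemma (in leibniz_infinity_morphism) zero_homotopy:
  "leibniz_infinity_homotopy K V W f f (\<lambda>x\<in>carrier (deg0 V). \<zero>\<^bsub>deg1 W\<^esub>)"
  by unfold_locales
    (simp_all add: linear_map_zero W.V0.M.minus_eq W.V1.M.minus_eq W.V0.M.r_neg W.V1.M.r_neg)

locale vertically_composable_homotopies =
  \<theta>: leibniz_infinity_homotopy K V W f g \<theta> + \<tau>: leibniz_infinity_homotopy K V W g h \<tau>
  for K :: "('k, 'r) ring_scheme" and V W :: "('k, 'a) lei_inf" and f g h \<theta> \<tau>
begin

lemma sum_homotopy:
  "leibniz_infinity_homotopy K V W f h (\<lambda>x\<in>carrier (deg0 V). \<tau> x \<oplus>\<^bsub>deg1 W\<^esub> \<theta> x)"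
proof unfold_locales
  show "linear_map K (deg0 V) (deg1 W) (\<lambda>x\<in>carrier (deg0 V). \<tau> x \<oplus>\<^bsub>deg1 W\<^esub> \<theta> x)"
    by (simp add: linear_map_add \<theta>.htp_linear \<tau>.htp_linear)
next
  fix x assume [simp]: "x \<in> carrier (deg0 V)"
  show "f1_0 h x \<ominus>\<^bsub>deg0 W\<^esub> f1_0 f x = l1 W ((\<lambda>x\<in>carrier (deg0 V). \<tau> x \<oplus>\<^bsub>deg1 W\<^esub> \<theta> x) x)"
    by (simp add: \<theta>.target_f1_0 \<tau>.target_f1_0)
      (rule formal_eqI[where G="deg0 W"], (rule formal_intros | simp)+)
next
  fix k assume [simp]: "k \<in> carrier (deg1 V)"
  show "f1_1 h k \<ominus>\<^bsub>deg1 W\<^esub> f1_1 f k =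
      (\<lambda>x\<in>carrier (deg0 V). \<tau> x \<oplus>\<^bsub>deg1 W\<^esub> \<theta> x) (l1 V k)"
    by (simp add: \<theta>.target_f1_1 \<tau>.target_f1_1)
      (rule formal_eqI[where G="deg1 W"], (rule formal_intros | simp)+)
next
  fix x y assume [simp]: "x \<in> carrier (deg0 V)" "y \<in> carrier (deg0 V)"
  show "f2 h x y \<ominus>\<^bsub>deg1 W\<^esub> f2 f x y =
    (\<lambda>x\<in>carrier (deg0 V). \<tau> x \<oplus>\<^bsub>deg1 W\<^esub> \<theta> x) (l2_00 V x y)
    \<ominus>\<^bsub>deg1 W\<^esub> l2_01 W (f1_0 f x) ((\<lambda>x\<in>carrier (deg0 V). \<tau> x \<oplus>\<^bsub>deg1 W\<^esub> \<theta> x) y)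
    \<ominus>\<^bsub>deg1 W\<^esub> l2_10 W ((\<lambda>x\<in>carrier (deg0 V). \<tau> x \<oplus>\<^bsub>deg1 W\<^esub> \<theta> x) x) (f1_0 h y)"
    by (simp add: \<theta>.target_f1_0 \<tau>.target_f1_0 \<theta>.target_f2 \<tau>.target_f2)
      (rule formal_eqI[where G="deg1 W"], (rule formal_intros | simp)+)
qed simp

end

locale horizontally_composable_homotopies =
  \<theta>: leibniz_infinity_homotopy K U V f g \<theta> + \<tau>: leibniz_infinity_homotopy K V W f' g' \<tau>
  for K :: "('k, 'r) ring_scheme" and U V W :: "('k, 'a) lei_inf" and f g f' g' \<theta> \<tau> +
  assumes dom_cod: "inf_dom f = U" "inf_cod f = V" "inf_dom g = U" "inf_cod g = V"
    "inf_dom f' = V" "inf_cod f' = W" "inf_dom g' = V" "inf_cod g' = W"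
begin

sublocale src: composable_infinity_morphisms K U V W f f'
  by unfold_locales (simp_all add: dom_cod)

sublocale tgt: composable_infinity_morphisms K U V W g g'
  by unfold_locales (simp_all add: dom_cod)

text \<open>Expressing \<open>g\<close> and \<open>g'\<close> through \<open>f\<close>, \<open>f'\<close> and the homotopies turns each condition into an identity
  of sums. The identity \<open>l\<^sub>2 (l\<^sub>1 h) k = l\<^sub>2 h (l\<^sub>1 k)\<close> accounts for the terms in which both homotopies occur.\<close>

lemma hcomp_homotopy:
  "leibniz_infinity_homotopy K U W (lei_inf_comp f' f) (lei_inf_comp g' g)
    (\<lambda>x\<in>carrier (deg0 U). f1_1 g' (\<theta> x) \<oplus>\<^bsub>deg1 W\<^esub> \<tau> (f1_0 f x))"
    (is "leibniz_infinity_homotopy K U W _ _ ?H")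
proof (intro leibniz_infinity_homotopy.intro leibniz_infinity_homotopy_axioms.intro
    src.comp_morphism tgt.comp_morphism)
  show "linear_map K (deg0 U) (deg1 W) ?H"
    by (simp add: linear_map_add linear_map_compose[OF \<theta>.htp_linear \<tau>.g.f1_1_linear]
        linear_map_compose[OF \<theta>.f.f1_0_linear \<tau>.htp_linear])
next
  fix x assume [simp]: "x \<in> carrier (deg0 U)"
  show "f1_0 (lei_inf_comp g' g) x \<ominus>\<^bsub>deg0 W\<^esub> f1_0 (lei_inf_comp f' f) x = l1 W (?H x)"
    by (simp add: src.comp_components tgt.comp_components
        \<theta>.target_f1_0 \<tau>.target_f1_0 \<tau>.target_f1_1)
      (rule formal_eqI[where G="deg0 W"], (rule formal_intros | simp)+)
next
  fix k assume [simp]: "k \<in> carrier (deg1 U)"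
  show "f1_1 (lei_inf_comp g' g) k \<ominus>\<^bsub>deg1 W\<^esub> f1_1 (lei_inf_comp f' f) k = ?H (l1 U k)"
    by (simp add: src.comp_components tgt.comp_components
        \<theta>.target_f1_1 \<tau>.target_f1_1)
      (rule formal_eqI[where G="deg1 W"], (rule formal_intros | simp)+)
next
  fix x y assume [simp]: "x \<in> carrier (deg0 U)" "y \<in> carrier (deg0 U)"
  show "f2 (lei_inf_comp g' g) x y \<ominus>\<^bsub>deg1 W\<^esub> f2 (lei_inf_comp f' f) x y =
    ?H (l2_00 U x y) \<ominus>\<^bsub>deg1 W\<^esub> l2_01 W (f1_0 (lei_inf_comp f' f) x) (?H y)
      \<ominus>\<^bsub>deg1 W\<^esub> l2_10 W (?H x) (f1_0 (lei_inf_comp g' g) y)"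
    by (simp add: src.comp_components tgt.comp_components
        \<theta>.target_f1_0 \<theta>.target_f2 \<tau>.target_f1_0 \<tau>.target_f1_1 \<tau>.target_f2)
      (rule formal_eqI[where G="deg1 W"], (rule formal_intros | simp)+)
qed simp

end

lemma htp_eqI:
  fixes \<theta> \<tau> :: "('k, 'a) lei_inf_homotopy"
  assumes "leibniz_infinity_homotopy K V W f g (htp \<theta>)" "leibniz_infinity_homotopy K V W f' g' (htp \<tau>)"
    and "htp_src \<theta> = htp_src \<tau>" "htp_tgt \<theta> = htp_tgt \<tau>"
    and "\<And>x. x \<in> carrier (deg0 V) \<Longrightarrow> htp \<theta> x = htp \<tau> x"
  shows "\<theta> = \<tau>"
proof -
  interpret \<theta>: leibniz_infinity_homotopy K V W f g "htp \<theta>" by fact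
  interpret \<tau>: leibniz_infinity_homotopy K V W f' g' "htp \<tau>" by fact
  have "htp \<theta> = htp \<tau>"
    by (rule PiE_ext[OF \<theta>.htp_ext \<tau>.htp_ext]) (rule assms(5))
  then show ?thesis using assms(3,4) by (intro lei_inf_homotopy.equality) simp_all
qed

section \<open>The strict 2-category of 2-term Leibniz infinity algebras\<close>

lemma two_Lei_inf_Alg_simps [simp]:
  "V \<in> obj (two_Lei_inf_Alg K) \<longleftrightarrow> leibniz_infinity_algebra K V"
  "f \<in> arr (two_Lei_inf_Alg K) \<longleftrightarrow> leibniz_infinity_morphism K (inf_dom f) (inf_cod f) f"
  "\<theta> \<in> cell (two_Lei_inf_Alg K) \<longleftrightarrow>
    inf_dom (htp_tgt \<theta>) = inf_dom (htp_src \<theta>) \<and> inf_cod (htp_tgt \<theta>) = inf_cod (htp_src \<theta>) \<and>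
    leibniz_infinity_homotopy K (inf_dom (htp_src \<theta>)) (inf_cod (htp_src \<theta>))
      (htp_src \<theta>) (htp_tgt \<theta>) (htp \<theta>)"
  "dom1 (two_Lei_inf_Alg K) = inf_dom" "cod1 (two_Lei_inf_Alg K) = inf_cod"
  "id1 (two_Lei_inf_Alg K) = lei_inf_id" "comp1 (two_Lei_inf_Alg K) = lei_inf_comp"
  "src2 (two_Lei_inf_Alg K) = htp_src" "tgt2 (two_Lei_inf_Alg K) = htp_tgt"
  "id2 (two_Lei_inf_Alg K) = htp_id"
  "vcomp (two_Lei_inf_Alg K) = htp_vcomp" "hcomp (two_Lei_inf_Alg K) = htp_hcomp"
  by (simp_all add: two_Lei_inf_Alg_def)

lemma lei_inf_dom_cod [simp]:
  "inf_dom (lei_inf_id V) = V" "inf_cod (lei_inf_id V) = V"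
  "inf_dom (lei_inf_comp g f) = inf_dom f" "inf_cod (lei_inf_comp g f) = inf_cod g"
  "htp_src (htp_id f) = f" "htp_tgt (htp_id f) = f"
  "htp_src (htp_vcomp \<tau> \<theta>) = htp_src \<theta>" "htp_tgt (htp_vcomp \<tau> \<theta>) = htp_tgt \<tau>"
  "htp_src (htp_hcomp \<tau> \<theta>) = lei_inf_comp (htp_src \<tau>) (htp_src \<theta>)"
  "htp_tgt (htp_hcomp \<tau> \<theta>) = lei_inf_comp (htp_tgt \<tau>) (htp_tgt \<theta>)"
  by (simp_all add: lei_inf_id_def lei_inf_comp_def htp_id_def htp_vcomp_def htp_hcomp_def)

lemma lei_inf_comp_closed:
  assumes "f \<in> arr (two_Lei_inf_Alg K)" "g \<in> arr (two_Lei_inf_Alg K)" "inf_cod f = inf_dom g"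
  shows "lei_inf_comp g f \<in> arr (two_Lei_inf_Alg K)"
proof -
  interpret f: leibniz_infinity_morphism K "inf_dom f" "inf_dom g" f using assms by simp
  interpret g: leibniz_infinity_morphism K "inf_dom g" "inf_cod g" g using assms by simp
  interpret composable_infinity_morphisms K "inf_dom f" "inf_dom g" "inf_cod g" f g
    using assms by unfold_locales simp_all
  show ?thesis using comp_morphism by simp
qed

lemma htp_id_closed:
  "f \<in> arr (two_Lei_inf_Alg K) \<Longrightarrow> htp_id f \<in> cell (two_Lei_inf_Alg K)"
  by (simp add: htp_id_def leibniz_infinity_morphism.zero_homotopy)

lemma htp_vcomp_closed:
  assumes "\<theta> \<in> cell (two_Lei_inf_Alg K)" "\<tau> \<in> cell (two_Lei_inf_Alg K)" "htp_tgt \<theta> = htp_src \<tau>"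
  shows "htp_vcomp \<tau> \<theta> \<in> cell (two_Lei_inf_Alg K)"
proof -
  have par: "inf_dom (htp_src \<tau>) = inf_dom (htp_src \<theta>)"
    "inf_cod (htp_src \<tau>) = inf_cod (htp_src \<theta>)"
    using assms by auto
  interpret vertically_composable_homotopies K "inf_dom (htp_src \<theta>)"
    "inf_cod (htp_src \<theta>)" "htp_src \<theta>" "htp_src \<tau>" "htp_tgt \<tau>" "htp \<theta>" "htp \<tau>"
    using assms par by (simp add: vertically_composable_homotopies_def)
  show ?thesis using assms par sum_homotopy by (simp add: htp_vcomp_def)
qed

lemma htp_hcomp_closed:
  assumes "\<theta> \<in> cell (two_Lei_inf_Alg K)" "\<tau> \<in> cell (two_Lei_inf_Alg K)"
    "inf_cod (htp_src \<theta>) = inf_dom (htp_src \<tau>)"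
  shows "htp_hcomp \<tau> \<theta> \<in> cell (two_Lei_inf_Alg K)"
proof -
  interpret horizontally_composable_homotopies K "inf_dom (htp_src \<theta>)" "inf_dom (htp_src \<tau>)"
    "inf_cod (htp_src \<tau>)" "htp_src \<theta>" "htp_tgt \<theta>" "htp_src \<tau>" "htp_tgt \<tau>" "htp \<theta>" "htp \<tau>"
    using assms
    by (simp add: horizontally_composable_homotopies_def horizontally_composable_homotopies_axioms_def)
  show ?thesis using assms hcomp_homotopy by (simp add: htp_hcomp_def)
qed

lemmas lei_inf_closed = lei_inf_comp_closed htp_id_closed htp_vcomp_closed htp_hcomp_closed

lemma lei_inf_arr_eqI:
  assumes "f \<in> arr (two_Lei_inf_Alg K)" "g \<in> arr (two_Lei_inf_Alg K)"
    and "inf_dom f = inf_dom g" "inf_cod f = inf_cod g"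
    and "\<And>x. x \<in> carrier (deg0 (inf_dom f)) \<Longrightarrow> f1_0 f x = f1_0 g x"
    and "\<And>h. h \<in> carrier (deg1 (inf_dom f)) \<Longrightarrow> f1_1 f h = f1_1 g h"
    and "\<And>x y. \<lbrakk>x \<in> carrier (deg0 (inf_dom f)); y \<in> carrier (deg0 (inf_dom f))\<rbrakk> \<Longrightarrow> f2 f x y = f2 g x y"
  shows "f = g"
  using assms by (intro lei_inf_mor_eqI[of K "inf_dom f" "inf_cod f"]) simp_all

lemma lei_inf_cell_eqI:
  assumes "\<theta> \<in> cell (two_Lei_inf_Alg K)" "\<tau> \<in> cell (two_Lei_inf_Alg K)"
    and "htp_src \<theta> = htp_src \<tau>" "htp_tgt \<theta> = htp_tgt \<tau>"
    and "\<And>x. x \<in> carrier (deg0 (inf_dom (htp_src \<theta>))) \<Longrightarrow> htp \<theta> x = htp \<tau> x"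
  shows "\<theta> = \<tau>"
  using assms
  by (intro htp_eqI[of K "inf_dom (htp_src \<theta>)" "inf_cod (htp_src \<theta>)" "htp_src \<theta>" "htp_tgt \<theta>" \<theta>
        "htp_src \<tau>" "htp_tgt \<tau>" \<tau>]) simp_all

lemma lei_inf_id_closed:
  "leibniz_infinity_algebra K V \<Longrightarrow> lei_inf_id V \<in> arr (two_Lei_inf_Alg K)"
  by (simp add: lei_inf_id_morphism)

lemma lei_inf_arr_objects:
  assumes "f \<in> arr (two_Lei_inf_Alg K)"
  shows "leibniz_infinity_algebra K (inf_dom f)" "leibniz_infinity_algebra K (inf_cod f)"
  using assms by (simp_all add: leibniz_infinity_morphism_def)

lemma lei_inf_cell_arrs:
  assumes "\<theta> \<in> cell (two_Lei_inf_Alg K)"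
  shows "htp_src \<theta> \<in> arr (two_Lei_inf_Alg K)" "htp_tgt \<theta> \<in> arr (two_Lei_inf_Alg K)"
  using assms by (simp_all add: leibniz_infinity_homotopy_def)

lemma lei_inf_cell_parallel:
  assumes "\<theta> \<in> cell (two_Lei_inf_Alg K)"
  shows "inf_dom (htp_tgt \<theta>) = inf_dom (htp_src \<theta>)" "inf_cod (htp_tgt \<theta>) = inf_cod (htp_src \<theta>)"
  using assms by simp_all

lemma lei_inf_comp_id:
  assumes f: "f \<in> arr (two_Lei_inf_Alg K)"
  shows "lei_inf_comp f (lei_inf_id (inf_dom f)) = f" "lei_inf_comp (lei_inf_id (inf_cod f)) f = f"
proof -
  interpret f: leibniz_infinity_morphism K "inf_dom f" "inf_cod f" f using f by simp
  note id = lei_inf_arr_objects[OF f, THEN lei_inf_id_closed]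
  have "lei_inf_comp f (lei_inf_id (inf_dom f)) \<in> arr (two_Lei_inf_Alg K)"
    "lei_inf_comp (lei_inf_id (inf_cod f)) f \<in> arr (two_Lei_inf_Alg K)"
    using lei_inf_comp_closed[OF id(1) f] lei_inf_comp_closed[OF f id(2)] by simp_all
  then show "lei_inf_comp f (lei_inf_id (inf_dom f)) = f" "lei_inf_comp (lei_inf_id (inf_cod f)) f = f"
    using f by (auto intro!: lei_inf_arr_eqI[of _ K f] simp: lei_inf_comp_def lei_inf_id_def
        simp del: two_Lei_inf_Alg_simps)
qed

lemma lei_inf_comp_assoc:
  assumes fgh: "f \<in> arr (two_Lei_inf_Alg K)" "g \<in> arr (two_Lei_inf_Alg K)"
    "h \<in> arr (two_Lei_inf_Alg K)" and "inf_cod f = inf_dom g" "inf_cod g = inf_dom h"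
  shows "lei_inf_comp h (lei_inf_comp g f) = lei_inf_comp (lei_inf_comp h g) f"
proof -
  interpret f: leibniz_infinity_morphism K "inf_dom f" "inf_dom g" f using assms by simp
  interpret g: leibniz_infinity_morphism K "inf_dom g" "inf_dom h" g using assms by simp
  interpret h: leibniz_infinity_morphism K "inf_dom h" "inf_cod h" h using assms by simp
  show ?thesis
  proof (rule lei_inf_arr_eqI)
    show "lei_inf_comp h (lei_inf_comp g f) \<in> arr (two_Lei_inf_Alg K)"
      "lei_inf_comp (lei_inf_comp h g) f \<in> arr (two_Lei_inf_Alg K)"
      using assms by (simp_all add: lei_inf_comp_closed del: two_Lei_inf_Alg_simps)
  qed (use assms in \<open>simp_all add: lei_inf_comp_def h.W.V1.M.a_assoc\<close>)
qed

lemma htp_vcomp_id: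
  assumes a: "\<alpha> \<in> cell (two_Lei_inf_Alg K)"
  shows "htp_vcomp \<alpha> (htp_id (htp_src \<alpha>)) = \<alpha>" "htp_vcomp (htp_id (htp_tgt \<alpha>)) \<alpha> = \<alpha>"
proof -
  interpret leibniz_infinity_homotopy K "inf_dom (htp_src \<alpha>)" "inf_cod (htp_src \<alpha>)"
    "htp_src \<alpha>" "htp_tgt \<alpha>" "htp \<alpha>" using a by simp
  note id = lei_inf_cell_arrs[OF a, THEN htp_id_closed]
  show "htp_vcomp \<alpha> (htp_id (htp_src \<alpha>)) = \<alpha>"
    by (rule lei_inf_cell_eqI[OF htp_vcomp_closed[OF id(1) a] a])
      (simp_all add: htp_vcomp_def htp_id_def)
  show "htp_vcomp (htp_id (htp_tgt \<alpha>)) \<alpha> = \<alpha>"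
    by (rule lei_inf_cell_eqI[OF htp_vcomp_closed[OF a id(2)] a])
      (use a in \<open>simp_all add: htp_vcomp_def htp_id_def\<close>)
qed

lemma htp_vcomp_assoc:
  assumes "\<alpha> \<in> cell (two_Lei_inf_Alg K)" "\<beta> \<in> cell (two_Lei_inf_Alg K)"
    "\<gamma> \<in> cell (two_Lei_inf_Alg K)" and "htp_tgt \<alpha> = htp_src \<beta>" "htp_tgt \<beta> = htp_src \<gamma>"
  shows "htp_vcomp \<gamma> (htp_vcomp \<beta> \<alpha>) = htp_vcomp (htp_vcomp \<gamma> \<beta>) \<alpha>"
proof -
  let ?V = "inf_dom (htp_src \<alpha>)" and ?W = "inf_cod (htp_src \<alpha>)"
  have [simp]: "inf_dom (htp_src \<beta>) = ?V" "inf_cod (htp_src \<beta>) = ?W"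
    "inf_dom (htp_src \<gamma>) = ?V" "inf_cod (htp_src \<gamma>) = ?W"
    using assms by auto
  interpret \<alpha>: leibniz_infinity_homotopy K ?V ?W "htp_src \<alpha>" "htp_tgt \<alpha>" "htp \<alpha>" using assms by simp
  interpret \<beta>: leibniz_infinity_homotopy K ?V ?W "htp_src \<beta>" "htp_tgt \<beta>" "htp \<beta>" using assms by simp
  interpret \<gamma>: leibniz_infinity_homotopy K ?V ?W "htp_src \<gamma>" "htp_tgt \<gamma>" "htp \<gamma>" using assms by simp
  show ?thesis
  proof (rule lei_inf_cell_eqI)
    show "htp_vcomp \<gamma> (htp_vcomp \<beta> \<alpha>) \<in> cell (two_Lei_inf_Alg K)"
      "htp_vcomp (htp_vcomp \<gamma> \<beta>) \<alpha> \<in> cell (two_Lei_inf_Alg K)"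
      using assms by (simp_all add: htp_vcomp_closed del: two_Lei_inf_Alg_simps)
  qed (simp_all add: htp_vcomp_def \<alpha>.f.W.V1.M.a_assoc)
qed

lemma htp_hcomp_id:
  assumes a: "\<alpha> \<in> cell (two_Lei_inf_Alg K)"
  shows "htp_hcomp \<alpha> (htp_id (lei_inf_id (inf_dom (htp_src \<alpha>)))) = \<alpha>"
    and "htp_hcomp (htp_id (lei_inf_id (inf_cod (htp_src \<alpha>)))) \<alpha> = \<alpha>"
proof -
  interpret leibniz_infinity_homotopy K "inf_dom (htp_src \<alpha>)" "inf_cod (htp_src \<alpha>)"
    "htp_src \<alpha>" "htp_tgt \<alpha>" "htp \<alpha>" using a by simp
  note st = lei_inf_cell_arrs[OF a]
  note id = lei_inf_arr_objects[OF st(1), THEN lei_inf_id_closed, THEN htp_id_closed]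
  have par: "inf_dom (htp_tgt \<alpha>) = inf_dom (htp_src \<alpha>)" "inf_cod (htp_tgt \<alpha>) = inf_cod (htp_src \<alpha>)"
    using a by simp_all
  have unit: "lei_inf_comp (htp_tgt \<alpha>) (lei_inf_id (inf_dom (htp_src \<alpha>))) = htp_tgt \<alpha>"
    "lei_inf_comp (lei_inf_id (inf_cod (htp_src \<alpha>))) (htp_tgt \<alpha>) = htp_tgt \<alpha>"
    using lei_inf_comp_id[OF st(2)] par by simp_all
  have cl: "htp_hcomp \<alpha> (htp_id (lei_inf_id (inf_dom (htp_src \<alpha>)))) \<in> cell (two_Lei_inf_Alg K)"
    "htp_hcomp (htp_id (lei_inf_id (inf_cod (htp_src \<alpha>)))) \<alpha> \<in> cell (two_Lei_inf_Alg K)"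
    using htp_hcomp_closed[OF id(1) a] htp_hcomp_closed[OF a id(2)] by simp_all
  show "htp_hcomp \<alpha> (htp_id (lei_inf_id (inf_dom (htp_src \<alpha>)))) = \<alpha>"
  proof (rule lei_inf_cell_eqI[OF cl(1) a])
    fix x assume "x \<in> carrier (deg0 (inf_dom (htp_src
      (htp_hcomp \<alpha> (htp_id (lei_inf_id (inf_dom (htp_src \<alpha>))))))))"
    then show "htp (htp_hcomp \<alpha> (htp_id (lei_inf_id (inf_dom (htp_src \<alpha>))))) x = htp \<alpha> x"
      by (simp add: htp_hcomp_def htp_id_def) (simp add: lei_inf_id_def)
  qed (simp_all add: lei_inf_comp_id[OF st(1)] unit)
  show "htp_hcomp (htp_id (lei_inf_id (inf_cod (htp_src \<alpha>)))) \<alpha> = \<alpha>"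
  proof (rule lei_inf_cell_eqI[OF cl(2) a])
    fix x assume "x \<in> carrier (deg0 (inf_dom (htp_src
      (htp_hcomp (htp_id (lei_inf_id (inf_cod (htp_src \<alpha>)))) \<alpha>))))"
    then show "htp (htp_hcomp (htp_id (lei_inf_id (inf_cod (htp_src \<alpha>)))) \<alpha>) x = htp \<alpha> x"
      by (simp add: htp_hcomp_def htp_id_def) (simp add: lei_inf_id_def)
  qed (simp_all add: lei_inf_comp_id[OF st(1)] unit)
qed

lemma htp_hcomp_id2:
  assumes "f \<in> arr (two_Lei_inf_Alg K)" "g \<in> arr (two_Lei_inf_Alg K)" "inf_cod f = inf_dom g"
  shows "htp_hcomp (htp_id g) (htp_id f) = htp_id (lei_inf_comp g f)"
proof -
  interpret f: leibniz_infinity_morphism K "inf_dom f" "inf_dom g" f using assms by simp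
  interpret g: leibniz_infinity_morphism K "inf_dom g" "inf_cod g" g using assms by simp
  show ?thesis
  proof (rule lei_inf_cell_eqI)
    show "htp_hcomp (htp_id g) (htp_id f) \<in> cell (two_Lei_inf_Alg K)"
      "htp_id (lei_inf_comp g f) \<in> cell (two_Lei_inf_Alg K)"
      using assms
      by (simp_all add: htp_hcomp_closed htp_id_closed lei_inf_comp_closed del: two_Lei_inf_Alg_simps)
  qed (use assms in \<open>simp_all add: htp_hcomp_def htp_id_def\<close>)
qed

lemma htp_hcomp_assoc:
  assumes "\<alpha> \<in> cell (two_Lei_inf_Alg K)" "\<beta> \<in> cell (two_Lei_inf_Alg K)"
    "\<gamma> \<in> cell (two_Lei_inf_Alg K)" and "inf_cod (htp_src \<alpha>) = inf_dom (htp_src \<beta>)"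
    "inf_cod (htp_src \<beta>) = inf_dom (htp_src \<gamma>)"
  shows "htp_hcomp \<gamma> (htp_hcomp \<beta> \<alpha>) = htp_hcomp (htp_hcomp \<gamma> \<beta>) \<alpha>"
proof -
  let ?U = "inf_dom (htp_src \<alpha>)" and ?V = "inf_dom (htp_src \<beta>)" and ?W = "inf_dom (htp_src \<gamma>)"
    and ?X = "inf_cod (htp_src \<gamma>)"
  interpret \<alpha>: leibniz_infinity_homotopy K ?U ?V "htp_src \<alpha>" "htp_tgt \<alpha>" "htp \<alpha>" using assms by simp
  interpret \<beta>: leibniz_infinity_homotopy K ?V ?W "htp_src \<beta>" "htp_tgt \<beta>" "htp \<beta>" using assms by simp
  interpret \<gamma>: leibniz_infinity_homotopy K ?W ?X "htp_src \<gamma>" "htp_tgt \<gamma>" "htp \<gamma>" using assms by simp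
  have "inf_cod (htp_tgt \<alpha>) = inf_dom (htp_tgt \<beta>)" "inf_cod (htp_tgt \<beta>) = inf_dom (htp_tgt \<gamma>)"
    using assms by simp_all
  note arrs = this lei_inf_cell_arrs[OF assms(1)] lei_inf_cell_arrs[OF assms(2)]
    lei_inf_cell_arrs[OF assms(3)]
  show ?thesis
  proof (rule lei_inf_cell_eqI)
    show "htp_hcomp \<gamma> (htp_hcomp \<beta> \<alpha>) \<in> cell (two_Lei_inf_Alg K)"
      "htp_hcomp (htp_hcomp \<gamma> \<beta>) \<alpha> \<in> cell (two_Lei_inf_Alg K)"
      using assms by (simp_all add: htp_hcomp_closed del: two_Lei_inf_Alg_simps)
    show "htp_src (htp_hcomp \<gamma> (htp_hcomp \<beta> \<alpha>)) = htp_src (htp_hcomp (htp_hcomp \<gamma> \<beta>) \<alpha>)"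
      "htp_tgt (htp_hcomp \<gamma> (htp_hcomp \<beta> \<alpha>)) = htp_tgt (htp_hcomp (htp_hcomp \<gamma> \<beta>) \<alpha>)"
      using assms arrs by (simp_all add: lei_inf_comp_assoc del: two_Lei_inf_Alg_simps)
  qed (use assms in \<open>simp_all add: htp_hcomp_def lei_inf_comp_def \<gamma>.f.W.V1.M.a_assoc\<close>)
qed

text \<open>The left side transports \<open>\<alpha>\<close> by the target of \<open>\<beta>'\<close> and evaluates \<open>\<beta>'\<close> at the source of \<open>\<alpha>\<close>; the right
  side transports \<open>\<alpha>\<close> by the source of \<open>\<beta>'\<close> and evaluates \<open>\<beta>'\<close> at the target of \<open>\<alpha>\<close>. Each of the two changes
  amounts to \<open>\<beta>'\<close> at \<open>l\<^sub>1 (\<alpha> x)\<close>, and they cancel.\<close>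

lemma htp_interchange:
  assumes "\<alpha> \<in> cell (two_Lei_inf_Alg K)" "\<alpha>' \<in> cell (two_Lei_inf_Alg K)"
    "\<beta> \<in> cell (two_Lei_inf_Alg K)" "\<beta>' \<in> cell (two_Lei_inf_Alg K)"
    and "htp_tgt \<alpha> = htp_src \<alpha>'" "htp_tgt \<beta> = htp_src \<beta>'"
    and "inf_cod (htp_src \<alpha>) = inf_dom (htp_src \<beta>)"
  shows "htp_hcomp (htp_vcomp \<beta>' \<beta>) (htp_vcomp \<alpha>' \<alpha>) =
    htp_vcomp (htp_hcomp \<beta>' \<alpha>') (htp_hcomp \<beta> \<alpha>)"
proof -
  let ?U = "inf_dom (htp_src \<alpha>)" and ?V = "inf_dom (htp_src \<beta>)" and ?W = "inf_cod (htp_src \<beta>)"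
  have par: "inf_dom (htp_src \<alpha>') = ?U" "inf_cod (htp_src \<alpha>') = ?V"
    "inf_dom (htp_src \<beta>') = ?V" "inf_cod (htp_src \<beta>') = ?W"
    using assms by auto
  interpret \<alpha>: leibniz_infinity_homotopy K ?U ?V "htp_src \<alpha>" "htp_src \<alpha>'" "htp \<alpha>"
    using assms by simp
  interpret \<alpha>': leibniz_infinity_homotopy K ?U ?V "htp_src \<alpha>'" "htp_tgt \<alpha>'" "htp \<alpha>'"
    using assms par by simp
  interpret \<beta>: leibniz_infinity_homotopy K ?V ?W "htp_src \<beta>" "htp_src \<beta>'" "htp \<beta>"
    using assms by simp
  interpret \<beta>': leibniz_infinity_homotopy K ?V ?W "htp_src \<beta>'" "htp_tgt \<beta>'" "htp \<beta>'"
    using assms par by simp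
  show ?thesis
  proof (rule lei_inf_cell_eqI)
    show "htp_hcomp (htp_vcomp \<beta>' \<beta>) (htp_vcomp \<alpha>' \<alpha>) \<in> cell (two_Lei_inf_Alg K)"
      "htp_vcomp (htp_hcomp \<beta>' \<alpha>') (htp_hcomp \<beta> \<alpha>) \<in> cell (two_Lei_inf_Alg K)"
      using assms par
      by (simp_all add: htp_hcomp_closed htp_vcomp_closed del: two_Lei_inf_Alg_simps)
  next
    fix x assume "x \<in> carrier (deg0 (inf_dom (htp_src (htp_hcomp (htp_vcomp \<beta>' \<beta>) (htp_vcomp \<alpha>' \<alpha>)))))"
    then have [simp]: "x \<in> carrier (deg0 ?U)" by simp
    show "htp (htp_hcomp (htp_vcomp \<beta>' \<beta>) (htp_vcomp \<alpha>' \<alpha>)) x =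
        htp (htp_vcomp (htp_hcomp \<beta>' \<alpha>') (htp_hcomp \<beta> \<alpha>)) x"
      by (simp add: htp_hcomp_def htp_vcomp_def par assms \<alpha>.target_f1_0 \<beta>'.target_f1_1)
        (rule formal_eqI[where G="deg1 ?W"], (rule formal_intros | simp)+)
  qed (use assms in simp_all)
qed

theorem strict_2_category_two_Lei_inf_Alg: "strict_2_category (two_Lei_inf_Alg K)"
  by unfold_locales
    (simp_all add: lei_inf_closed lei_inf_id_closed lei_inf_arr_objects lei_inf_cell_arrs
      lei_inf_cell_parallel lei_inf_comp_id lei_inf_comp_assoc htp_vcomp_id htp_vcomp_assoc htp_hcomp_id htp_hcomp_id2
      htp_hcomp_assoc htp_interchange del: two_Lei_inf_Alg_simps(2,3))

section \<open>Linear categories and the kernel of the source map\<close>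

definition arrow_part :: "('k, 'a, 'z) linear_cat_scheme \<Rightarrow> 'a \<Rightarrow> 'a" where
  "arrow_part L f = f \<ominus>\<^bsub>mo L\<^esub> idm L (src L f)"

text \<open>The submodule keeps the operations of the module of morphisms, so that no coercion between arrow
  parts and morphisms is needed.\<close>

definition ker_src :: "('k, 'a, 'z) linear_cat_scheme \<Rightarrow> ('k, 'a) module" where
  "ker_src L = (mo L)\<lparr>carrier := {f \<in> carrier (mo L). src L f = \<zero>\<^bsub>ob L\<^esub>}\<rparr>"

lemma ker_src_simps [simp]:
  "f \<in> carrier (ker_src L) \<longleftrightarrow> f \<in> carrier (mo L) \<and> src L f = \<zero>\<^bsub>ob L\<^esub>"
  "add (ker_src L) = add (mo L)" "\<zero>\<^bsub>ker_src L\<^esub> = \<zero>\<^bsub>mo L\<^esub>" "smult (ker_src L) = smult (mo L)"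
  by (simp_all add: ker_src_def)

context linear_category
begin

lemmas abelian_groups [simp] = Ob.M.abelian_group_axioms Mo.M.abelian_group_axioms
lemmas modules [simp] = Ob.module_axioms Mo.module_axioms

lemmas src_simps [simp] = linear_map_simps[OF Mo.module_axioms Ob.module_axioms src_linear]
lemmas tgt_simps [simp] = linear_map_simps[OF Mo.module_axioms Ob.module_axioms tgt_linear]
lemmas idm_simps [simp] = linear_map_simps[OF Ob.module_axioms Mo.module_axioms idm_linear]

declare src_idm [simp] tgt_idm [simp] src_cmp [simp] tgt_cmp [simp] cmp_closed [simp]

lemma module_ker_src [simp]: "module K (ker_src L)"
proof -
  have "submodule {f \<in> carrier (mo L). src L f = \<zero>\<^bsub>ob L\<^esub>} K (mo L)"
    by (rule Mo.submoduleI) simp_all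
  then show ?thesis
    unfolding ker_src_def by (rule submodule.submodule_is_module[OF _ Mo.module_axioms])
qed

lemma abelian_group_ker_src [simp]: "abelian_group (ker_src L)"
  using module_ker_src by (simp add: module_def)

lemma neg_ker_src [simp]:
  assumes "h \<in> carrier (mo L)" "src L h = \<zero>\<^bsub>ob L\<^esub>"
  shows "\<ominus>\<^bsub>ker_src L\<^esub> h = \<ominus>\<^bsub>mo L\<^esub> h"
proof -
  interpret k: abelian_group "ker_src L" by simp
  show ?thesis
    using assms k.minus_equality[of "\<ominus>\<^bsub>mo L\<^esub> h" h] by (simp add: Mo.M.l_neg)
qed

lemma minus_ker_src [simp]:
  assumes "h \<in> carrier (mo L)" "src L h = \<zero>\<^bsub>ob L\<^esub>"
  shows "k \<ominus>\<^bsub>ker_src L\<^esub> h = k \<ominus>\<^bsub>mo L\<^esub> h"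
  using assms by (simp add: a_minus_def)

lemma arrow_part_simps [simp]:
  "f \<in> carrier (mo L) \<Longrightarrow> arrow_part L f \<in> carrier (mo L)"
  "f \<in> carrier (mo L) \<Longrightarrow> src L (arrow_part L f) = \<zero>\<^bsub>ob L\<^esub>"
  "f \<in> carrier (mo L) \<Longrightarrow> tgt L (arrow_part L f) = tgt L f \<ominus>\<^bsub>ob L\<^esub> src L f"
  "x \<in> carrier (ob L) \<Longrightarrow> arrow_part L (idm L x) = \<zero>\<^bsub>mo L\<^esub>"
  by (simp_all add: arrow_part_def Ob.M.minus_eq Mo.M.minus_eq Ob.M.r_neg Mo.M.r_neg)

lemma arrow_part_ker: "\<lbrakk>h \<in> carrier (mo L); src L h = \<zero>\<^bsub>ob L\<^esub>\<rbrakk> \<Longrightarrow> arrow_part L h = h"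
  by (simp add: arrow_part_def Mo.M.minus_eq)

lemma arrow_part_linear: "linear_map K (mo L) (mo L) (arrow_part L)"
  unfolding arrow_part_def
  by (intro linear_map_diff Mo.module_axioms linear_map_ident
      linear_map_compose[OF src_linear idm_linear])

lemmas arrow_part_linear_simps [simp] =
  linear_map_simps(2-)[OF Mo.module_axioms Mo.module_axioms arrow_part_linear]

lemma arrow_part_linear_ker: "linear_map K (mo L) (ker_src L) (arrow_part L)"
  using arrow_part_linear by (auto simp: linear_map_def)

text \<open>Together with \<open>arrow_part_cmp\<close> below, this splitting replaces the calculus of composites by addition.\<close>

lemma decompose: "f \<in> carrier (mo L) \<Longrightarrow> idm L (src L f) \<oplus>\<^bsub>mo L\<^esub> arrow_part L f = f"
  unfolding arrow_part_def
  by (rule formal_eqI[where G="mo L"], (rule formal_intros | simp)+)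

lemma morphism_eqI:
  assumes "f \<in> carrier (mo L)" "g \<in> carrier (mo L)" "src L f = src L g"
    "arrow_part L f = arrow_part L g"
  shows "f = g"
  using assms decompose by metis

text \<open>Interchange of addition and composition, applied to \<open>g = 1 + arrow_part g\<close> and \<open>f = f + 0\<close>: the arrow
  part of \<open>g\<close> starts at \<open>0\<close> and can be composed with the zero morphism.\<close>

lemma cmp_eq:
  assumes [simp]: "f \<in> carrier (mo L)" "g \<in> carrier (mo L)" and eq: "tgt L f = src L g"
  shows "g \<bullet> f = arrow_part L g \<oplus>\<^bsub>mo L\<^esub> f"
proof -
  let ?a = "arrow_part L g" and ?i = "idm L (src L g)"
  have "g \<bullet> f = (?i \<oplus>\<^bsub>mo L\<^esub> ?a) \<bullet> (f \<oplus>\<^bsub>mo L\<^esub> \<zero>\<^bsub>mo L\<^esub>)"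
    by (simp add: decompose)
  also have "\<dots> = (?i \<bullet> f) \<oplus>\<^bsub>mo L\<^esub> (?a \<bullet> \<zero>\<^bsub>mo L\<^esub>)"
    by (rule cmp_add) (simp_all add: eq)
  also have "?i \<bullet> f = f" using cmp_idm_left[of f] eq by simp
  also have "?a \<bullet> \<zero>\<^bsub>mo L\<^esub> = ?a" using cmp_idm_right[of ?a] by simp
  finally show ?thesis by (simp add: Mo.M.a_comm)
qed

lemma arrow_part_cmp [simp]:
  "\<lbrakk>f \<in> carrier (mo L); g \<in> carrier (mo L); tgt L f = src L g\<rbrakk> \<Longrightarrow>
    arrow_part L (g \<bullet> f) = arrow_part L g \<oplus>\<^bsub>mo L\<^esub> arrow_part L f"
  by (simp add: cmp_eq arrow_part_ker)

end

context leibniz_2_algebra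
begin

lemma br0_bilinear: "bilinear_map K (ob L) (ob L) (ob L) (br0 L)"
  and br1_bilinear: "bilinear_map K (mo L) (mo L) (mo L) (br1 L)"
  using bracket_functor by (simp_all add: bilinear_functor_def)

lemmas br0_simps [simp] =
  bilinear_map_simps[OF Ob.module_axioms Ob.module_axioms Ob.module_axioms br0_bilinear]
lemmas br1_simps [simp] =
  bilinear_map_simps[OF Mo.module_axioms Mo.module_axioms Mo.module_axioms br1_bilinear]

lemma br1_functor [simp]:
  "\<lbrakk>f \<in> carrier (mo L); g \<in> carrier (mo L)\<rbrakk> \<Longrightarrow> src L \<lblot>f, g\<rblot> = \<lbrace>src L f, src L g\<rbrace>"
  "\<lbrakk>f \<in> carrier (mo L); g \<in> carrier (mo L)\<rbrakk> \<Longrightarrow> tgt L \<lblot>f, g\<rblot> = \<lbrace>tgt L f, tgt L g\<rbrace>"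
  "\<lbrakk>x \<in> carrier (ob L); y \<in> carrier (ob L)\<rbrakk> \<Longrightarrow> \<lblot>idm L x, idm L y\<rblot> = idm L \<lbrace>x, y\<rbrace>"
  using bracket_functor by (simp_all add: bilinear_functor_def)

lemma br1_cmp:
  "\<lbrakk>f \<in> carrier (mo L); f' \<in> carrier (mo L); g \<in> carrier (mo L); g' \<in> carrier (mo L);
    tgt L f = src L f'; tgt L g = src L g'\<rbrakk> \<Longrightarrow> \<lblot>f' \<bullet> f, g' \<bullet> g\<rblot> = \<lblot>f', g'\<rblot> \<bullet> \<lblot>f, g\<rblot>"
  using bracket_functor by (simp add: bilinear_functor_def)

lemma arrow_part_br1_left:
  assumes [simp]: "f \<in> carrier (mo L)" "x \<in> carrier (ob L)"
  shows "arrow_part L \<lblot>f, idm L x\<rblot> = \<lblot>arrow_part L f, idm L x\<rblot>"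
  by (simp add: arrow_part_def)

lemma arrow_part_br1_right:
  assumes [simp]: "f \<in> carrier (mo L)" "x \<in> carrier (ob L)"
  shows "arrow_part L \<lblot>idm L x, f\<rblot> = \<lblot>idm L x, arrow_part L f\<rblot>"
  by (simp add: arrow_part_def)

text \<open>Functoriality of the bracket at the two factorisations
  \<open>[f, g] = [1, g] \<bullet> [f, 1] = [f, 1] \<bullet> [1, g]\<close>.\<close>

lemma arrow_part_br1:
  assumes [simp]: "f \<in> carrier (mo L)" "g \<in> carrier (mo L)"
  shows "arrow_part L \<lblot>f, g\<rblot> =
      \<lblot>idm L (tgt L f), arrow_part L g\<rblot> \<oplus>\<^bsub>mo L\<^esub> \<lblot>arrow_part L f, idm L (src L g)\<rblot>"
    and "arrow_part L \<lblot>f, g\<rblot> =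
      \<lblot>arrow_part L f, idm L (tgt L g)\<rblot> \<oplus>\<^bsub>mo L\<^esub> \<lblot>idm L (src L f), arrow_part L g\<rblot>"
proof -
  have "\<lblot>f, g\<rblot> = \<lblot>idm L (tgt L f), g\<rblot> \<bullet> \<lblot>f, idm L (src L g)\<rblot>"
    using br1_cmp[of f "idm L (tgt L f)" "idm L (src L g)" g]
    by (simp add: cmp_idm_left cmp_idm_right)
  then show "arrow_part L \<lblot>f, g\<rblot> =
      \<lblot>idm L (tgt L f), arrow_part L g\<rblot> \<oplus>\<^bsub>mo L\<^esub> \<lblot>arrow_part L f, idm L (src L g)\<rblot>"
    by (simp add: arrow_part_br1_left arrow_part_br1_right)
  have "\<lblot>f, g\<rblot> = \<lblot>f, idm L (tgt L g)\<rblot> \<bullet> \<lblot>idm L (src L f), g\<rblot>"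
    using br1_cmp[of "idm L (src L f)" f g "idm L (tgt L g)"]
    by (simp add: cmp_idm_left cmp_idm_right)
  then show "arrow_part L \<lblot>f, g\<rblot> =
      \<lblot>arrow_part L f, idm L (tgt L g)\<rblot> \<oplus>\<^bsub>mo L\<^esub> \<lblot>idm L (src L f), arrow_part L g\<rblot>"
    by (simp add: arrow_part_br1_left arrow_part_br1_right)
qed

text \<open>The two ways of computing the arrow part of \<open>[h, k]\<close> agree. In the kernel algebra this is
  \<open>l\<^sub>2 (l\<^sub>1 h) k = l\<^sub>2 h (l\<^sub>1 k)\<close>.\<close>

lemma br1_ker:
  assumes [simp]: "h \<in> carrier (mo L)" "k \<in> carrier (mo L)"
    "src L h = \<zero>\<^bsub>ob L\<^esub>" "src L k = \<zero>\<^bsub>ob L\<^esub>"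
  shows "\<lblot>idm L (tgt L h), k\<rblot> = \<lblot>h, idm L (tgt L k)\<rblot>"
  using arrow_part_br1[of h k] by (simp add: arrow_part_ker)

lemma jac_trilinear: "trilinear_map K (ob L) (ob L) (ob L) (mo L) (jac L)"
  using jacobiator_transformation by (simp add: trilinear_transformation_def)

lemmas jac_linear_simps [simp] = trilinear_map_simps[OF Ob.module_axioms Ob.module_axioms
    Ob.module_axioms Mo.module_axioms jac_trilinear]

lemma src_jac [simp]:
    "\<lbrakk>x \<in> carrier (ob L); y \<in> carrier (ob L); z \<in> carrier (ob L)\<rbrakk> \<Longrightarrow>
      src L (jac L x y z) = \<lbrace>x, \<lbrace>y, z\<rbrace>\<rbrace>"
  and tgt_jac [simp]:
    "\<lbrakk>x \<in> carrier (ob L); y \<in> carrier (ob L); z \<in> carrier (ob L)\<rbrakk> \<Longrightarrow>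
      tgt L (jac L x y z) = \<lbrace>\<lbrace>x, y\<rbrace>, z\<rbrace> \<oplus>\<^bsub>ob L\<^esub> \<lbrace>y, \<lbrace>x, z\<rbrace>\<rbrace>"
  using jacobiator_transformation by (simp_all add: trilinear_transformation_def)

lemma arrow_part_jac_natural:
  assumes [simp]: "f \<in> carrier (mo L)" "g \<in> carrier (mo L)" "h \<in> carrier (mo L)"
  shows "arrow_part L (jac L (tgt L f) (tgt L g) (tgt L h)) \<oplus>\<^bsub>mo L\<^esub> arrow_part L \<lblot>f, \<lblot>g, h\<rblot>\<rblot> =
    arrow_part L (\<lblot>\<lblot>f, g\<rblot>, h\<rblot> \<oplus>\<^bsub>mo L\<^esub> \<lblot>g, \<lblot>f, h\<rblot>\<rblot>) \<oplus>\<^bsub>mo L\<^esub>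
      arrow_part L (jac L (src L f) (src L g) (src L h))"
proof -
  have "jac L (tgt L f) (tgt L g) (tgt L h) \<bullet> \<lblot>f, \<lblot>g, h\<rblot>\<rblot> =
      (\<lblot>\<lblot>f, g\<rblot>, h\<rblot> \<oplus>\<^bsub>mo L\<^esub> \<lblot>g, \<lblot>f, h\<rblot>\<rblot>) \<bullet> jac L (src L f) (src L g) (src L h)"
    using jacobiator_transformation by (simp add: trilinear_transformation_def)
  from arg_cong[OF this, of "arrow_part L"] show ?thesis
    by (simp del: arrow_part_linear_simps)
qed

lemma arrow_part_jac_coherence:
  assumes [simp]: "w \<in> carrier (ob L)" "x \<in> carrier (ob L)" "y \<in> carrier (ob L)" "z \<in> carrier (ob L)"
  shows "\<lblot>arrow_part L (jac L w x y), idm L z\<rblot> \<oplus>\<^bsub>mo L\<^esub>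
      (\<lblot>idm L y, arrow_part L (jac L w x z)\<rblot> \<oplus>\<^bsub>mo L\<^esub>
      ((arrow_part L (jac L w \<lbrace>x, y\<rbrace> z) \<oplus>\<^bsub>mo L\<^esub> arrow_part L (jac L w y \<lbrace>x, z\<rbrace>)) \<oplus>\<^bsub>mo L\<^esub>
      \<lblot>idm L w, arrow_part L (jac L x y z)\<rblot>)) =
    (arrow_part L (jac L \<lbrace>w, x\<rbrace> y z) \<oplus>\<^bsub>mo L\<^esub> arrow_part L (jac L x \<lbrace>w, y\<rbrace> z) \<oplus>\<^bsub>mo L\<^esub>
      arrow_part L (jac L x y \<lbrace>w, z\<rbrace>)) \<oplus>\<^bsub>mo L\<^esub>
    (\<lblot>idm L x, arrow_part L (jac L w y z)\<rblot> \<oplus>\<^bsub>mo L\<^esub> arrow_part L (jac L w x \<lbrace>y, z\<rbrace>))"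
proof -
  \<comment> \<open>composability of the factors holds only up to the order of the summands\<close>
  note ac = Ob.M.a_assoc Ob.M.a_comm Ob.M.a_lcomm
  from arg_cong[OF jacobiator_coherence[OF assms], of "arrow_part L"] show ?thesis
    by (simp add: ac arrow_part_br1_left arrow_part_br1_right)
qed

end

text \<open>The sign of \<open>l\<^sub>3\<close> comes from the direction of the Jacobiator, which goes from \<open>[x, [y, z]]\<close>
  to \<open>[[x, y], z] + [y, [x, z]]\<close>.\<close>

definition kernel_algebra :: "('k, 'a) lei2 \<Rightarrow> ('k, 'a) lei_inf" where
  "kernel_algebra L = \<lparr>deg0 = ob L, deg1 = ker_src L, l1 = tgt L, l2_00 = br0 L,
    l2_01 = (\<lambda>x h. br1 L (idm L x) h), l2_10 = (\<lambda>h x. br1 L h (idm L x)),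
    l3 = (\<lambda>x y z. \<ominus>\<^bsub>mo L\<^esub> arrow_part L (jac L x y z))\<rparr>"

lemma kernel_algebra_simps [simp]:
  "deg0 (kernel_algebra L) = ob L" "deg1 (kernel_algebra L) = ker_src L"
  "l1 (kernel_algebra L) = tgt L" "l2_00 (kernel_algebra L) = br0 L"
  "l2_01 (kernel_algebra L) x h = br1 L (idm L x) h"
  "l2_10 (kernel_algebra L) h x = br1 L h (idm L x)"
  "l3 (kernel_algebra L) x y z = \<ominus>\<^bsub>mo L\<^esub> arrow_part L (jac L x y z)"
  by (simp_all add: kernel_algebra_def)

text \<open>The three conditions on \<open>l\<^sub>3\<close> with one argument \<open>l\<^sub>1 h\<close> are naturality of the Jacobiator in that
  argument at the morphism \<open>h : 0 \<rightarrow> l\<^sub>1 h\<close>, where the Jacobiator at \<open>0\<close> vanishes. The last condition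
  is the coherence law read on arrow parts.\<close>

lemma (in leibniz_2_algebra) leibniz_infinity_algebra_kernel:
  "leibniz_infinity_algebra K (kernel_algebra L)"
proof (intro leibniz_infinity_algebra.intro leibniz_infinity_algebra_axioms.intro)
  show "linear_map K (deg1 (kernel_algebra L)) (deg0 (kernel_algebra L)) (l1 (kernel_algebra L))"
    by (simp add: linear_map_def)
  show "bilinear_map K (deg0 (kernel_algebra L)) (deg0 (kernel_algebra L)) (deg0 (kernel_algebra L))
      (l2_00 (kernel_algebra L))"
    by (simp add: br0_bilinear)
  show "bilinear_map K (deg0 (kernel_algebra L)) (deg1 (kernel_algebra L)) (deg1 (kernel_algebra L))
      (l2_01 (kernel_algebra L))"
    by (simp add: bilinear_map_def linear_map_def)
  show "bilinear_map K (deg1 (kernel_algebra L)) (deg0 (kernel_algebra L)) (deg1 (kernel_algebra L))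
      (l2_10 (kernel_algebra L))"
    by (simp add: bilinear_map_def linear_map_def)
  show "trilinear_map K (deg0 (kernel_algebra L)) (deg0 (kernel_algebra L)) (deg0 (kernel_algebra L))
      (deg1 (kernel_algebra L)) (l3 (kernel_algebra L))"
    by (simp add: trilinear_map_def linear_map_def Mo.M.minus_add Mo.M.a_comm Mo.smult_r_minus)
next
  fix x y h
  assume "x \<in> carrier (deg0 (kernel_algebra L))" "y \<in> carrier (deg0 (kernel_algebra L))"
    "h \<in> carrier (deg1 (kernel_algebra L))"
  then have [simp]: "x \<in> carrier (ob L)" "y \<in> carrier (ob L)" "h \<in> carrier (mo L)"
    "src L h = \<zero>\<^bsub>ob L\<^esub>" by simp_all
  \<comment> \<open>in each case, the Jacobiator at the source vanishes because \<open>src L h = 0\<close>\<close>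
  note nat = arrow_part_jac_natural[of "idm L x" "idm L y" h]
    arrow_part_jac_natural[of "idm L x" h "idm L y"] arrow_part_jac_natural[of h "idm L x" "idm L y"]
  show "l3 (kernel_algebra L) x y (l1 (kernel_algebra L) h) =
    l2_01 (kernel_algebra L) x (l2_01 (kernel_algebra L) y h)
    \<ominus>\<^bsub>deg1 (kernel_algebra L)\<^esub> l2_01 (kernel_algebra L) y (l2_01 (kernel_algebra L) x h)
    \<ominus>\<^bsub>deg1 (kernel_algebra L)\<^esub> l2_01 (kernel_algebra L) (l2_00 (kernel_algebra L) x y) h"
    using nat(1) by (simp add: arrow_part_ker)
      (rule formal_eqI_from[where G="mo L", OF sym], assumption, (rule formal_intros | simp)+)
  show "l3 (kernel_algebra L) x (l1 (kernel_algebra L) h) y =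
    l2_01 (kernel_algebra L) x (l2_10 (kernel_algebra L) h y)
    \<ominus>\<^bsub>deg1 (kernel_algebra L)\<^esub> l2_10 (kernel_algebra L) h (l2_00 (kernel_algebra L) x y)
    \<ominus>\<^bsub>deg1 (kernel_algebra L)\<^esub> l2_10 (kernel_algebra L) (l2_01 (kernel_algebra L) x h) y"
    using nat(2) by (simp add: arrow_part_ker)
      (rule formal_eqI_from[where G="mo L", OF sym], assumption, (rule formal_intros | simp)+)
  show "l3 (kernel_algebra L) (l1 (kernel_algebra L) h) x y =
    l2_10 (kernel_algebra L) h (l2_00 (kernel_algebra L) x y)
    \<ominus>\<^bsub>deg1 (kernel_algebra L)\<^esub> l2_01 (kernel_algebra L) x (l2_10 (kernel_algebra L) h y)
    \<ominus>\<^bsub>deg1 (kernel_algebra L)\<^esub> l2_10 (kernel_algebra L) (l2_10 (kernel_algebra L) h x) y"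
    using nat(3) by (simp add: arrow_part_ker)
      (rule formal_eqI_from[where G="mo L", OF sym], assumption, (rule formal_intros | simp)+)
next
  fix x y z
  assume "x \<in> carrier (deg0 (kernel_algebra L))" "y \<in> carrier (deg0 (kernel_algebra L))"
    "z \<in> carrier (deg0 (kernel_algebra L))"
  then have [simp]: "x \<in> carrier (ob L)" "y \<in> carrier (ob L)" "z \<in> carrier (ob L)" by simp_all
  show "l1 (kernel_algebra L) (l3 (kernel_algebra L) x y z) =
    l2_00 (kernel_algebra L) x (l2_00 (kernel_algebra L) y z)
    \<ominus>\<^bsub>deg0 (kernel_algebra L)\<^esub> l2_00 (kernel_algebra L) y (l2_00 (kernel_algebra L) x z)
    \<ominus>\<^bsub>deg0 (kernel_algebra L)\<^esub> l2_00 (kernel_algebra L) (l2_00 (kernel_algebra L) x y) z"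
    by simp
      (rule formal_eqI[where G="ob L"], (rule formal_intros | simp)+)
next
  fix w x y z
  assume "w \<in> carrier (deg0 (kernel_algebra L))" "x \<in> carrier (deg0 (kernel_algebra L))"
    "y \<in> carrier (deg0 (kernel_algebra L))" "z \<in> carrier (deg0 (kernel_algebra L))"
  then have m [simp]: "w \<in> carrier (ob L)" "x \<in> carrier (ob L)" "y \<in> carrier (ob L)"
    "z \<in> carrier (ob L)" by simp_all
  let ?V = "kernel_algebra L"
  show "l2_10 ?V (l3 ?V w x y) z
          \<oplus>\<^bsub>deg1 ?V\<^esub> l2_01 ?V w (l3 ?V x y z)
          \<ominus>\<^bsub>deg1 ?V\<^esub> l2_01 ?V x (l3 ?V w y z)
          \<oplus>\<^bsub>deg1 ?V\<^esub> l2_01 ?V y (l3 ?V w x z)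
          \<ominus>\<^bsub>deg1 ?V\<^esub> l3 ?V (l2_00 ?V w x) y z
          \<oplus>\<^bsub>deg1 ?V\<^esub> l3 ?V w (l2_00 ?V x y) z
          \<ominus>\<^bsub>deg1 ?V\<^esub> l3 ?V x (l2_00 ?V w y) z
          \<ominus>\<^bsub>deg1 ?V\<^esub> l3 ?V w x (l2_00 ?V y z)
          \<oplus>\<^bsub>deg1 ?V\<^esub> l3 ?V w y (l2_00 ?V x z)
          \<ominus>\<^bsub>deg1 ?V\<^esub> l3 ?V x y (l2_00 ?V w z) = \<zero>\<^bsub>deg1 ?V\<^esub>"
    by simp
      (rule formal_eqI_from[where G="mo L", OF arrow_part_jac_coherence[OF m, symmetric]],
        (rule formal_intros | simp)+)
qed (simp_all add: br1_ker)

section \<open>Morphisms of Leibniz 2-algebras and of their kernels\<close>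

definition kernel_mor :: "('k, 'a) lei2_mor \<Rightarrow> ('k, 'a) lei_inf_mor" where
  "kernel_mor F = \<lparr>inf_dom = kernel_algebra (mor_dom F), inf_cod = kernel_algebra (mor_cod F),
    f1_0 = fun0 F,
    f1_1 = (\<lambda>h\<in>carrier (ker_src (mor_dom F)). fun1 F h),
    f2 = (\<lambda>x\<in>carrier (ob (mor_dom F)). \<lambda>y\<in>carrier (ob (mor_dom F)).
      arrow_part (mor_cod F) (str F x y))\<rparr>"

text \<open>On arrow parts the functor is \<open>f\<^sub>1\<close> and the structure transformation is \<open>f\<^sub>2\<close>, as there is no other
  choice by \<open>decompose\<close>.\<close>

definition extend_mor :: "('k, 'a) lei2 \<Rightarrow> ('k, 'a) lei2 \<Rightarrow> ('k, 'a) lei_inf_mor \<Rightarrow> ('k, 'a) lei2_mor"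
  where "extend_mor L M f = \<lparr>mor_dom = L, mor_cod = M,
    fun0 = f1_0 f,
    fun1 = (\<lambda>m\<in>carrier (mo L). idm M (f1_0 f (src L m)) \<oplus>\<^bsub>mo M\<^esub> f1_1 f (arrow_part L m)),
    str = (\<lambda>x\<in>carrier (ob L). \<lambda>y\<in>carrier (ob L).
      idm M (br0 M (f1_0 f x) (f1_0 f y)) \<oplus>\<^bsub>mo M\<^esub> f2 f x y)\<rparr>"

context leibniz_2_morphism
begin

lemma fun0_linear: "linear_map K (ob L) (ob M) (fun0 F)"
  and fun1_linear: "linear_map K (mo L) (mo M) (fun1 F)"
  using mor_functor by (simp_all add: linear_functor_def)

lemma str_bilinear: "bilinear_map K (ob L) (ob L) (mo M) (str F)"
  using str_transformation by (simp add: bilinear_transformation_def)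

lemmas fun0_simps [simp] = linear_map_simps[OF L.Ob.module_axioms M.Ob.module_axioms fun0_linear]
lemmas fun1_simps [simp] = linear_map_simps[OF L.Mo.module_axioms M.Mo.module_axioms fun1_linear]
lemmas str_simps [simp] =
  bilinear_map_simps[OF L.Ob.module_axioms L.Ob.module_axioms M.Mo.module_axioms str_bilinear]

lemma fun1_functor [simp]:
  "f \<in> carrier (mo L) \<Longrightarrow> src M (fun1 F f) = fun0 F (src L f)"
  "f \<in> carrier (mo L) \<Longrightarrow> tgt M (fun1 F f) = fun0 F (tgt L f)"
  "x \<in> carrier (ob L) \<Longrightarrow> fun1 F (idm L x) = idm M (fun0 F x)"
  using mor_functor by (simp_all add: linear_functor_def)

lemma str_components [simp]:
  "\<lbrakk>x \<in> carrier (ob L); y \<in> carrier (ob L)\<rbrakk> \<Longrightarrow> src M (str F x y) = br0 M (fun0 F x) (fun0 F y)"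
  "\<lbrakk>x \<in> carrier (ob L); y \<in> carrier (ob L)\<rbrakk> \<Longrightarrow> tgt M (str F x y) = fun0 F (br0 L x y)"
  using str_transformation by (simp_all add: bilinear_transformation_def)

lemma arrow_part_fun1 [simp]:
  "f \<in> carrier (mo L) \<Longrightarrow> arrow_part M (fun1 F f) = fun1 F (arrow_part L f)"
  by (simp add: arrow_part_def)

lemma arrow_part_str_natural:
  assumes [simp]: "f \<in> carrier (mo L)" "g \<in> carrier (mo L)"
  shows "arrow_part M (str F (tgt L f) (tgt L g)) \<oplus>\<^bsub>mo M\<^esub>
      arrow_part M (br1 M (fun1 F f) (fun1 F g)) =
    fun1 F (arrow_part L (br1 L f g)) \<oplus>\<^bsub>mo M\<^esub> arrow_part M (str F (src L f) (src L g))"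
proof -
  have "cmp M (str F (tgt L f) (tgt L g)) (br1 M (fun1 F f) (fun1 F g)) =
      cmp M (fun1 F (br1 L f g)) (str F (src L f) (src L g))"
    using str_transformation by (simp add: bilinear_transformation_def)
  from arg_cong[OF this, of "arrow_part M"] show ?thesis by simp
qed

lemma arrow_part_str_coherence:
  assumes [simp]: "x \<in> carrier (ob L)" "y \<in> carrier (ob L)" "z \<in> carrier (ob L)"
  shows "(arrow_part M (str F (br0 L x y) z) \<oplus>\<^bsub>mo M\<^esub> arrow_part M (str F y (br0 L x z)))
      \<oplus>\<^bsub>mo M\<^esub> ((br1 M (arrow_part M (str F x y)) (idm M (fun0 F z)) \<oplus>\<^bsub>mo M\<^esub>
        br1 M (idm M (fun0 F y)) (arrow_part M (str F x z)))
      \<oplus>\<^bsub>mo M\<^esub> arrow_part M (jac M (fun0 F x) (fun0 F y) (fun0 F z))) =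
    fun1 F (arrow_part L (jac L x y z)) \<oplus>\<^bsub>mo M\<^esub> (arrow_part M (str F x (br0 L y z))
      \<oplus>\<^bsub>mo M\<^esub> br1 M (idm M (fun0 F x)) (arrow_part M (str F y z)))"
  using arg_cong[OF str_coherence[OF assms], of "arrow_part M"]
  by (simp add: M.arrow_part_br1_left M.arrow_part_br1_right)

text \<open>The conditions on brackets of an object with \<open>h\<close> are naturality of the structure transformation at an
  identity and the morphism \<open>h : 0 \<rightarrow> l\<^sub>1 h\<close>.\<close>

lemma kernel_mor_morphism:
  assumes "mor_dom F = L" "mor_cod F = M"
  shows "leibniz_infinity_morphism K (kernel_algebra L) (kernel_algebra M) (kernel_mor F)"
proof -
  have comps: "f1_0 (kernel_mor F) = fun0 F"
    "f1_1 (kernel_mor F) = (\<lambda>h\<in>carrier (ker_src L). fun1 F h)"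
    "f2 (kernel_mor F) = (\<lambda>x\<in>carrier (ob L). \<lambda>y\<in>carrier (ob L). arrow_part M (str F x y))"
    by (simp_all add: kernel_mor_def assms)
  show ?thesis
  proof (intro leibniz_infinity_morphism.intro leibniz_infinity_morphism_axioms.intro
      L.leibniz_infinity_algebra_kernel M.leibniz_infinity_algebra_kernel)
    show "linear_map K (deg0 (kernel_algebra L)) (deg0 (kernel_algebra M)) (f1_0 (kernel_mor F))"
      by (simp add: comps fun0_linear)
    have "linear_map K (ker_src L) (ker_src M) (fun1 F)"
      by (simp add: linear_map_def)
    then show "linear_map K (deg1 (kernel_algebra L)) (deg1 (kernel_algebra M)) (f1_1 (kernel_mor F))"
      by (simp add: comps del: ker_src_simps)
    show "bilinear_map K (deg0 (kernel_algebra L)) (deg0 (kernel_algebra L))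
        (deg1 (kernel_algebra M)) (f2 (kernel_mor F))"
      using bilinear_map_postcompose[OF str_bilinear M.arrow_part_linear_ker]
      by (simp add: comps)
    show "f1_0 (kernel_mor F) \<in> carrier (deg0 (kernel_algebra L)) \<rightarrow>\<^sub>E carrier (deg0 (kernel_algebra M))"
      using fun0_ext by (simp add: comps)
    show "f1_1 (kernel_mor F) \<in> carrier (deg1 (kernel_algebra L)) \<rightarrow>\<^sub>E carrier (deg1 (kernel_algebra M))"
      by (auto simp: comps)
    show "f2 (kernel_mor F) \<in> carrier (deg0 (kernel_algebra L)) \<rightarrow>\<^sub>E
        (carrier (deg0 (kernel_algebra L)) \<rightarrow>\<^sub>E carrier (deg1 (kernel_algebra M)))"
      by (auto simp: comps)
  next
    fix h assume "h \<in> carrier (deg1 (kernel_algebra L))"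
    then show "l1 (kernel_algebra M) (f1_1 (kernel_mor F) h) =
        f1_0 (kernel_mor F) (l1 (kernel_algebra L) h)"
      by (simp add: comps)
  next
    fix x y assume "x \<in> carrier (deg0 (kernel_algebra L))" "y \<in> carrier (deg0 (kernel_algebra L))"
    then have [simp]: "x \<in> carrier (ob L)" "y \<in> carrier (ob L)" by simp_all
    show "l2_00 (kernel_algebra M) (f1_0 (kernel_mor F) x) (f1_0 (kernel_mor F) y)
        \<oplus>\<^bsub>deg0 (kernel_algebra M)\<^esub> l1 (kernel_algebra M) (f2 (kernel_mor F) x y) =
        f1_0 (kernel_mor F) (l2_00 (kernel_algebra L) x y)"
      by (simp add: comps)
        (rule formal_eqI[where G="ob M"], (rule formal_intros | simp)+)
  next
    fix x h assume "x \<in> carrier (deg0 (kernel_algebra L))" "h \<in> carrier (deg1 (kernel_algebra L))"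
    then have [simp]: "x \<in> carrier (ob L)" "h \<in> carrier (mo L)" "src L h = \<zero>\<^bsub>ob L\<^esub>" by simp_all
    note nat = arrow_part_str_natural[of "idm L x" h] arrow_part_str_natural[of h "idm L x"]
    show "l2_01 (kernel_algebra M) (f1_0 (kernel_mor F) x) (f1_1 (kernel_mor F) h) =
        f1_1 (kernel_mor F) (l2_01 (kernel_algebra L) x h)
        \<ominus>\<^bsub>deg1 (kernel_algebra M)\<^esub> f2 (kernel_mor F) x (l1 (kernel_algebra L) h)"
      using nat(1) by (simp add: comps L.arrow_part_ker M.arrow_part_ker)
        (rule formal_eqI_from[where G="mo M"], assumption, (rule formal_intros | simp)+)
    show "l2_10 (kernel_algebra M) (f1_1 (kernel_mor F) h) (f1_0 (kernel_mor F) x) =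
        f1_1 (kernel_mor F) (l2_10 (kernel_algebra L) h x)
        \<ominus>\<^bsub>deg1 (kernel_algebra M)\<^esub> f2 (kernel_mor F) (l1 (kernel_algebra L) h) x"
      using nat(2) by (simp add: comps L.arrow_part_ker M.arrow_part_ker)
        (rule formal_eqI_from[where G="mo M"], assumption, (rule formal_intros | simp)+)
  next
    fix x y z assume "x \<in> carrier (deg0 (kernel_algebra L))" "y \<in> carrier (deg0 (kernel_algebra L))"
      "z \<in> carrier (deg0 (kernel_algebra L))"
    then have m [simp]: "x \<in> carrier (ob L)" "y \<in> carrier (ob L)" "z \<in> carrier (ob L)" by simp_all
    show "l3 (kernel_algebra M) (f1_0 (kernel_mor F) x) (f1_0 (kernel_mor F) y) (f1_0 (kernel_mor F) z)
          \<ominus>\<^bsub>deg1 (kernel_algebra M)\<^esub>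
            l2_10 (kernel_algebra M) (f2 (kernel_mor F) x y) (f1_0 (kernel_mor F) z)
          \<oplus>\<^bsub>deg1 (kernel_algebra M)\<^esub>
            l2_01 (kernel_algebra M) (f1_0 (kernel_mor F) x) (f2 (kernel_mor F) y z)
          \<ominus>\<^bsub>deg1 (kernel_algebra M)\<^esub>
            l2_01 (kernel_algebra M) (f1_0 (kernel_mor F) y) (f2 (kernel_mor F) x z) =
        f1_1 (kernel_mor F) (l3 (kernel_algebra L) x y z)
          \<oplus>\<^bsub>deg1 (kernel_algebra M)\<^esub> f2 (kernel_mor F) (l2_00 (kernel_algebra L) x y) z
          \<ominus>\<^bsub>deg1 (kernel_algebra M)\<^esub> f2 (kernel_mor F) x (l2_00 (kernel_algebra L) y z)
          \<oplus>\<^bsub>deg1 (kernel_algebra M)\<^esub> f2 (kernel_mor F) y (l2_00 (kernel_algebra L) x z)"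
      by (simp add: comps)
        (rule formal_eqI_from[where G="mo M", OF arrow_part_str_coherence[OF m, symmetric]],
          (rule formal_intros | simp)+)
  qed
qed

end

lemma lei2_mor_eqI:
  fixes F G :: "('k, 'a) lei2_mor"
  assumes "leibniz_2_morphism K L M F" "leibniz_2_morphism K L M G"
    and "mor_dom F = mor_dom G" "mor_cod F = mor_cod G"
    and "\<And>x. x \<in> carrier (ob L) \<Longrightarrow> fun0 F x = fun0 G x"
    and "\<And>m. m \<in> carrier (mo L) \<Longrightarrow> fun1 F m = fun1 G m"
    and str: "\<And>x y. \<lbrakk>x \<in> carrier (ob L); y \<in> carrier (ob L)\<rbrakk> \<Longrightarrow> str F x y = str G x y"
  shows "F = G"
proof -
  interpret F: leibniz_2_morphism K L M F by fact
  interpret G: leibniz_2_morphism K L M G by fact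
  have "fun0 F = fun0 G"
    by (rule PiE_ext[OF F.fun0_ext G.fun0_ext]) (rule assms(5))
  moreover have "fun1 F = fun1 G"
    by (rule PiE_ext[OF F.fun1_ext G.fun1_ext]) (rule assms(6))
  moreover have "str F = str G"
  proof (rule PiE_ext[OF F.str_ext G.str_ext])
    fix x assume x: "x \<in> carrier (ob L)"
    show "str F x = str G x"
      by (rule PiE_ext[OF PiE_mem[OF F.str_ext x] PiE_mem[OF G.str_ext x]]) (rule str[OF x])
  qed
  ultimately show ?thesis using assms(3,4) by (intro lei2_mor.equality) simp_all
qed

text \<open>The lemmas of this locale restate the properties of \<open>f\<close> in terms of the operations of \<open>L\<close> and \<open>M\<close>,
  in which the constructions below are expressed.\<close>

locale kernel_morphism =
  L: leibniz_2_algebra K L + M: leibniz_2_algebra K M +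
  f: leibniz_infinity_morphism K "kernel_algebra L" "kernel_algebra M" f
  for K :: "('k, 'r) ring_scheme" and L M :: "('k, 'a) lei2" and f :: "('k, 'a) lei_inf_mor"
begin

lemma f1_0_linear: "linear_map K (ob L) (ob M) (f1_0 f)"
  and f1_1_linear: "linear_map K (ker_src L) (ker_src M) (f1_1 f)"
  and f2_bilinear: "bilinear_map K (ob L) (ob L) (ker_src M) (f2 f)"
  using f.f1_0_linear f.f1_1_linear f.f2_bilinear by simp_all

lemmas f1_0_simps [simp] = linear_map_simps[OF L.Ob.module_axioms M.Ob.module_axioms f1_0_linear]

lemma f1_1_simps [simp]:
  assumes h: "h \<in> carrier (mo L)" "src L h = \<zero>\<^bsub>ob L\<^esub>"
  shows "f1_1 f h \<in> carrier (mo M)" "src M (f1_1 f h) = \<zero>\<^bsub>ob M\<^esub>"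
    "tgt M (f1_1 f h) = f1_0 f (tgt L h)" "f1_1 f (\<ominus>\<^bsub>mo L\<^esub> h) = \<ominus>\<^bsub>mo M\<^esub> f1_1 f h"
    "\<lbrakk>k \<in> carrier (mo L); src L k = \<zero>\<^bsub>ob L\<^esub>\<rbrakk> \<Longrightarrow> f1_1 f (h \<oplus>\<^bsub>mo L\<^esub> k) = f1_1 f h \<oplus>\<^bsub>mo M\<^esub> f1_1 f k"
    "arrow_part M (f1_1 f h) = f1_1 f h"
proof -
  note lin = linear_map_simps[OF L.module_ker_src M.module_ker_src f1_1_linear]
  show mem: "f1_1 f h \<in> carrier (mo M)" "src M (f1_1 f h) = \<zero>\<^bsub>ob M\<^esub>"
    using lin(1)[of h] h by simp_all
  show "tgt M (f1_1 f h) = f1_0 f (tgt L h)"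
    using f.f1_chain[of h] h by simp
  show "f1_1 f (\<ominus>\<^bsub>mo L\<^esub> h) = \<ominus>\<^bsub>mo M\<^esub> f1_1 f h"
    using lin(3)[of h] h mem by simp
  show "\<lbrakk>k \<in> carrier (mo L); src L k = \<zero>\<^bsub>ob L\<^esub>\<rbrakk> \<Longrightarrow>
      f1_1 f (h \<oplus>\<^bsub>mo L\<^esub> k) = f1_1 f h \<oplus>\<^bsub>mo M\<^esub> f1_1 f k"
    using lin(2)[of h k] h by simp
  show "arrow_part M (f1_1 f h) = f1_1 f h"
    using mem by (rule M.arrow_part_ker)
qed

lemma f1_1_zero [simp]: "f1_1 f \<zero>\<^bsub>mo L\<^esub> = \<zero>\<^bsub>mo M\<^esub>"
  using linear_map_simps(5)[OF L.module_ker_src M.module_ker_src f1_1_linear] by simp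

lemma f2_simps [simp]:
  assumes [simp]: "x \<in> carrier (ob L)" "y \<in> carrier (ob L)"
  shows "f2 f x y \<in> carrier (mo M)" "src M (f2 f x y) = \<zero>\<^bsub>ob M\<^esub>"
    "tgt M (f2 f x y) = f1_0 f (br0 L x y) \<ominus>\<^bsub>ob M\<^esub> br0 M (f1_0 f x) (f1_0 f y)"
    "arrow_part M (f2 f x y) = f2 f x y"
proof -
  show mem [simp]: "f2 f x y \<in> carrier (mo M)" "src M (f2 f x y) = \<zero>\<^bsub>ob M\<^esub>"
    using bilinear_map_simps(1)[OF L.Ob.module_axioms L.Ob.module_axioms M.module_ker_src f2_bilinear,
        of x y] by simp_all
  have eq: "br0 M (f1_0 f x) (f1_0 f y) \<oplus>\<^bsub>ob M\<^esub> tgt M (f2 f x y) = f1_0 f (br0 L x y)"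
    using f.f1_l2_00[of x y] by simp
  show "tgt M (f2 f x y) = f1_0 f (br0 L x y) \<ominus>\<^bsub>ob M\<^esub> br0 M (f1_0 f x) (f1_0 f y)"
    by (rule formal_eqI_from[where G="ob M", OF eq], (rule formal_intros | simp)+)
  show "arrow_part M (f2 f x y) = f2 f x y"
    using mem by (rule M.arrow_part_ker)
qed

lemma f2_diff:
  "\<lbrakk>x \<in> carrier (ob L); y \<in> carrier (ob L); z \<in> carrier (ob L)\<rbrakk> \<Longrightarrow>
    f2 f x (y \<ominus>\<^bsub>ob L\<^esub> z) = f2 f x y \<ominus>\<^bsub>mo M\<^esub> f2 f x z"
  "\<lbrakk>x \<in> carrier (ob L); y \<in> carrier (ob L); z \<in> carrier (ob L)\<rbrakk> \<Longrightarrow>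
    f2 f (x \<ominus>\<^bsub>ob L\<^esub> y) z = f2 f x z \<ominus>\<^bsub>mo M\<^esub> f2 f y z"
  using bilinear_map_simps(6,7)[OF L.Ob.module_axioms L.Ob.module_axioms M.module_ker_src f2_bilinear]
  by simp_all

lemma l2_f1_1:
  assumes [simp]: "x \<in> carrier (ob L)" "h \<in> carrier (mo L)" "src L h = \<zero>\<^bsub>ob L\<^esub>"
  shows "br1 M (idm M (f1_0 f x)) (f1_1 f h) = f1_1 f (br1 L (idm L x) h) \<ominus>\<^bsub>mo M\<^esub> f2 f x (tgt L h)"
    and "br1 M (f1_1 f h) (idm M (f1_0 f x)) = f1_1 f (br1 L h (idm L x)) \<ominus>\<^bsub>mo M\<^esub> f2 f (tgt L h) x"
  using f.f1_l2_01[of x h] f.f1_l2_10[of x h] by simp_all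

abbreviation "F \<equiv> extend_mor L M f"

lemma extend_dom_cod [simp]: "mor_dom F = L" "mor_cod F = M" "fun0 F = f1_0 f"
  by (simp_all add: extend_mor_def)

lemma extend_fun1 [simp]:
  assumes [simp]: "m \<in> carrier (mo L)"
  shows "fun1 F m \<in> carrier (mo M)" "src M (fun1 F m) = f1_0 f (src L m)"
    "tgt M (fun1 F m) = f1_0 f (tgt L m)" "arrow_part M (fun1 F m) = f1_1 f (arrow_part L m)"
proof -
  show "fun1 F m \<in> carrier (mo M)" "src M (fun1 F m) = f1_0 f (src L m)"
    "arrow_part M (fun1 F m) = f1_1 f (arrow_part L m)"
    by (simp_all add: extend_mor_def)
  show "tgt M (fun1 F m) = f1_0 f (tgt L m)"
    by (simp add: extend_mor_def)
      (rule formal_eqI[where G="ob M"], (rule formal_intros | simp)+)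
qed

lemma extend_str [simp]:
  assumes [simp]: "x \<in> carrier (ob L)" "y \<in> carrier (ob L)"
  shows "str F x y \<in> carrier (mo M)" "src M (str F x y) = br0 M (f1_0 f x) (f1_0 f y)"
    "tgt M (str F x y) = f1_0 f (br0 L x y)" "arrow_part M (str F x y) = f2 f x y"
proof -
  show "str F x y \<in> carrier (mo M)" "src M (str F x y) = br0 M (f1_0 f x) (f1_0 f y)"
    "arrow_part M (str F x y) = f2 f x y"
    by (simp_all add: extend_mor_def)
  show "tgt M (str F x y) = f1_0 f (br0 L x y)"
    by (simp add: extend_mor_def)
      (rule formal_eqI[where G="ob M"], (rule formal_intros | simp)+)
qed

lemma extend_fun1_linear: "linear_map K (mo L) (mo M) (fun1 F)"
proof -
  have "linear_map K (ker_src L) (mo M) (f1_1 f)"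
    using f1_1_linear by (auto simp: linear_map_def)
  then have "linear_map K (mo L) (mo M) (\<lambda>m. f1_1 f (arrow_part L m))"
    by (rule linear_map_compose[OF L.arrow_part_linear_ker])
  moreover have "linear_map K (mo L) (mo M) (\<lambda>m. idm M (f1_0 f (src L m)))"
    by (rule linear_map_compose[OF L.src_linear linear_map_compose[OF f1_0_linear M.idm_linear]])
  ultimately show ?thesis
    by (simp add: extend_mor_def linear_map_add)
qed

lemma extend_str_bilinear: "bilinear_map K (ob L) (ob L) (mo M) (str F)"
proof -
  have "bilinear_map K (ob L) (ob L) (mo M) (f2 f)"
    using f2_bilinear by (auto simp: bilinear_map_def linear_map_def)
  moreover have "bilinear_map K (ob L) (ob L) (mo M) (\<lambda>x y. idm M (br0 M (f1_0 f x) (f1_0 f y)))"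
    by (rule bilinear_map_postcompose[OF
          bilinear_map_precompose[OF M.br0_bilinear f1_0_linear f1_0_linear] M.idm_linear])
  ultimately show ?thesis
    by (simp add: extend_mor_def bilinear_map_add)
qed

text \<open>A morphism of \<open>L\<close> is a sum of an identity and an arrow part, and the values of the functor on both
  are known; each axiom is an equality of sources and of arrow parts.\<close>

lemma extend_morphism: "leibniz_2_morphism K L M F"
proof (intro leibniz_2_morphism.intro leibniz_2_morphism_axioms.intro
    L.leibniz_2_algebra_axioms M.leibniz_2_algebra_axioms)
  show "linear_functor K L M (fun0 F) (fun1 F)"
    unfolding linear_functor_def
  proof (intro conjI ballI impI)
    fix x assume [simp]: "x \<in> carrier (ob L)"
    show "fun1 F (idm L x) = idm M (fun0 F x)"
      by (rule M.morphism_eqI) simp_all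
  next
    fix m n assume [simp]: "m \<in> carrier (mo L)" "n \<in> carrier (mo L)" and eq: "tgt L m = src L n"
    show "fun1 F (cmp L n m) = cmp M (fun1 F n) (fun1 F m)"
      by (rule M.morphism_eqI) (simp_all add: eq)
  qed (simp_all add: f1_0_linear extend_fun1_linear)
  show "fun0 F \<in> carrier (ob L) \<rightarrow>\<^sub>E carrier (ob M)"
    using f.f1_0_ext by simp
  show "fun1 F \<in> carrier (mo L) \<rightarrow>\<^sub>E carrier (mo M)"
    by (rule PiE_I) (simp_all, simp add: extend_mor_def)
  show "str F \<in> carrier (ob L) \<rightarrow>\<^sub>E (carrier (ob L) \<rightarrow>\<^sub>E carrier (mo M))"
    by (auto simp: extend_mor_def)
  show "bilinear_transformation K L M
      (\<lambda>x y. br0 M (fun0 F x) (fun0 F y)) (\<lambda>g h. br1 M (fun1 F g) (fun1 F h))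
      (\<lambda>x y. fun0 F (br0 L x y)) (\<lambda>g h. fun1 F (br1 L g h)) (str F)"
    unfolding bilinear_transformation_def
  proof (intro conjI ballI)
    fix g h assume [simp]: "g \<in> carrier (mo L)" "h \<in> carrier (mo L)"
    have 1: "br1 M (idm M (f1_0 f (tgt L g))) (f1_1 f (arrow_part L h)) =
        f1_1 f (br1 L (idm L (tgt L g)) (arrow_part L h)) \<ominus>\<^bsub>mo M\<^esub>
        f2 f (tgt L g) (tgt L (arrow_part L h))"
      by (rule l2_f1_1(1)) simp_all
    have 2: "br1 M (f1_1 f (arrow_part L g)) (idm M (f1_0 f (src L h))) =
        f1_1 f (br1 L (arrow_part L g) (idm L (src L h))) \<ominus>\<^bsub>mo M\<^esub>
        f2 f (tgt L (arrow_part L g)) (src L h)"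
      by (rule l2_f1_1(2)) simp_all
    have 3: "f2 f (tgt L g) (tgt L (arrow_part L h)) =
        f2 f (tgt L g) (tgt L h) \<ominus>\<^bsub>mo M\<^esub> f2 f (tgt L g) (src L h)"
      "f2 f (tgt L (arrow_part L g)) (src L h) =
        f2 f (tgt L g) (src L h) \<ominus>\<^bsub>mo M\<^esub> f2 f (src L g) (src L h)"
      by (simp_all add: f2_diff)
    have nat: "f2 f (tgt L g) (tgt L h) \<oplus>\<^bsub>mo M\<^esub>
        (br1 M (idm M (f1_0 f (tgt L g))) (f1_1 f (arrow_part L h)) \<oplus>\<^bsub>mo M\<^esub>
        br1 M (f1_1 f (arrow_part L g)) (idm M (f1_0 f (src L h)))) =
        f1_1 f (br1 L (idm L (tgt L g)) (arrow_part L h)) \<oplus>\<^bsub>mo M\<^esub>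
        f1_1 f (br1 L (arrow_part L g) (idm L (src L h))) \<oplus>\<^bsub>mo M\<^esub> f2 f (src L g) (src L h)"
      unfolding 1 2 3
      by (rule formal_eqI[where G="mo M"],
          (rule formal_intros | simp)+)
    show "cmp M (str F (tgt L g) (tgt L h)) (br1 M (fun1 F g) (fun1 F h)) =
        cmp M (fun1 F (br1 L g h)) (str F (src L g) (src L h))"
      by (rule M.morphism_eqI) (use nat in \<open>simp_all add: L.arrow_part_br1(1) M.arrow_part_br1(1)\<close>)
  qed (simp_all add: extend_str_bilinear)
next
  fix x y z assume m [simp]: "x \<in> carrier (ob L)" "y \<in> carrier (ob L)" "z \<in> carrier (ob L)"
  have coh: "(f2 f (br0 L x y) z \<oplus>\<^bsub>mo M\<^esub> f2 f y (br0 L x z)) \<oplus>\<^bsub>mo M\<^esub>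
      ((br1 M (f2 f x y) (idm M (f1_0 f z)) \<oplus>\<^bsub>mo M\<^esub> br1 M (idm M (f1_0 f y)) (f2 f x z)) \<oplus>\<^bsub>mo M\<^esub>
      arrow_part M (jac M (f1_0 f x) (f1_0 f y) (f1_0 f z))) =
      f1_1 f (arrow_part L (jac L x y z)) \<oplus>\<^bsub>mo M\<^esub> (f2 f x (br0 L y z) \<oplus>\<^bsub>mo M\<^esub>
      br1 M (idm M (f1_0 f x)) (f2 f y z))"
    using f.f2_coherence[of x y z] by simp
      (rule formal_eqI_from[where G="mo M", OF sym], assumption, (rule formal_intros | simp)+)
  show "cmp M (str F (br0 L x y) z \<oplus>\<^bsub>mo M\<^esub> str F y (br0 L x z))
      (cmp M (br1 M (str F x y) (idm M (fun0 F z)) \<oplus>\<^bsub>mo M\<^esub> br1 M (idm M (fun0 F y)) (str F x z))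
        (jac M (fun0 F x) (fun0 F y) (fun0 F z))) =
    cmp M (fun1 F (jac L x y z)) (cmp M (str F x (br0 L y z)) (br1 M (idm M (fun0 F x)) (str F y z)))"
    by (rule M.morphism_eqI) (use coh in \<open>simp_all add: M.arrow_part_br1_left M.arrow_part_br1_right\<close>)
qed

lemma kernel_extend:
  assumes "inf_dom f = kernel_algebra L" "inf_cod f = kernel_algebra M"
  shows "kernel_mor (extend_mor L M f) = f"
proof (rule lei_inf_mor_eqI)
  interpret F: leibniz_2_morphism K L M F by (rule extend_morphism)
  show "leibniz_infinity_morphism K (kernel_algebra L) (kernel_algebra M) (kernel_mor F)"
    by (rule F.kernel_mor_morphism) simp_all
  show "leibniz_infinity_morphism K (kernel_algebra L) (kernel_algebra M) f"
    by (rule f.leibniz_infinity_morphism_axioms)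
  fix h assume "h \<in> carrier (deg1 (kernel_algebra L))"
  then show "f1_1 (kernel_mor F) h = f1_1 f h"
    by (simp add: kernel_mor_def extend_mor_def L.arrow_part_ker)
qed (simp_all add: kernel_mor_def assms)

end

context leibniz_2_morphism
begin

lemma extend_kernel:
  assumes [simp]: "mor_dom F = L" "mor_cod F = M"
  shows "extend_mor L M (kernel_mor F) = F"
proof -
  interpret k: kernel_morphism K L M "kernel_mor F"
    by (intro kernel_morphism.intro L.leibniz_2_algebra_axioms M.leibniz_2_algebra_axioms
        kernel_mor_morphism assms)
  have [simp]: "f1_0 (kernel_mor F) = fun0 F"
    by (simp add: kernel_mor_def)
  show ?thesis
  proof (rule lei2_mor_eqI[OF k.extend_morphism leibniz_2_morphism_axioms])
    fix m assume [simp]: "m \<in> carrier (mo L)"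
    have *: "f1_1 (kernel_mor F) (arrow_part L m) = fun1 F (arrow_part L m)"
      by (simp add: kernel_mor_def)
    show "fun1 (extend_mor L M (kernel_mor F)) m = fun1 F m"
      by (rule M.morphism_eqI) (simp_all add: *)
  next
    fix x y assume [simp]: "x \<in> carrier (ob L)" "y \<in> carrier (ob L)"
    have *: "f2 (kernel_mor F) x y = arrow_part M (str F x y)"
      by (simp add: kernel_mor_def)
    show "str (extend_mor L M (kernel_mor F)) x y = str F x y"
      by (rule M.morphism_eqI) (simp_all add: *)
  qed simp_all
qed

end

section \<open>2-cells\<close>

definition kernel_cell :: "('k, 'a) lei2_cell \<Rightarrow> ('k, 'a) lei_inf_homotopy" where
  "kernel_cell \<theta> = \<lparr>htp_src = kernel_mor (cell_src \<theta>), htp_tgt = kernel_mor (cell_tgt \<theta>),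
    htp = (\<lambda>x\<in>carrier (ob (mor_dom (cell_src \<theta>))).
      arrow_part (mor_cod (cell_src \<theta>)) (trf \<theta> x))\<rparr>"

definition extend_cell ::
  "('k, 'a) lei2_mor \<Rightarrow> ('k, 'a) lei2_mor \<Rightarrow> ('k, 'a) lei_inf_homotopy \<Rightarrow> ('k, 'a) lei2_cell" where
  "extend_cell F G \<gamma> = \<lparr>cell_src = F, cell_tgt = G,
    trf = (\<lambda>x\<in>carrier (ob (mor_dom F)). idm (mor_cod F) (fun0 F x) \<oplus>\<^bsub>mo (mor_cod F)\<^esub> htp \<gamma> x)\<rparr>"

lemma kernel_mor_components:
  "f1_0 (kernel_mor F) = fun0 F"
  "h \<in> carrier (ker_src (mor_dom F)) \<Longrightarrow> f1_1 (kernel_mor F) h = fun1 F h"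
  "\<lbrakk>x \<in> carrier (ob (mor_dom F)); y \<in> carrier (ob (mor_dom F))\<rbrakk> \<Longrightarrow>
    f2 (kernel_mor F) x y = arrow_part (mor_cod F) (str F x y)"
  "inf_dom (kernel_mor F) = kernel_algebra (mor_dom F)"
  "inf_cod (kernel_mor F) = kernel_algebra (mor_cod F)"
  by (simp_all add: kernel_mor_def del: ker_src_simps)

context leibniz_2_transformation
begin

lemma trf_linear: "linear_map K (ob L) (mo M) \<theta>"
  using transformation by (simp add: linear_transformation_def)

lemmas trf_simps [simp] = linear_map_simps[OF F.L.Ob.module_axioms F.M.Mo.module_axioms trf_linear]

lemma trf_components [simp]:
  "x \<in> carrier (ob L) \<Longrightarrow> src M (\<theta> x) = fun0 F x"
  "x \<in> carrier (ob L) \<Longrightarrow> tgt M (\<theta> x) = fun0 G x"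
  using transformation by (simp_all add: linear_transformation_def)

lemma arrow_part_trf_natural:
  assumes [simp]: "f \<in> carrier (mo L)"
  shows "arrow_part M (\<theta> (tgt L f)) \<oplus>\<^bsub>mo M\<^esub> fun1 F (arrow_part L f) =
    fun1 G (arrow_part L f) \<oplus>\<^bsub>mo M\<^esub> arrow_part M (\<theta> (src L f))"
proof -
  have "cmp M (\<theta> (tgt L f)) (fun1 F f) = cmp M (fun1 G f) (\<theta> (src L f))"
    using transformation by (simp add: linear_transformation_def)
  from arg_cong[OF this, of "arrow_part M"] show ?thesis by simp
qed

lemma arrow_part_trf_coherence:
  assumes [simp]: "x \<in> carrier (ob L)" "y \<in> carrier (ob L)"
  shows "arrow_part M (\<theta> (br0 L x y)) \<oplus>\<^bsub>mo M\<^esub> arrow_part M (str F x y) =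
    arrow_part M (str G x y) \<oplus>\<^bsub>mo M\<^esub> (br1 M (arrow_part M (\<theta> x)) (idm M (fun0 G y))
      \<oplus>\<^bsub>mo M\<^esub> br1 M (idm M (fun0 F x)) (arrow_part M (\<theta> y)))"
  using arg_cong[OF trf_coherence[OF assms], of "arrow_part M"]
  by (simp add: F.M.arrow_part_br1(2))

lemma kernel_homotopy:
  assumes [simp]: "mor_dom F = L" "mor_cod F = M" "mor_dom G = L" "mor_cod G = M"
  shows "leibniz_infinity_homotopy K (kernel_algebra L) (kernel_algebra M)
    (kernel_mor F) (kernel_mor G) (\<lambda>x\<in>carrier (ob L). arrow_part M (\<theta> x))"
proof (intro leibniz_infinity_homotopy.intro leibniz_infinity_homotopy_axioms.intro
    F.kernel_mor_morphism G.kernel_mor_morphism assms)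
  let ?\<theta> = "\<lambda>x\<in>carrier (ob L). arrow_part M (\<theta> x)"
  note comps = kernel_mor_components
  show "linear_map K (deg0 (kernel_algebra L)) (deg1 (kernel_algebra M)) ?\<theta>"
    using linear_map_compose[OF trf_linear F.M.arrow_part_linear_ker] by simp
  show "?\<theta> \<in> carrier (deg0 (kernel_algebra L)) \<rightarrow>\<^sub>E carrier (deg1 (kernel_algebra M))"
    by auto
  show "f1_0 (kernel_mor G) x \<ominus>\<^bsub>deg0 (kernel_algebra M)\<^esub> f1_0 (kernel_mor F) x =
      l1 (kernel_algebra M) (?\<theta> x)" if "x \<in> carrier (deg0 (kernel_algebra L))" for x
    using that by (simp add: comps)
  show "f1_1 (kernel_mor G) h \<ominus>\<^bsub>deg1 (kernel_algebra M)\<^esub> f1_1 (kernel_mor F) h =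
      ?\<theta> (l1 (kernel_algebra L) h)" if "h \<in> carrier (deg1 (kernel_algebra L))" for h
  proof -
    have [simp]: "h \<in> carrier (mo L)" "src L h = \<zero>\<^bsub>ob L\<^esub>" using that by simp_all
    have nat: "arrow_part M (\<theta> (tgt L h)) \<oplus>\<^bsub>mo M\<^esub> fun1 F h = fun1 G h"
      using arrow_part_trf_natural[of h] by (simp add: F.L.arrow_part_ker)
    show ?thesis
      by (simp add: comps)
        (rule formal_eqI_from[where G="mo M", OF nat[symmetric]], (rule formal_intros | simp)+)
  qed
  fix x y assume "x \<in> carrier (deg0 (kernel_algebra L))" "y \<in> carrier (deg0 (kernel_algebra L))"
  then have m [simp]: "x \<in> carrier (ob L)" "y \<in> carrier (ob L)" by simp_all
  show "f2 (kernel_mor G) x y \<ominus>\<^bsub>deg1 (kernel_algebra M)\<^esub> f2 (kernel_mor F) x y =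
      ?\<theta> (l2_00 (kernel_algebra L) x y)
      \<ominus>\<^bsub>deg1 (kernel_algebra M)\<^esub> l2_01 (kernel_algebra M) (f1_0 (kernel_mor F) x) (?\<theta> y)
      \<ominus>\<^bsub>deg1 (kernel_algebra M)\<^esub> l2_10 (kernel_algebra M) (?\<theta> x) (f1_0 (kernel_mor G) y)"
    by (simp add: comps)
      (rule formal_eqI_from[where G="mo M", OF arrow_part_trf_coherence[OF m, symmetric]],
        (rule formal_intros | simp)+)
qed

end

locale kernel_homotopy =
  F: leibniz_2_morphism K L M F + G: leibniz_2_morphism K L M G +
  h: leibniz_infinity_homotopy K "kernel_algebra L" "kernel_algebra M" "kernel_mor F" "kernel_mor G" \<theta>
  for K :: "('k, 'r) ring_scheme" and L M :: "('k, 'a) lei2" and F G :: "('k, 'a) lei2_mor" and \<theta> +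
  assumes dom_cod: "mor_dom F = L" "mor_cod F = M" "mor_dom G = L" "mor_cod G = M"
begin

lemma htp_linear: "linear_map K (ob L) (ker_src M) \<theta>"
  using h.htp_linear by simp

lemma htp_linear_mo: "linear_map K (ob L) (mo M) \<theta>"
  using htp_linear by (auto simp: linear_map_def)

lemmas htp_simps [simp] = linear_map_simps[OF F.L.Ob.module_axioms F.M.Mo.module_axioms htp_linear_mo]

lemma htp_components [simp]:
  assumes x [simp]: "x \<in> carrier (ob L)"
  shows "src M (\<theta> x) = \<zero>\<^bsub>ob M\<^esub>" "tgt M (\<theta> x) = fun0 G x \<ominus>\<^bsub>ob M\<^esub> fun0 F x"
    "arrow_part M (\<theta> x) = \<theta> x"
proof -
  show src: "src M (\<theta> x) = \<zero>\<^bsub>ob M\<^esub>"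
    using linear_map_simps(1)[OF F.L.Ob.module_axioms F.M.module_ker_src htp_linear x] by simp
  show "tgt M (\<theta> x) = fun0 G x \<ominus>\<^bsub>ob M\<^esub> fun0 F x"
    using h.htp_deg0[of x] by (simp add: kernel_mor_components)
  show "arrow_part M (\<theta> x) = \<theta> x"
    using src by (simp add: F.M.arrow_part_ker)
qed

lemma fun1_difference:
  assumes [simp]: "k \<in> carrier (mo L)" "src L k = \<zero>\<^bsub>ob L\<^esub>"
  shows "fun1 G k \<ominus>\<^bsub>mo M\<^esub> fun1 F k = \<theta> (tgt L k)"
  using h.htp_deg1[of k] by (simp add: kernel_mor_components dom_cod)

definition extension where
  "extension = (\<lambda>x\<in>carrier (ob L). idm M (fun0 F x) \<oplus>\<^bsub>mo M\<^esub> \<theta> x)"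

lemma extension_simps [simp]:
  assumes [simp]: "x \<in> carrier (ob L)"
  shows "extension x \<in> carrier (mo M)" "src M (extension x) = fun0 F x"
    "tgt M (extension x) = fun0 G x" "arrow_part M (extension x) = \<theta> x"
proof -
  show "extension x \<in> carrier (mo M)" "src M (extension x) = fun0 F x"
    "arrow_part M (extension x) = \<theta> x"
    by (simp_all add: extension_def)
  show "tgt M (extension x) = fun0 G x"
    by (simp add: extension_def)
      (rule formal_eqI[where G="ob M"], (rule formal_intros | simp)+)
qed

text \<open>Naturality at \<open>f\<close> is the degree 1 condition of the homotopy at the arrow part of \<open>f\<close>, whose target
  is the difference of the target and the source of \<open>f\<close>.\<close>

lemma extension_transformation: "leibniz_2_transformation K L M F G extension"
proof (intro leibniz_2_transformation.intro leibniz_2_transformation_axioms.intro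
    F.leibniz_2_morphism_axioms G.leibniz_2_morphism_axioms)
  show "extension \<in> carrier (ob L) \<rightarrow>\<^sub>E carrier (mo M)"
    by (auto simp: extension_def)
  have "linear_map K (ob L) (mo M) extension"
    unfolding extension_def
    by (simp add: linear_map_add htp_linear_mo linear_map_compose[OF F.fun0_linear F.M.idm_linear])
  moreover have "cmp M (extension (tgt L f)) (fun1 F f) = cmp M (fun1 G f) (extension (src L f))"
    if [simp]: "f \<in> carrier (mo L)" for f
  proof -
    have diff: "fun1 G (arrow_part L f) \<ominus>\<^bsub>mo M\<^esub> fun1 F (arrow_part L f) = \<theta> (tgt L (arrow_part L f))"
      by (rule fun1_difference) simp_all
    have "\<theta> (tgt L f) \<oplus>\<^bsub>mo M\<^esub> fun1 F (arrow_part L f) = fun1 G (arrow_part L f) \<oplus>\<^bsub>mo M\<^esub> \<theta> (src L f)"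
      by (rule formal_eqI_from[where G="mo M", OF diff[symmetric, simplified]],
          (rule formal_intros | simp)+)
    then show ?thesis
      by (rule_tac F.M.morphism_eqI) simp_all
  qed
  ultimately show "linear_transformation K L M (fun0 F) (fun1 F) (fun0 G) (fun1 G) extension"
    by (simp add: linear_transformation_def)
next
  fix x y assume m [simp]: "x \<in> carrier (ob L)" "y \<in> carrier (ob L)"
  have coh: "\<theta> (br0 L x y) \<oplus>\<^bsub>mo M\<^esub> arrow_part M (str F x y) =
    arrow_part M (str G x y) \<oplus>\<^bsub>mo M\<^esub> (br1 M (\<theta> x) (idm M (fun0 G y))
      \<oplus>\<^bsub>mo M\<^esub> br1 M (idm M (fun0 F x)) (\<theta> y))"
    using h.htp_f2[of x y] by (simp add: kernel_mor_components dom_cod)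
      (rule formal_eqI_from[where G="mo M", OF sym], assumption, (rule formal_intros | simp)+)
  show "cmp M (extension (br0 L x y)) (str F x y) =
      cmp M (str G x y) (br1 M (extension x) (extension y))"
    by (rule F.M.morphism_eqI) (use coh in \<open>simp_all add: F.M.arrow_part_br1(2)\<close>)
qed

end

lemma trf_eqI:
  fixes \<theta> \<tau> :: "('k, 'a) lei2_cell"
  assumes "leibniz_2_transformation K L M F G (trf \<theta>)" "leibniz_2_transformation K L M F' G' (trf \<tau>)"
    and "cell_src \<theta> = cell_src \<tau>" "cell_tgt \<theta> = cell_tgt \<tau>"
    and "\<And>x. x \<in> carrier (ob L) \<Longrightarrow> trf \<theta> x = trf \<tau> x"
  shows "\<theta> = \<tau>"
proof -
  interpret \<theta>: leibniz_2_transformation K L M F G "trf \<theta>" by fact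
  interpret \<tau>: leibniz_2_transformation K L M F' G' "trf \<tau>" by fact
  have "trf \<theta> = trf \<tau>"
    by (rule PiE_ext[OF \<theta>.trf_ext \<tau>.trf_ext]) (rule assms(5))
  then show ?thesis using assms(3,4) by (intro lei2_cell.equality) simp_all
qed

section \<open>The hom-categories agree\<close>

lemma Lei2Alg_simps [simp]:
  "L \<in> obj (Lei2Alg K) \<longleftrightarrow> leibniz_2_algebra K L"
  "F \<in> arr (Lei2Alg K) \<longleftrightarrow> leibniz_2_morphism K (mor_dom F) (mor_cod F) F"
  "\<theta> \<in> cell (Lei2Alg K) \<longleftrightarrow>
    mor_dom (cell_tgt \<theta>) = mor_dom (cell_src \<theta>) \<and> mor_cod (cell_tgt \<theta>) = mor_cod (cell_src \<theta>) \<and>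
    leibniz_2_transformation K (mor_dom (cell_src \<theta>)) (mor_cod (cell_src \<theta>))
      (cell_src \<theta>) (cell_tgt \<theta>) (trf \<theta>)"
  "dom1 (Lei2Alg K) = mor_dom" "cod1 (Lei2Alg K) = mor_cod"
  "id1 (Lei2Alg K) = lei2_id" "comp1 (Lei2Alg K) = lei2_comp"
  "src2 (Lei2Alg K) = cell_src" "tgt2 (Lei2Alg K) = cell_tgt"
  "id2 (Lei2Alg K) = trf_id" "vcomp (Lei2Alg K) = trf_vcomp" "hcomp (Lei2Alg K) = trf_hcomp"
  by (simp_all add: Lei2Alg_def)

lemma kernel_mor_dom_cod [simp]:
  "inf_dom (kernel_mor F) = kernel_algebra (mor_dom F)"
  "inf_cod (kernel_mor F) = kernel_algebra (mor_cod F)"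
  "htp_src (kernel_cell \<theta>) = kernel_mor (cell_src \<theta>)"
  "htp_tgt (kernel_cell \<theta>) = kernel_mor (cell_tgt \<theta>)"
  by (simp_all add: kernel_mor_def kernel_cell_def)

lemma extend_dom_cod [simp]:
  "mor_dom (extend_mor L M f) = L" "mor_cod (extend_mor L M f) = M"
  "cell_src (extend_cell F G \<gamma>) = F" "cell_tgt (extend_cell F G \<gamma>) = G"
  by (simp_all add: extend_mor_def extend_cell_def)

lemma kernel_mor_closed:
  "F \<in> arr (Lei2Alg K) \<Longrightarrow> kernel_mor F \<in> arr (two_Lei_inf_Alg K)"
  by (simp add: leibniz_2_morphism.kernel_mor_morphism)

lemma kernel_cell_closed:
  assumes "\<theta> \<in> cell (Lei2Alg K)"
  shows "kernel_cell \<theta> \<in> cell (two_Lei_inf_Alg K)"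
  using assms by (simp add: kernel_cell_def leibniz_2_transformation.kernel_homotopy)

lemma extend_mor_closed:
  assumes "leibniz_2_algebra K L" "leibniz_2_algebra K M" "f \<in> arr (two_Lei_inf_Alg K)"
    "inf_dom f = kernel_algebra L" "inf_cod f = kernel_algebra M"
  shows "extend_mor L M f \<in> arr (Lei2Alg K)" "kernel_mor (extend_mor L M f) = f"
proof -
  interpret kernel_morphism K L M f
    using assms by (simp add: kernel_morphism_def)
  show "extend_mor L M f \<in> arr (Lei2Alg K)" using extend_morphism by simp
  show "kernel_mor (extend_mor L M f) = f" using assms by (intro kernel_extend)
qed

lemma extend_cell_closed:
  assumes "F \<in> arr (Lei2Alg K)" "G \<in> arr (Lei2Alg K)" "mor_dom G = mor_dom F" "mor_cod G = mor_cod F"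
    "\<gamma> \<in> cell (two_Lei_inf_Alg K)" "htp_src \<gamma> = kernel_mor F" "htp_tgt \<gamma> = kernel_mor G"
  shows "extend_cell F G \<gamma> \<in> cell (Lei2Alg K)" "kernel_cell (extend_cell F G \<gamma>) = \<gamma>"
proof -
  interpret kernel_homotopy K "mor_dom F" "mor_cod F" F G "htp \<gamma>"
    using assms by (simp add: kernel_homotopy_def kernel_homotopy_axioms_def)
  have ext: "extend_cell F G \<gamma> = \<lparr>cell_src = F, cell_tgt = G, trf = extension\<rparr>"
    by (simp add: extend_cell_def extension_def)
  show cl: "extend_cell F G \<gamma> \<in> cell (Lei2Alg K)"
    using extension_transformation assms by (simp add: ext)
  show "kernel_cell (extend_cell F G \<gamma>) = \<gamma>"
    by (rule lei_inf_cell_eqI[OF kernel_cell_closed[OF cl] assms(5)])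
      (simp_all add: assms, simp add: kernel_cell_def ext)
qed

lemma extend_kernel_cell:
  assumes t: "\<theta> \<in> cell (Lei2Alg K)"
  shows "extend_cell (cell_src \<theta>) (cell_tgt \<theta>) (kernel_cell \<theta>) = \<theta>"
proof -
  let ?L = "mor_dom (cell_src \<theta>)" and ?M = "mor_cod (cell_src \<theta>)"
  interpret leibniz_2_transformation K ?L ?M "cell_src \<theta>" "cell_tgt \<theta>" "trf \<theta>"
    using t by simp
  have "extend_cell (cell_src \<theta>) (cell_tgt \<theta>) (kernel_cell \<theta>) \<in> cell (Lei2Alg K)"
    using t kernel_cell_closed[OF t] F.leibniz_2_morphism_axioms G.leibniz_2_morphism_axioms
    by (intro extend_cell_closed) simp_all
  moreover have "idm ?M (fun0 (cell_src \<theta>) x) \<oplus>\<^bsub>mo ?M\<^esub> arrow_part ?M (trf \<theta> x) = trf \<theta> x"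
    if "x \<in> carrier (ob ?L)" for x
    using F.M.decompose[of "trf \<theta> x"] that by simp
  ultimately show ?thesis
    using t
    by (intro trf_eqI[of K ?L ?M "cell_src \<theta>" "cell_tgt \<theta>" _ "cell_src \<theta>" "cell_tgt \<theta>"])
      (simp_all add: extend_cell_def kernel_cell_def)
qed

lemma lei2_id_extend:
  assumes "leibniz_2_algebra K L"
  shows "lei2_id L = extend_mor L L (lei_inf_id (kernel_algebra L))"
proof -
  interpret leibniz_2_algebra K L by fact
  show ?thesis
    by (auto simp: lei2_id_def extend_mor_def lei_inf_id_def decompose intro!: restrict_ext)
qed

lemma lei2_comp_extend:
  assumes "F \<in> arr (Lei2Alg K)" "G \<in> arr (Lei2Alg K)" "mor_cod F = mor_dom G"
  shows "lei2_comp G F =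
    extend_mor (mor_dom F) (mor_cod G) (lei_inf_comp (kernel_mor G) (kernel_mor F))"
proof -
  let ?L = "mor_dom F" and ?M = "mor_dom G" and ?N = "mor_cod G"
  interpret F: leibniz_2_morphism K ?L ?M F using assms by simp
  interpret G: leibniz_2_morphism K ?M ?N G using assms by simp
  have 1: "fun1 G (fun1 F m) = idm ?N (fun0 G (fun0 F (src ?L m))) \<oplus>\<^bsub>mo ?N\<^esub>
      fun1 G (fun1 F (arrow_part ?L m))" if [simp]: "m \<in> carrier (mo ?L)" for m
    using G.M.decompose[of "fun1 G (fun1 F m)"] by simp
  have 2: "cmp ?N (fun1 G (str F x y)) (str G (fun0 F x) (fun0 F y)) =
      idm ?N (br0 ?N (fun0 G (fun0 F x)) (fun0 G (fun0 F y))) \<oplus>\<^bsub>mo ?N\<^esub>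
      (arrow_part ?N (str G (fun0 F x) (fun0 F y)) \<oplus>\<^bsub>mo ?N\<^esub> fun1 G (arrow_part ?M (str F x y)))"
    if [simp]: "x \<in> carrier (ob ?L)" "y \<in> carrier (ob ?L)" for x y
    using G.M.decompose[of "cmp ?N (fun1 G (str F x y)) (str G (fun0 F x) (fun0 F y))"]
    by (simp add: G.M.Mo.M.a_comm)
  have "fun0 (lei2_comp G F) = f1_0 (lei_inf_comp (kernel_mor G) (kernel_mor F))"
    by (simp add: lei2_comp_def lei_inf_comp_def kernel_mor_components)
  moreover have "fun1 (lei2_comp G F) =
      fun1 (extend_mor ?L ?N (lei_inf_comp (kernel_mor G) (kernel_mor F)))"
    by (auto simp: lei2_comp_def lei_inf_comp_def extend_mor_def kernel_mor_components assms 1[symmetric]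
        intro!: restrict_ext)
  moreover have "str (lei2_comp G F) =
      str (extend_mor ?L ?N (lei_inf_comp (kernel_mor G) (kernel_mor F)))"
    by (auto simp: lei2_comp_def lei_inf_comp_def extend_mor_def kernel_mor_components assms 2
        intro!: restrict_ext)
  ultimately show ?thesis
    by (intro lei2_mor.equality) (simp_all add: lei2_comp_def, simp_all add: extend_mor_def)
qed

lemma trf_id_extend:
  assumes "F \<in> arr (Lei2Alg K)"
  shows "trf_id F = extend_cell F F (htp_id (kernel_mor F))"
proof -
  interpret F: leibniz_2_morphism K "mor_dom F" "mor_cod F" F using assms by simp
  show ?thesis
    by (auto simp: trf_id_def extend_cell_def htp_id_def intro!: restrict_ext)
qed

lemma trf_vcomp_extend:
  assumes "\<theta> \<in> cell (Lei2Alg K)" "\<tau> \<in> cell (Lei2Alg K)" "cell_tgt \<theta> = cell_src \<tau>"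
  shows "trf_vcomp \<tau> \<theta> = extend_cell (cell_src \<theta>) (cell_tgt \<tau>)
    (htp_vcomp (kernel_cell \<tau>) (kernel_cell \<theta>))"
proof -
  let ?L = "mor_dom (cell_src \<theta>)" and ?M = "mor_cod (cell_src \<theta>)"
  have par: "mor_dom (cell_src \<tau>) = ?L" "mor_cod (cell_src \<tau>) = ?M"
    using assms by auto
  interpret \<theta>: leibniz_2_transformation K ?L ?M "cell_src \<theta>" "cell_src \<tau>" "trf \<theta>"
    using assms by simp
  interpret \<tau>: leibniz_2_transformation K ?L ?M "cell_src \<tau>" "cell_tgt \<tau>" "trf \<tau>"
    using assms par by simp
  have "cmp ?M (trf \<tau> x) (trf \<theta> x) = idm ?M (fun0 (cell_src \<theta>) x) \<oplus>\<^bsub>mo ?M\<^esub>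
      (arrow_part ?M (trf \<tau> x) \<oplus>\<^bsub>mo ?M\<^esub> arrow_part ?M (trf \<theta> x))"
    if [simp]: "x \<in> carrier (ob ?L)" for x
    using \<theta>.F.M.decompose[of "cmp ?M (trf \<tau> x) (trf \<theta> x)"] by simp
  then show ?thesis
    by (auto simp: trf_vcomp_def extend_cell_def htp_vcomp_def kernel_cell_def kernel_mor_components par
        intro!: restrict_ext)
qed

text \<open>The two 2-categories use different formulas: \<open>\<tau> G \<bullet> F' \<theta>\<close> for transformations and
  \<open>G' \<theta> + \<tau> F\<close> for homotopies. Naturality of \<open>\<tau>\<close> at the morphism \<open>\<theta> x\<close> relates them.\<close>

lemma trf_hcomp_extend:
  assumes "\<theta> \<in> cell (Lei2Alg K)" "\<tau> \<in> cell (Lei2Alg K)"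
    "mor_cod (cell_src \<theta>) = mor_dom (cell_src \<tau>)"
  shows "trf_hcomp \<tau> \<theta> = extend_cell (lei2_comp (cell_src \<tau>) (cell_src \<theta>))
    (lei2_comp (cell_tgt \<tau>) (cell_tgt \<theta>)) (htp_hcomp (kernel_cell \<tau>) (kernel_cell \<theta>))"
proof -
  let ?L = "mor_dom (cell_src \<theta>)" and ?M = "mor_dom (cell_src \<tau>)" and ?N = "mor_cod (cell_src \<tau>)"
  interpret \<theta>: leibniz_2_transformation K ?L ?M "cell_src \<theta>" "cell_tgt \<theta>" "trf \<theta>"
    using assms by simp
  interpret \<tau>: leibniz_2_transformation K ?M ?N "cell_src \<tau>" "cell_tgt \<tau>" "trf \<tau>"
    using assms by simp
  have "cmp ?N (trf \<tau> (fun0 (cell_tgt \<theta>) x)) (fun1 (cell_src \<tau>) (trf \<theta> x)) =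
      idm ?N (fun0 (cell_src \<tau>) (fun0 (cell_src \<theta>) x)) \<oplus>\<^bsub>mo ?N\<^esub>
      (fun1 (cell_tgt \<tau>) (arrow_part ?M (trf \<theta> x)) \<oplus>\<^bsub>mo ?N\<^esub>
        arrow_part ?N (trf \<tau> (fun0 (cell_src \<theta>) x)))"
    if [simp]: "x \<in> carrier (ob ?L)" for x
    using \<tau>.arrow_part_trf_natural[of "trf \<theta> x"]
      \<tau>.F.M.decompose[of "cmp ?N (trf \<tau> (fun0 (cell_tgt \<theta>) x)) (fun1 (cell_src \<tau>) (trf \<theta> x))"]
    by simp
  then show ?thesis
    using assms
    by (auto simp: trf_hcomp_def extend_cell_def htp_hcomp_def kernel_cell_def kernel_mor_components
        lei2_comp_def intro!: restrict_ext)
qed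

lemma lei2_arr_objects:
  assumes "F \<in> arr (Lei2Alg K)"
  shows "leibniz_2_algebra K (mor_dom F)" "leibniz_2_algebra K (mor_cod F)"
  using assms by (simp_all add: leibniz_2_morphism_def)

lemma lei2_cell_arrs:
  assumes "\<theta> \<in> cell (Lei2Alg K)"
  shows "cell_src \<theta> \<in> arr (Lei2Alg K)" "cell_tgt \<theta> \<in> arr (Lei2Alg K)"
    "mor_dom (cell_tgt \<theta>) = mor_dom (cell_src \<theta>)" "mor_cod (cell_tgt \<theta>) = mor_cod (cell_src \<theta>)"
  using assms by (simp_all add: leibniz_2_transformation_def)

theorem kernel_hom_transport:
  "hom_transport (two_Lei_inf_Alg K :: (('k, 'a) lei_inf, ('k, 'a) lei_inf_mor, ('k, 'a) lei_inf_homotopy) two_cat)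
    (Lei2Alg K) kernel_algebra kernel_mor kernel_cell extend_mor extend_cell"
proof (intro hom_transport.intro hom_transport_axioms.intro strict_2_category_two_Lei_inf_Alg)
  fix F :: "('k, 'a) lei2_mor" assume "F \<in> arr (Lei2Alg K)"
  then show "extend_mor (dom1 (Lei2Alg K) F) (cod1 (Lei2Alg K) F) (kernel_mor F) = F"
    by (simp add: leibniz_2_morphism.extend_kernel)
next
  fix L M :: "('k, 'a) lei2" and f :: "('k, 'a) lei_inf_mor"
  assume "L \<in> obj (Lei2Alg K)" "M \<in> obj (Lei2Alg K)" "f \<in> arr (two_Lei_inf_Alg K)"
    "dom1 (two_Lei_inf_Alg K) f = kernel_algebra L" "cod1 (two_Lei_inf_Alg K) f = kernel_algebra M"
  then show "extend_mor L M f \<in> arr (Lei2Alg K) \<and> dom1 (Lei2Alg K) (extend_mor L M f) = L \<and>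
      cod1 (Lei2Alg K) (extend_mor L M f) = M \<and> kernel_mor (extend_mor L M f) = f"
    using extend_mor_closed[of K L M f] by (simp del: two_Lei_inf_Alg_simps(2) Lei2Alg_simps(2))
next
  fix F G :: "('k, 'a) lei2_mor" and \<gamma> :: "('k, 'a) lei_inf_homotopy"
  assume "F \<in> arr (Lei2Alg K)" "G \<in> arr (Lei2Alg K)" "dom1 (Lei2Alg K) G = dom1 (Lei2Alg K) F"
    "cod1 (Lei2Alg K) G = cod1 (Lei2Alg K) F" "\<gamma> \<in> cell (two_Lei_inf_Alg K)"
    "src2 (two_Lei_inf_Alg K) \<gamma> = kernel_mor F" "tgt2 (two_Lei_inf_Alg K) \<gamma> = kernel_mor G"
  then show "extend_cell F G \<gamma> \<in> cell (Lei2Alg K) \<and> src2 (Lei2Alg K) (extend_cell F G \<gamma>) = F \<and>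
      tgt2 (Lei2Alg K) (extend_cell F G \<gamma>) = G \<and> kernel_cell (extend_cell F G \<gamma>) = \<gamma>"
    using extend_cell_closed[of F K G \<gamma>]
    by (simp del: two_Lei_inf_Alg_simps(2,3) Lei2Alg_simps(2,3))
qed (simp_all add: kernel_mor_closed kernel_cell_closed lei2_arr_objects lei2_cell_arrs
    leibniz_2_algebra.leibniz_infinity_algebra_kernel extend_kernel_cell lei2_id_extend
    lei2_comp_extend trf_id_extend trf_vcomp_extend trf_hcomp_extend
    del: two_Lei_inf_Alg_simps(2,3) Lei2Alg_simps(2,3))

section \<open>Leibniz 2-algebras from Leibniz infinity algebras\<close>

text \<open>Morphisms with \<open>f\<^sub>2 = 0\<close> suffice to compare an algebra with the kernel of the Leibniz 2-algebra
  constructed from it.\<close>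

definition strict_mor ::
  "('k, 'a) lei_inf \<Rightarrow> ('k, 'a) lei_inf \<Rightarrow> ('a \<Rightarrow> 'a) \<Rightarrow> ('a \<Rightarrow> 'a) \<Rightarrow> ('k, 'a) lei_inf_mor" where
  "strict_mor V W a b = \<lparr>inf_dom = V, inf_cod = W,
    f1_0 = (\<lambda>x\<in>carrier (deg0 V). a x), f1_1 = (\<lambda>h\<in>carrier (deg1 V). b h),
    f2 = (\<lambda>x\<in>carrier (deg0 V). \<lambda>y\<in>carrier (deg0 V). \<zero>\<^bsub>deg1 W\<^esub>)\<rparr>"

lemma strict_mor_morphism:
  assumes "leibniz_infinity_algebra K V" "leibniz_infinity_algebra K W"
    and a: "linear_map K (deg0 V) (deg0 W) a" and b: "linear_map K (deg1 V) (deg1 W) b"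
    and "\<And>h. h \<in> carrier (deg1 V) \<Longrightarrow> l1 W (b h) = a (l1 V h)"
    and "\<And>x y. \<lbrakk>x \<in> carrier (deg0 V); y \<in> carrier (deg0 V)\<rbrakk> \<Longrightarrow>
      l2_00 W (a x) (a y) = a (l2_00 V x y)"
    and "\<And>x h. \<lbrakk>x \<in> carrier (deg0 V); h \<in> carrier (deg1 V)\<rbrakk> \<Longrightarrow>
      l2_01 W (a x) (b h) = b (l2_01 V x h)"
    and "\<And>x h. \<lbrakk>x \<in> carrier (deg0 V); h \<in> carrier (deg1 V)\<rbrakk> \<Longrightarrow>
      l2_10 W (b h) (a x) = b (l2_10 V h x)"
    and "\<And>x y z. \<lbrakk>x \<in> carrier (deg0 V); y \<in> carrier (deg0 V); z \<in> carrier (deg0 V)\<rbrakk> \<Longrightarrow>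
      l3 W (a x) (a y) (a z) = b (l3 V x y z)"
  shows "leibniz_infinity_morphism K V W (strict_mor V W a b)"
proof -
  interpret V: leibniz_infinity_algebra K V by fact
  interpret W: leibniz_infinity_algebra K W by fact
  note lin [simp] = linear_map_simps[OF V.V0.module_axioms W.V0.module_axioms a]
    linear_map_simps[OF V.V1.module_axioms W.V1.module_axioms b]
  have comps: "f1_0 (strict_mor V W a b) = (\<lambda>x\<in>carrier (deg0 V). a x)"
    "f1_1 (strict_mor V W a b) = (\<lambda>h\<in>carrier (deg1 V). b h)"
    "f2 (strict_mor V W a b) = (\<lambda>x\<in>carrier (deg0 V). \<lambda>y\<in>carrier (deg0 V). \<zero>\<^bsub>deg1 W\<^esub>)"
    by (simp_all add: strict_mor_def)
  show ?thesis
  proof (intro leibniz_infinity_morphism.intro leibniz_infinity_morphism_axioms.intro assms(1,2))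
    show "linear_map K (deg0 V) (deg0 W) (f1_0 (strict_mor V W a b))"
      "linear_map K (deg1 V) (deg1 W) (f1_1 (strict_mor V W a b))"
      unfolding comps by (simp_all add: a b)
    show "bilinear_map K (deg0 V) (deg0 V) (deg1 W) (f2 (strict_mor V W a b))"
      unfolding comps by (subst bilinear_map_restrict) (simp_all add: bilinear_map_def linear_map_zero)
  qed (simp_all add: comps assms W.V1.M.minus_eq)
qed

text \<open>The injection \<open>enc\<close> serves as pairing function. A morphism is the code \<open>mk x h\<close> of an object \<open>x\<close> and an
  element \<open>h\<close> of degree 1, and is thought of as an arrow from \<open>x\<close> to \<open>x + l\<^sub>1 h\<close>.\<close>

locale pair_encoding = leibniz_infinity_algebra K V
  for K :: "('k, 'r) ring_scheme" and V :: "('k, 'a) lei_inf" +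
  fixes enc :: "'a \<times> 'a \<Rightarrow> 'a"
  assumes enc_inj: "inj_on enc (carrier (deg0 V) \<times> carrier (deg1 V))"
begin

abbreviation pairs :: "('a \<times> 'a) set" where
  "pairs \<equiv> carrier (deg0 V) \<times> carrier (deg1 V)"

definition mk :: "'a \<Rightarrow> 'a \<Rightarrow> 'a" where
  "mk x h = enc (x, h)"

definition start :: "'a \<Rightarrow> 'a" where
  "start f = fst (inv_into pairs enc f)"

definition arrow :: "'a \<Rightarrow> 'a" where
  "arrow f = snd (inv_into pairs enc f)"

definition finish :: "'a \<Rightarrow> 'a" where
  "finish f = start f \<oplus>\<^bsub>deg0 V\<^esub> l1 V (arrow f)"

definition sum_space :: "('k, 'a) module" where
  "sum_space = \<lparr>carrier = enc ` pairs, mult = undefined, one = undefined,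
    ring.zero = mk \<zero>\<^bsub>deg0 V\<^esub> \<zero>\<^bsub>deg1 V\<^esub>,
    add = (\<lambda>f g. mk (start f \<oplus>\<^bsub>deg0 V\<^esub> start g) (arrow f \<oplus>\<^bsub>deg1 V\<^esub> arrow g)),
    smult = (\<lambda>c f. mk (c \<odot>\<^bsub>deg0 V\<^esub> start f) (c \<odot>\<^bsub>deg1 V\<^esub> arrow f))\<rparr>"

text \<open>These formulas are forced by those for arrow parts in a Leibniz 2-algebra.\<close>

definition category :: "('k, 'a) lei2" where
  "category = \<lparr>ob = deg0 V, mo = sum_space, src = start, tgt = finish,
    idm = (\<lambda>x. mk x \<zero>\<^bsub>deg1 V\<^esub>),
    cmp = (\<lambda>g f. mk (start f) (arrow g \<oplus>\<^bsub>deg1 V\<^esub> arrow f)),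
    br0 = l2_00 V,
    br1 = (\<lambda>f g. mk (l2_00 V (start f) (start g))
      (l2_01 V (finish f) (arrow g) \<oplus>\<^bsub>deg1 V\<^esub> l2_10 V (arrow f) (start g))),
    jac = (\<lambda>x y z. mk (l2_00 V x (l2_00 V y z)) (\<ominus>\<^bsub>deg1 V\<^esub> l3 V x y z))\<rparr>"

lemma mk_components [simp]:
  assumes "x \<in> carrier (deg0 V)" "h \<in> carrier (deg1 V)"
  shows "start (mk x h) = x" "arrow (mk x h) = h" "finish (mk x h) = x \<oplus>\<^bsub>deg0 V\<^esub> l1 V h"
    "mk x h \<in> carrier sum_space"
  using assms enc_inj by (simp_all add: finish_def start_def arrow_def mk_def sum_space_def)

lemma sum_spaceE:
  assumes "f \<in> carrier sum_space"
  obtains x h where "x \<in> carrier (deg0 V)" "h \<in> carrier (deg1 V)" "f = mk x h"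
  using assms by (auto simp: sum_space_def mk_def)

lemma mk_cong: "x = x' \<Longrightarrow> h = h' \<Longrightarrow> mk x h = mk x' h'"
  by simp

lemma sum_space_ops [simp]:
  assumes "x \<in> carrier (deg0 V)" "h \<in> carrier (deg1 V)"
  shows "\<lbrakk>y \<in> carrier (deg0 V); k \<in> carrier (deg1 V)\<rbrakk> \<Longrightarrow>
      mk x h \<oplus>\<^bsub>sum_space\<^esub> mk y k = mk (x \<oplus>\<^bsub>deg0 V\<^esub> y) (h \<oplus>\<^bsub>deg1 V\<^esub> k)"
    and "c \<odot>\<^bsub>sum_space\<^esub> mk x h = mk (c \<odot>\<^bsub>deg0 V\<^esub> x) (c \<odot>\<^bsub>deg1 V\<^esub> h)"
  using mk_components[OF assms] mk_components[of y k] by (simp_all add: sum_space_def)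

lemma sum_space_zero: "\<zero>\<^bsub>sum_space\<^esub> = mk \<zero>\<^bsub>deg0 V\<^esub> \<zero>\<^bsub>deg1 V\<^esub>"
  by (simp add: sum_space_def)

lemma sum_space_module: "module K sum_space"
proof (rule moduleI)
  show "cring K" by (rule V0.R.cring_axioms)
  show "abelian_group sum_space"
  proof (rule abelian_groupI)
    fix f assume "f \<in> carrier sum_space"
    then obtain x h where "x \<in> carrier (deg0 V)" "h \<in> carrier (deg1 V)" "f = mk x h"
      by (rule sum_spaceE)
    then show "\<exists>g\<in>carrier sum_space. g \<oplus>\<^bsub>sum_space\<^esub> f = \<zero>\<^bsub>sum_space\<^esub>"
      by (intro bexI[of _ "mk (\<ominus>\<^bsub>deg0 V\<^esub> x) (\<ominus>\<^bsub>deg1 V\<^esub> h)"])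
        (simp_all add: sum_space_zero V0.M.l_neg V1.M.l_neg)
  qed (auto elim!: sum_spaceE simp: sum_space_zero V0.M.a_ac V1.M.a_ac)
qed (auto elim!: sum_spaceE simp: V0.smult_l_distr V1.smult_l_distr V0.smult_r_distr
    V1.smult_r_distr V0.smult_assoc1 V1.smult_assoc1)

lemmas sum_space_abelian [simp] = module.axioms(2)[OF sum_space_module]

lemma sum_space_neg [simp]:
  assumes "x \<in> carrier (deg0 V)" "h \<in> carrier (deg1 V)"
  shows "\<ominus>\<^bsub>sum_space\<^esub> mk x h = mk (\<ominus>\<^bsub>deg0 V\<^esub> x) (\<ominus>\<^bsub>deg1 V\<^esub> h)"
  using assms by (intro abelian_group.minus_equality)
    (simp_all add: sum_space_zero V0.M.l_neg V1.M.l_neg)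

lemma category_simps [simp]:
  "ob category = deg0 V" "mo category = sum_space" "src category = start" "tgt category = finish"
  "idm category x = mk x \<zero>\<^bsub>deg1 V\<^esub>"
  "cmp category g f = mk (start f) (arrow g \<oplus>\<^bsub>deg1 V\<^esub> arrow f)"
  "br0 category = l2_00 V"
  "br1 category f g = mk (l2_00 V (start f) (start g))
    (l2_01 V (finish f) (arrow g) \<oplus>\<^bsub>deg1 V\<^esub> l2_10 V (arrow f) (start g))"
  "jac category x y z = mk (l2_00 V x (l2_00 V y z)) (\<ominus>\<^bsub>deg1 V\<^esub> l3 V x y z)"
  by (simp_all add: category_def)

lemma category_linear: "linear_category K category"
proof (intro linear_category.intro linear_category_axioms.intro)
  show "module K (ob category)" "module K (mo category)"
    by (simp_all add: sum_space_module)
  show "linear_map K (mo category) (ob category) (src category)"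
    by (auto simp: linear_map_def elim!: sum_spaceE)
  show "linear_map K (mo category) (ob category) (tgt category)"
    by (auto simp: linear_map_def V0.M.a_ac V0.smult_r_distr elim!: sum_spaceE)
  show "linear_map K (ob category) (mo category) (idm category)"
    by (auto simp: linear_map_def)
qed (auto elim!: sum_spaceE simp: V0.M.a_ac V1.M.a_ac V1.smult_r_distr)

text \<open>Functoriality holds because \<open>l\<^sub>2 (l\<^sub>1 h) k = l\<^sub>2 h (l\<^sub>1 k)\<close> lets the target of one argument be moved to
  the other one.\<close>

lemma category_bracket: "bilinear_functor K category category (br0 category) (br1 category)"
  unfolding bilinear_functor_def
proof (intro conjI ballI impI)
  show "bilinear_map K (ob category) (ob category) (ob category) (br0 category)"
    by (simp add: l2_00_bilinear)
  have br1_smult: "br1 category (c \<odot>\<^bsub>sum_space\<^esub> f) g = c \<odot>\<^bsub>sum_space\<^esub> br1 category f g"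
    "br1 category f (c \<odot>\<^bsub>sum_space\<^esub> g) = c \<odot>\<^bsub>sum_space\<^esub> br1 category f g"
    if "f \<in> carrier sum_space" "g \<in> carrier sum_space" "c \<in> carrier K" for c f g
    using that by (auto elim!: sum_spaceE simp: V1.smult_r_distr)
  have br1_add: "br1 category (f \<oplus>\<^bsub>sum_space\<^esub> f') g =
      br1 category f g \<oplus>\<^bsub>sum_space\<^esub> br1 category f' g"
    "br1 category g (f \<oplus>\<^bsub>sum_space\<^esub> f') =
      br1 category g f \<oplus>\<^bsub>sum_space\<^esub> br1 category g f'"
    if "f \<in> carrier sum_space" "f' \<in> carrier sum_space" "g \<in> carrier sum_space" for f f' g
    using that by (auto elim!: sum_spaceE simp: V0.M.a_ac V1.M.a_ac)
  have br1_closed: "br1 category f g \<in> carrier sum_space"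
    if "f \<in> carrier sum_space" "g \<in> carrier sum_space" for f g
    using that by (auto elim!: sum_spaceE)
  show "bilinear_map K (mo category) (mo category) (mo category) (br1 category)"
    using br1_smult br1_add br1_closed
    by (simp add: bilinear_map_def linear_map_def del: category_simps(8))
next
  fix f g assume "f \<in> carrier (mo category)" "g \<in> carrier (mo category)"
  then obtain x h y k where [simp]: "x \<in> carrier (deg0 V)" "h \<in> carrier (deg1 V)" "f = mk x h"
    "y \<in> carrier (deg0 V)" "k \<in> carrier (deg1 V)" "g = mk y k"
    by (auto elim!: sum_spaceE)
  show "src category (br1 category f g) = br0 category (src category f) (src category g)"
    by simp
  show "tgt category (br1 category f g) = br0 category (tgt category f) (tgt category g)"
    by (simp add: V0.M.a_ac)
next
  fix f f' g g'
  assume "f \<in> carrier (mo category)" "f' \<in> carrier (mo category)" "g \<in> carrier (mo category)"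
    "g' \<in> carrier (mo category)"
    "tgt category f = src category f' \<and> tgt category g = src category g'"
  then show "br1 category (cmp category f' f) (cmp category g' g) =
      cmp category (br1 category f' g') (br1 category f g)"
    by (auto elim!: sum_spaceE intro!: mk_cong simp: V0.M.a_ac V1.M.a_ac)
qed simp

text \<open>Naturality in all three arguments at once is trilinear in sums \<open>x + h\<close>; after
  expansion the terms with several elements of degree 1 reduce to those with one by the conditions
  on \<open>l\<^sub>3\<close> with one argument \<open>l\<^sub>1 h\<close>.\<close>

lemma category_jacobiator:
  "trilinear_transformation K category category
    (\<lambda>x y z. br0 category x (br0 category y z)) (\<lambda>f g h. br1 category f (br1 category g h))
    (\<lambda>x y z. br0 category (br0 category x y) z \<oplus>\<^bsub>ob category\<^esub> br0 category y (br0 category x z))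
    (\<lambda>f g h. br1 category (br1 category f g) h \<oplus>\<^bsub>mo category\<^esub> br1 category g (br1 category f h))
    (jac category)"
  unfolding trilinear_transformation_def
proof (intro conjI ballI)
  show "trilinear_map K (ob category) (ob category) (ob category) (mo category) (jac category)"
    by (auto simp: trilinear_map_def linear_map_def V1.M.minus_add V1.M.a_ac V1.smult_r_minus)
next
  fix x y z assume "x \<in> carrier (ob category)" "y \<in> carrier (ob category)" "z \<in> carrier (ob category)"
  then have [simp]: "x \<in> carrier (deg0 V)" "y \<in> carrier (deg0 V)" "z \<in> carrier (deg0 V)" by simp_all
  show "src category (jac category x y z) = br0 category x (br0 category y z)"
    by simp
  show "tgt category (jac category x y z) =
      br0 category (br0 category x y) z \<oplus>\<^bsub>ob category\<^esub> br0 category y (br0 category x z)"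
    by simp
      (rule formal_eqI[where G="deg0 V"], (rule formal_intros | simp)+)
next
  fix f g h assume "f \<in> carrier (mo category)" "g \<in> carrier (mo category)" "h \<in> carrier (mo category)"
  then obtain x y z a b c where [simp]: "x \<in> carrier (deg0 V)" "a \<in> carrier (deg1 V)" "f = mk x a"
    "y \<in> carrier (deg0 V)" "b \<in> carrier (deg1 V)" "g = mk y b"
    "z \<in> carrier (deg0 V)" "c \<in> carrier (deg1 V)" "h = mk z c"
    by (auto elim!: sum_spaceE)
  show "cmp category (jac category (tgt category f) (tgt category g) (tgt category h))
      (br1 category f (br1 category g h)) =
    cmp category (br1 category (br1 category f g) h \<oplus>\<^bsub>mo category\<^esub> br1 category g (br1 category f h))
      (jac category (src category f) (src category g) (src category h))"
    by (simp, rule mk_cong[OF refl])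
      (rule formal_eqI[where G="deg1 V"], (rule formal_intros | simp)+)
qed

lemma category_leibniz: "leibniz_2_algebra K category"
proof (intro leibniz_2_algebra.intro leibniz_2_algebra_axioms.intro category_linear
    category_bracket category_jacobiator)
  fix w x y z
  assume "w \<in> carrier (ob category)" "x \<in> carrier (ob category)" "y \<in> carrier (ob category)"
    "z \<in> carrier (ob category)"
  then have m [simp]: "w \<in> carrier (deg0 V)" "x \<in> carrier (deg0 V)" "y \<in> carrier (deg0 V)"
    "z \<in> carrier (deg0 V)" by simp_all
  let ?L = category
  show "cmp ?L (br1 ?L (jac ?L w x y) (idm ?L z) \<oplus>\<^bsub>mo ?L\<^esub>
      idm ?L (br0 ?L (br0 ?L x y) (br0 ?L w z) \<oplus>\<^bsub>ob ?L\<^esub> br0 ?L (br0 ?L w y) (br0 ?L x z) \<oplus>\<^bsub>ob ?L\<^esub>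
        br0 ?L y (br0 ?L (br0 ?L w x) z) \<oplus>\<^bsub>ob ?L\<^esub> br0 ?L y (br0 ?L x (br0 ?L w z))))
    (cmp ?L (idm ?L (br0 ?L (br0 ?L w (br0 ?L x y)) z \<oplus>\<^bsub>ob ?L\<^esub> br0 ?L (br0 ?L x y) (br0 ?L w z) \<oplus>\<^bsub>ob ?L\<^esub>
          br0 ?L (br0 ?L w y) (br0 ?L x z)) \<oplus>\<^bsub>mo ?L\<^esub> br1 ?L (idm ?L y) (jac ?L w x z))
      (cmp ?L (jac ?L w (br0 ?L x y) z \<oplus>\<^bsub>mo ?L\<^esub> jac ?L w y (br0 ?L x z))
        (br1 ?L (idm ?L w) (jac ?L x y z)))) =
    cmp ?L (jac ?L (br0 ?L w x) y z \<oplus>\<^bsub>mo ?L\<^esub> jac ?L x (br0 ?L w y) z \<oplus>\<^bsub>mo ?L\<^esub>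
        jac ?L x y (br0 ?L w z))
      (cmp ?L (idm ?L (br0 ?L (br0 ?L w x) (br0 ?L y z)) \<oplus>\<^bsub>mo ?L\<^esub> br1 ?L (idm ?L x) (jac ?L w y z))
        (jac ?L w x (br0 ?L y z)))"
    by (simp, rule mk_cong[OF refl])
      (rule formal_eqI_from[where G="deg1 V", OF l3_coherence[OF m, symmetric]],
        (rule formal_intros | simp)+)
qed

lemma arrow_part_category:
  assumes [simp]: "x \<in> carrier (deg0 V)" "h \<in> carrier (deg1 V)"
  shows "arrow_part category (mk x h) = mk \<zero>\<^bsub>deg0 V\<^esub> h"
  by (simp add: arrow_part_def a_minus_def V0.M.r_neg)

text \<open>The kernel of \<open>category\<close> consists of the codes of the pairs \<open>(0, h)\<close>; forgetting the first component and
  putting it back are the two inverse morphisms.\<close>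

lemma unpack_morphism:
  "leibniz_infinity_morphism K (kernel_algebra category) V
    (strict_mor (kernel_algebra category) V (\<lambda>x. x) arrow)"
proof (intro strict_mor_morphism leibniz_infinity_algebra_axioms
    leibniz_2_algebra.leibniz_infinity_algebra_kernel category_leibniz)
  show "linear_map K (deg1 (kernel_algebra category)) (deg1 V) arrow"
    by (auto simp: linear_map_def elim!: sum_spaceE)
qed (auto simp: linear_map_ident arrow_part_category elim!: sum_spaceE)

lemma pack_morphism:
  "leibniz_infinity_morphism K V (kernel_algebra category)
    (strict_mor V (kernel_algebra category) (\<lambda>x. x) (mk \<zero>\<^bsub>deg0 V\<^esub>))"
proof (intro strict_mor_morphism leibniz_infinity_algebra_axioms
    leibniz_2_algebra.leibniz_infinity_algebra_kernel category_leibniz)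
  show "linear_map K (deg1 V) (deg1 (kernel_algebra category)) (mk \<zero>\<^bsub>deg0 V\<^esub>)"
    by (auto simp: linear_map_def)
qed (auto simp: linear_map_ident arrow_part_category)

lemma kernel_category_iso:
  "\<exists>L\<in>obj (Lei2Alg K). \<exists>u\<in>arr (two_Lei_inf_Alg K). \<exists>v\<in>arr (two_Lei_inf_Alg K).
    inf_dom u = kernel_algebra L \<and> inf_cod u = V \<and> inf_dom v = V \<and> inf_cod v = kernel_algebra L \<and>
    lei_inf_comp v u = lei_inf_id (kernel_algebra L) \<and> lei_inf_comp u v = lei_inf_id V"
proof -
  let ?W = "kernel_algebra category"
  define u where "u = strict_mor ?W V (\<lambda>x. x) arrow"
  define v where "v = strict_mor V ?W (\<lambda>x. x) (mk \<zero>\<^bsub>deg0 V\<^esub>)"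
  have dc: "inf_dom u = ?W" "inf_cod u = V" "inf_dom v = V" "inf_cod v = ?W"
    by (simp_all add: u_def v_def strict_mor_def)
  have L: "category \<in> obj (Lei2Alg K)"
    using category_leibniz by simp
  have uv: "u \<in> arr (two_Lei_inf_Alg K)" "v \<in> arr (two_Lei_inf_Alg K)"
    using unpack_morphism pack_morphism by (simp_all add: dc) (simp_all add: u_def v_def)
  have ids: "lei_inf_id ?W \<in> arr (two_Lei_inf_Alg K)" "lei_inf_id V \<in> arr (two_Lei_inf_Alg K)"
    by (intro lei_inf_id_closed leibniz_infinity_algebra_axioms
        leibniz_2_algebra.leibniz_infinity_algebra_kernel category_leibniz)+
  have "lei_inf_comp v u = lei_inf_id ?W"
  proof (rule lei_inf_arr_eqI[OF _ ids(1)])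
    show "lei_inf_comp v u \<in> arr (two_Lei_inf_Alg K)"
      by (intro lei_inf_comp_closed uv) (simp add: dc)
  qed (auto simp: dc lei_inf_comp_def lei_inf_id_def u_def v_def strict_mor_def sum_space_zero
      elim!: sum_spaceE)
  moreover have "lei_inf_comp u v = lei_inf_id V"
  proof (rule lei_inf_arr_eqI[OF _ ids(2)])
    show "lei_inf_comp u v \<in> arr (two_Lei_inf_Alg K)"
      by (intro lei_inf_comp_closed uv) (simp add: dc)
  qed (auto simp: dc lei_inf_comp_def lei_inf_id_def u_def v_def strict_mor_def sum_space_zero)
  ultimately show ?thesis
    using L uv dc by blast
qed

end

section \<open>The 2-equivalence\<close>

text \<open>If the vectors \<open>n x\<close> for natural numbers \<open>n\<close> are not pairwise different, then \<open>c x = 0\<close> for a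
  nonzero scalar \<open>c\<close>.\<close>

lemma trivial_if_finite:
  assumes "field K" and char: "\<And>n::nat. n > 0 \<Longrightarrow> [n] \<cdot>\<^bsub>K\<^esub> \<one>\<^bsub>K\<^esub> \<noteq> \<zero>\<^bsub>K\<^esub>"
    and "module K V" "finite (carrier V)"
  shows "carrier V = {\<zero>\<^bsub>V\<^esub>}"
proof -
  interpret K: field K by fact
  interpret V: module K V by fact
  have "x = \<zero>\<^bsub>V\<^esub>" if x: "x \<in> carrier V" for x
  proof -
    let ?f = "\<lambda>n::nat. ([n] \<cdot>\<^bsub>K\<^esub> \<one>\<^bsub>K\<^esub>) \<odot>\<^bsub>V\<^esub> x"
    have "range ?f \<subseteq> carrier V" using x by auto
    then have "\<not> inj ?f"
      using assms(4) finite_subset range_inj_infinite by blast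
    then obtain m n where mn: "m < n" "?f m = ?f n"
      by (metis (no_types, lifting) injI linorder_neqE_nat)
    define c where "c = [(n - m)] \<cdot>\<^bsub>K\<^esub> \<one>\<^bsub>K\<^esub>"
    have c: "c \<in> carrier K" "c \<noteq> \<zero>\<^bsub>K\<^esub>"
      using char[of "n - m"] mn by (auto simp: c_def)
    have "[n] \<cdot>\<^bsub>K\<^esub> \<one>\<^bsub>K\<^esub> = [m] \<cdot>\<^bsub>K\<^esub> \<one>\<^bsub>K\<^esub> \<oplus>\<^bsub>K\<^esub> c"
      using K.add.nat_pow_mult[of "\<one>\<^bsub>K\<^esub>" m "n - m"] mn by (simp add: c_def)
    then have "?f m \<oplus>\<^bsub>V\<^esub> c \<odot>\<^bsub>V\<^esub> x = ?f m"
      using mn c x by (simp add: V.smult_l_distr)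
    then have cx: "c \<odot>\<^bsub>V\<^esub> x = \<zero>\<^bsub>V\<^esub>"
      using c x by (simp add: V.M.add.r_cancel_one)
    have inv: "inv\<^bsub>K\<^esub> c \<in> carrier K" "inv\<^bsub>K\<^esub> c \<otimes>\<^bsub>K\<^esub> c = \<one>\<^bsub>K\<^esub>"
      using c by (simp_all add: K.field_Units)
    have "x = (inv\<^bsub>K\<^esub> c \<otimes>\<^bsub>K\<^esub> c) \<odot>\<^bsub>V\<^esub> x"
      using x by (simp add: inv(2))
    also have "\<dots> = inv\<^bsub>K\<^esub> c \<odot>\<^bsub>V\<^esub> (c \<odot>\<^bsub>V\<^esub> x)"
      using c x inv(1) by (rule_tac V.smult_assoc1)
    also have "\<dots> = \<zero>\<^bsub>V\<^esub>"
      using inv(1) by (simp add: cx)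
    finally show ?thesis .
  qed
  then show ?thesis by auto
qed

lemma exists_pair_encoding:
  fixes K :: "('k, 'r) ring_scheme" and V W :: "('k, 'a) module"
  assumes "field K" and "\<And>n::nat. n > 0 \<Longrightarrow> [n] \<cdot>\<^bsub>K\<^esub> \<one>\<^bsub>K\<^esub> \<noteq> \<zero>\<^bsub>K\<^esub>"
    and "module K V" "module K W"
  shows "\<exists>enc :: 'a \<times> 'a \<Rightarrow> 'a. inj_on enc (carrier V \<times> carrier W)"
proof (cases "finite (UNIV :: 'a set)")
  case True
  then have "finite (carrier V)" "finite (carrier W)"
    by (simp_all add: finite_subset[OF subset_UNIV])
  then have "carrier V = {\<zero>\<^bsub>V\<^esub>}" "carrier W = {\<zero>\<^bsub>W\<^esub>}"
    using trivial_if_finite[OF assms(1,2,3)] trivial_if_finite[OF assms(1,2,4)] by simp_all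
  then show ?thesis by simp
next
  case False
  then have "\<exists>enc :: 'a \<times> 'a \<Rightarrow> 'a. bij_betw enc (UNIV \<times> UNIV) UNIV"
    unfolding card_of_ordIso by (rule card_of_Times_same_infinite)
  then obtain enc :: "'a \<times> 'a \<Rightarrow> 'a" where "bij_betw enc (UNIV \<times> UNIV) UNIV" ..
  then show ?thesis
    by (auto simp: bij_betw_def intro: inj_on_subset)
qed

theorem corollary2:
  fixes K :: "('k, 'r) ring_scheme"
  assumes "field K"
    and "\<And>n::nat. n > 0 \<Longrightarrow> [n] \<cdot>\<^bsub>K\<^esub> \<one>\<^bsub>K\<^esub> \<noteq> \<zero>\<^bsub>K\<^esub>"
  shows "two_equivalent
    (two_Lei_inf_Alg K ::
      (('k, 'a) lei_inf, ('k, 'a) lei_inf_mor, ('k, 'a) lei_inf_homotopy) two_cat)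
    (Lei2Alg K ::
      (('k, 'a) lei2, ('k, 'a) lei2_mor, ('k, 'a) lei2_cell) two_cat)"
proof (rule hom_transport.two_equivalent_if_dense[OF kernel_hom_transport])
  fix V :: "('k, 'a) lei_inf" assume "V \<in> obj (two_Lei_inf_Alg K)"
  then interpret leibniz_infinity_algebra K V by simp
  obtain enc :: "'a \<times> 'a \<Rightarrow> 'a" where "inj_on enc (carrier (deg0 V) \<times> carrier (deg1 V))"
    using exists_pair_encoding[OF assms V0.module_axioms V1.module_axioms] by blast
  then interpret pair_encoding K V enc
    by unfold_locales
  show "\<exists>L\<in>obj (Lei2Alg K). \<exists>u\<in>arr (two_Lei_inf_Alg K). \<exists>v\<in>arr (two_Lei_inf_Alg K).
    dom1 (two_Lei_inf_Alg K) u = kernel_algebra L \<and> cod1 (two_Lei_inf_Alg K) u = V \<and>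
    dom1 (two_Lei_inf_Alg K) v = V \<and> cod1 (two_Lei_inf_Alg K) v = kernel_algebra L \<and>
    comp1 (two_Lei_inf_Alg K) v u = id1 (two_Lei_inf_Alg K) (kernel_algebra L) \<and>
    comp1 (two_Lei_inf_Alg K) u v = id1 (two_Lei_inf_Alg K) V"
    using kernel_category_iso by (simp del: two_Lei_inf_Alg_simps(1-3) Lei2Alg_simps)
qed

end
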